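(* Let $\alpha>-1$, $i\in\mathbb{S}$, and let $J$ be the unitary anti-selfadjoint operator $Jf=\operatorname{ext}(if_i)$ on $\mathcal{A}^2_{\alpha,i}(\mathbb{D})$. Let $T$ be a positive (bounded right $\mathbb{H}$-linear) operator on $\mathcal{A}^2_{\alpha,i}(\mathbb{D})$ such that $[T,J]=0$. (i) If $1\le p<+\infty$ and $T\in S_p(J)$, then $\widetilde{T}\in L^p(\mathbb{D}_i,d\mu_i)$. (ii) If $0<p\le1$ and $\widetilde{T}\in L^p(\mathbb{D}_i,d\mu_i)$, then $T\in S_p(J)$.
   Context: $\mathbb{H}$ denotes the quaternions, $\mathbb{D}$ its open unit ball, $\mathbb{S}=\{x\in\mathbb{H}:\operatorname{Re}(x)=0,\ |x|=1\}$, $\mathbb{C}_i=\{a+ib:a,b\in\mathbb{R}\}$, $\mathbb{D}_i=\mathbb{D}\cap\mathbb{C}_i$, and $dm_i$ is Lebesgue measure on $\mathbb{C}_i$. Every $x\in\mathbb{H}$ is written $x=x_0+i_xx_1$ with $x_0=\operatorname{Re}(x)$, $x_1$ the modulus of the imaginary part, $i_x\in\mathbb{S}$. A real differentiable $f:\mathbb{D}\to\mathbb{H}$ is left slice hyperholomorphic if $f(x)=u(x_0,x_1)+i_xv(x_0,x_1)$ with $\mathbb{H}$-valued $u,v$ satisfying $u(x_0,x_1)=u(x_0,-x_1)$, $v(x_0,x_1)=-v(x_0,-x_1)$, $\partial_{x_0}u=\partial_{x_1}v$ and $\partial_{x_0}v=-\partial_{x_1}u$. $dA_{\alpha,i}(z)=\frac{\alpha+1}{\pi}(1-|z|^2)^\alpha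 dm_i(z)$ and $d\mu_i(z)=\frac{1}{\pi(1-|z|^2)^2}dm_i(z)$ on $\mathbb{D}_i$. $\mathcal{A}^2_{\alpha,i}(\mathbb{D})$ is the right $\mathbb{H}$-vector space of all left slice hyperholomorphic $f$ on $\mathbb{D}$ with $\int_{\mathbb{D}_i}|f|^2dA_{\alpha,i}<\infty$, with scalar product $\langle f,g\rangle=\int_{\mathbb{D}_i}\overline{f(z)}g(z)\,dA_{\alpha,i}(z)$; it is a quaternionic reproducing kernel Hilbert space. $K_w$ denotes the unique element with $f(w)=\langle K_w,f\rangle$ for all $f$ (for $z,w\in\mathbb{D}_i$, $K_w(z)=(1-z\overline w)^{-(2+\alpha)}$), $k_w=K_w/\|K_w\|$, and the Berezin transform of $T$ is $\widetilde{T}(z)=\langle k_z,Tk_z\rangle$, $z\in\mathbb{D}_i$. $f_i=f|_{\mathbb{D}_i}$, and $\operatorname{ext}(if_i)$ is the unique left slice hyperholomorphic function on $\mathbb{D}$ whose restriction to $\mathbb{D}_i$ is $z\mapsto i f(z)$. $[T,J]=TJ-JT$. $T$ is positive if $\langle f,Tf\rangle\ge0$ for all $f$. The singular values $\lambda_n(T)$ of a compact operator are the eigenvalues of $|T|=\sqrt{T^*T}$ in decreasing order, counted with multiplicity; $S_p(J)$ ($0<p<\infty$) is the set of compact right $\mathbb{H}$-linear operators $T$ with $[T,J]=0$ and $(\lambda_n(T))_n\in\ell^p$. *)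

theory Defs
  imports "HOL-Analysis.Analysis"
begin

section \<open>The quaternions\<close>

datatype quat = Quat (qRe: real) (qI: real) (qJ: real) (qK: real)

lemma quat_eq_iff: "x = y \<longleftrightarrow> qRe x = qRe y \<and> qI x = qI y \<and> qJ x = qJ y \<and> qK x = qK y"
  by (cases x; cases y) simp

instantiation quat :: ring_1
begin

definition "0 = Quat 0 0 0 0"
definition "1 = Quat 1 0 0 0"
definition "x + y = Quat (qRe x + qRe y) (qI x + qI y) (qJ x + qJ y) (qK x + qK y)"
definition "- x = Quat (- qRe x) (- qI x) (- qJ x) (- qK x)"
definition "x - y = Quat (qRe x - qRe y) (qI x - qI y) (qJ x - qJ y) (qK x - qK y)"
definition "x * y = Quat
  (qRe x * qRe y - qI x * qI y - qJ x * qJ y - qK x * qK y)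
  (qRe x * qI y + qI x * qRe y + qJ x * qK y - qK x * qJ y)
  (qRe x * qJ y - qI x * qK y + qJ x * qRe y + qK x * qI y)
  (qRe x * qK y + qI x * qJ y - qJ x * qI y + qK x * qRe y)"

instance
  by standard
    (simp_all add: quat_eq_iff zero_quat_def one_quat_def plus_quat_def uminus_quat_def
      minus_quat_def times_quat_def algebra_simps)

end

lemma quat_components [simp]:
  "qRe 0 = 0" "qI 0 = 0" "qJ 0 = 0" "qK 0 = 0"
  "qRe 1 = 1" "qI 1 = 0" "qJ 1 = 0" "qK 1 = 0"
  "qRe (x + y) = qRe x + qRe y" "qI (x + y) = qI x + qI y"
  "qJ (x + y) = qJ x + qJ y" "qK (x + y) = qK x + qK y"
  "qRe (- x) = - qRe x" "qI (- x) = - qI x" "qJ (- x) = - qJ x" "qK (- x) = - qK x"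
  "qRe (x - y) = qRe x - qRe y" "qI (x - y) = qI x - qI y"
  "qJ (x - y) = qJ x - qJ y" "qK (x - y) = qK x - qK y"
  by (simp_all add: zero_quat_def one_quat_def plus_quat_def uminus_quat_def minus_quat_def)

lemma quat_mult_components:
  "qRe (x * y) = qRe x * qRe y - qI x * qI y - qJ x * qJ y - qK x * qK y"
  "qI (x * y) = qRe x * qI y + qI x * qRe y + qJ x * qK y - qK x * qJ y"
  "qJ (x * y) = qRe x * qJ y - qI x * qK y + qJ x * qRe y + qK x * qI y"
  "qK (x * y) = qRe x * qK y + qI x * qJ y - qJ x * qI y + qK x * qRe y"
  by (simp_all add: times_quat_def)

definition qcnj :: "quat \<Rightarrow> quat"
  where "qcnj x = Quat (qRe x) (- qI x) (- qJ x) (- qK x)"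

instantiation quat :: real_algebra_1
begin

definition "scaleR r x = Quat (r * qRe x) (r * qI x) (r * qJ x) (r * qK x)"

instance
  by standard
    (simp_all add: quat_eq_iff scaleR_quat_def quat_mult_components algebra_simps)

end

lemma quat_scaleR_components [simp]:
  "qRe (r *\<^sub>R x) = r * qRe x" "qI (r *\<^sub>R x) = r * qI x"
  "qJ (r *\<^sub>R x) = r * qJ x" "qK (r *\<^sub>R x) = r * qK x"
  by (simp_all add: scaleR_quat_def)

lemma quat_of_real_components [simp]:
  "qRe (of_real r) = r" "qI (of_real r) = 0" "qJ (of_real r) = 0" "qK (of_real r) = 0"
  by (simp_all add: of_real_def)

instantiation quat :: real_inner
begin

definition "inner x y = qRe x * qRe y + qI x * qI y + qJ x * qJ y + qK x * qK y"
definition "norm (x::quat) = sqrt (inner x x)"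
definition "sgn (x::quat) = x /\<^sub>R norm x"
definition "dist (x::quat) y = norm (x - y)"
definition
  "(uniformity :: (quat \<times> quat) filter) = (INF e\<in>{0 <..}. principal {(x, y). dist x y < e})"
definition
  "open (U :: quat set) \<longleftrightarrow> (\<forall>x\<in>U. eventually (\<lambda>(x', y). x' = x \<longrightarrow> y \<in> U) uniformity)"

instance
proof
  fix x y z :: quat and r :: real
  show "inner x y = inner y x"
    by (simp add: inner_quat_def algebra_simps)
  show "inner (x + y) z = inner x z + inner y z"
    by (simp add: inner_quat_def algebra_simps)
  show "inner (r *\<^sub>R x) y = r * inner x y"
    by (simp add: inner_quat_def algebra_simps)
  show "0 \<le> inner x x"
    by (simp add: inner_quat_def)
  have "inner x x = (qRe x)\<^sup>2 + (qI x)\<^sup>2 + (qJ x)\<^sup>2 + (qK x)\<^sup>2"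
    by (simp add: inner_quat_def power2_eq_square)
  then show "inner x x = 0 \<longleftrightarrow> x = 0"
    by (simp add: quat_eq_iff add_nonneg_eq_0_iff)
qed (simp_all add: norm_quat_def sgn_quat_def dist_quat_def uniformity_quat_def open_quat_def)

end

instantiation quat :: real_normed_div_algebra
begin

definition "inverse x = qcnj x /\<^sub>R inner x x"
definition "x div (y::quat) = x * inverse y"

instance
proof
  fix x y :: quat
  have cn: "qcnj x * x = of_real (inner x x)" "x * qcnj x = of_real (inner x x)"
    by (simp_all add: quat_eq_iff qcnj_def quat_mult_components inner_quat_def)
  show "inverse x * x = 1" if "x \<noteq> 0"
    using that cn(1) by (simp add: inverse_quat_def of_real_def)
  show "x * inverse x = 1" if "x \<noteq> 0"
    using that cn(2) by (simp add: inverse_quat_def of_real_def)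
  show "x div y = x * inverse y"
    by (simp add: divide_quat_def)
  show "inverse (0::quat) = 0"
    by (simp add: inverse_quat_def)
  have "inner (x * y) (x * y) = inner x x * inner y y"
    unfolding inner_quat_def quat_mult_components by algebra
  then show "norm (x * y) = norm x * norm y"
    by (simp add: norm_quat_def real_sqrt_mult)
qed

end

instantiation quat :: euclidean_space
begin

definition "Basis = {Quat 1 0 0 0, Quat 0 1 0 0, Quat 0 0 1 0, Quat 0 0 0 1}"

instance
proof
  fix x y u v :: quat
  show "finite (Basis :: quat set)" and "(Basis :: quat set) \<noteq> {}"
    by (simp_all add: Basis_quat_def)
  show "inner u v = (if u = v then 1 else 0)" if "u \<in> Basis" "v \<in> Basis"
    using that unfolding Basis_quat_def by (elim insertE emptyE) (simp_all add: inner_quat_def)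
  show "(\<forall>u\<in>Basis. inner x u = 0) \<longleftrightarrow> x = 0"
    unfolding Basis_quat_def by (simp add: inner_quat_def) (simp add: quat_eq_iff)
qed

end


section \<open>Slices, measures and slice hyperholomorphic functions\<close>

definition qball :: "quat set"
  where "qball = ball 0 1"

definition imag_sphere :: "quat set"
  where "imag_sphere = {x. qRe x = 0 \<and> norm x = 1}"

definition qIm :: "quat \<Rightarrow> quat"
  where "qIm x = x - of_real (qRe x)"

definition slice_emb :: "quat \<Rightarrow> complex \<Rightarrow> quat"
  where "slice_emb i z = of_real (Re z) + i * of_real (Im z)"

definition slice_plane :: "quat \<Rightarrow> quat set"
  where "slice_plane i = range (slice_emb i)"

definition slice_disc :: "quat \<Rightarrow> quat set"
  where "slice_disc i = qball \<inter> slice_plane i"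

definition slice_lborel :: "quat \<Rightarrow> quat measure"
  where "slice_lborel i = distr lborel (restrict_space borel (slice_plane i)) (slice_emb i)"

definition bergman_measure :: "real \<Rightarrow> quat \<Rightarrow> quat measure"
  where "bergman_measure \<alpha> i = density (restrict_space (slice_lborel i) (slice_disc i))
    (\<lambda>z. ennreal ((\<alpha> + 1) / pi * (1 - (norm z)\<^sup>2) powr \<alpha>))"

definition moebius_measure :: "quat \<Rightarrow> quat measure"
  where "moebius_measure i = density (restrict_space (slice_lborel i) (slice_disc i))
    (\<lambda>z. ennreal (1 / (pi * (1 - (norm z)\<^sup>2)\<^sup>2)))"

definition Lp_space :: "quat measure \<Rightarrow> real \<Rightarrow> (quat \<Rightarrow> quat) set"
  where "Lp_space M p = {f. f \<in> borel_measurable M \<and> integrable M (\<lambda>z. norm (f z) powr p)}"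

text \<open>For real \<open>x\<close> the imaginary unit in \<open>x = x\<^sub>0 + \<iota> x\<^sub>1\<close> is not unique; the
  representation is required for every such \<open>\<iota>\<close>, which is harmless as
  \<open>v\<close> vanishes at \<open>(x\<^sub>0, 0)\<close> by oddness.\<close>

definition slice_hyperholomorphic :: "(quat \<Rightarrow> quat) \<Rightarrow> bool"
  where "slice_hyperholomorphic f \<longleftrightarrow>
    f differentiable_on qball \<and>
    (\<exists>u v :: real \<Rightarrow> real \<Rightarrow> quat.
      (\<forall>x\<in>qball. \<forall>\<iota>\<in>imag_sphere. x = of_real (qRe x) + \<iota> * of_real (norm (qIm x)) \<longrightarrow>
         f x = u (qRe x) (norm (qIm x)) + \<iota> * v (qRe x) (norm (qIm x))) \<and>
      (\<forall>a b. a\<^sup>2 + b\<^sup>2 < 1 \<longrightarrow>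
         u a b = u a (- b) \<and> v a b = - v a (- b) \<and>
         (\<exists>ua ub va vb.
            ((\<lambda>s. u s b) has_vector_derivative ua) (at a) \<and>
            ((\<lambda>t. u a t) has_vector_derivative ub) (at b) \<and>
            ((\<lambda>s. v s b) has_vector_derivative va) (at a) \<and>
            ((\<lambda>t. v a t) has_vector_derivative vb) (at b) \<and>
            ua = vb \<and> va = - ub)))"

text \<open>Functions on the unit ball are represented by total functions vanishing off the ball, so
  that equality of functions is equality on the ball and pointwise sums and scalar multiples stay
  in the space.\<close>

definition slice_hol_space :: "(quat \<Rightarrow> quat) set"
  where "slice_hol_space = {f. slice_hyperholomorphic f \<and> (\<forall>x. x \<notin> qball \<longrightarrow> f x = 0)}"

definition slice_ext :: "quat \<Rightarrow> (quat \<Rightarrow> quat) \<Rightarrow> quat \<Rightarrow> quat"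
  where "slice_ext i h = (THE g. g \<in> slice_hol_space \<and> (\<forall>z\<in>slice_disc i. g z = h z))"


section \<open>The weighted Bergman space\<close>

definition bergman :: "real \<Rightarrow> quat \<Rightarrow> (quat \<Rightarrow> quat) set"
  where "bergman \<alpha> i =
    {f \<in> slice_hol_space. integrable (bergman_measure \<alpha> i) (\<lambda>z. (norm (f z))\<^sup>2)}"

definition bip :: "real \<Rightarrow> quat \<Rightarrow> (quat \<Rightarrow> quat) \<Rightarrow> (quat \<Rightarrow> quat) \<Rightarrow> quat"
  where "bip \<alpha> i f g = (LINT z|bergman_measure \<alpha> i. qcnj (f z) * g z)"

definition bnorm :: "real \<Rightarrow> quat \<Rightarrow> (quat \<Rightarrow> quat) \<Rightarrow> real"
  where "bnorm \<alpha> i f = sqrt (qRe (bip \<alpha> i f f))"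

definition kernel :: "real \<Rightarrow> quat \<Rightarrow> quat \<Rightarrow> quat \<Rightarrow> quat"
  where "kernel \<alpha> i w = (THE K. K \<in> bergman \<alpha> i \<and> (\<forall>f\<in>bergman \<alpha> i. f w = bip \<alpha> i K f))"

definition normalized_kernel :: "real \<Rightarrow> quat \<Rightarrow> quat \<Rightarrow> quat \<Rightarrow> quat"
  where "normalized_kernel \<alpha> i w = (\<lambda>z. kernel \<alpha> i w z / of_real (bnorm \<alpha> i (kernel \<alpha> i w)))"


section \<open>Operators on the weighted Bergman space\<close>

type_synonym qop = "(quat \<Rightarrow> quat) \<Rightarrow> (quat \<Rightarrow> quat)"

text \<open>Operators are extensional functions on the Bergman space, so that operators are equal iff
  they agree on the space.\<close>

definition bounded_ops :: "real \<Rightarrow> quat \<Rightarrow> qop set"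
  where "bounded_ops \<alpha> i = {T \<in> bergman \<alpha> i \<rightarrow>\<^sub>E bergman \<alpha> i.
    (\<forall>f\<in>bergman \<alpha> i. \<forall>g\<in>bergman \<alpha> i. T (\<lambda>x. f x + g x) = (\<lambda>x. T f x + T g x)) \<and>
    (\<forall>f\<in>bergman \<alpha> i. \<forall>a. T (\<lambda>x. f x * a) = (\<lambda>x. T f x * a)) \<and>
    (\<exists>C. \<forall>f\<in>bergman \<alpha> i. bnorm \<alpha> i (T f) \<le> C * bnorm \<alpha> i f)}"

definition J_op :: "real \<Rightarrow> quat \<Rightarrow> qop"
  where "J_op \<alpha> i = (\<lambda>f\<in>bergman \<alpha> i. slice_ext i (\<lambda>z. i * f z))"

definition zero_op :: "real \<Rightarrow> quat \<Rightarrow> qop"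
  where "zero_op \<alpha> i = (\<lambda>f\<in>bergman \<alpha> i. \<lambda>x. 0)"

definition op_commutator :: "real \<Rightarrow> quat \<Rightarrow> qop \<Rightarrow> qop \<Rightarrow> qop"
  where "op_commutator \<alpha> i A B = (\<lambda>f\<in>bergman \<alpha> i. \<lambda>x. A (B f) x - B (A f) x)"

definition positive_op :: "real \<Rightarrow> quat \<Rightarrow> qop \<Rightarrow> bool"
  where "positive_op \<alpha> i T \<longleftrightarrow> (\<forall>f\<in>bergman \<alpha> i. \<exists>r\<ge>0. bip \<alpha> i f (T f) = of_real r)"

definition op_adjoint :: "real \<Rightarrow> quat \<Rightarrow> qop \<Rightarrow> qop"
  where "op_adjoint \<alpha> i T = (THE S. S \<in> bounded_ops \<alpha> i \<and>
    (\<forall>f\<in>bergman \<alpha> i. \<forall>g\<in>bergman \<alpha> i. bip \<alpha> i (S f) g = bip \<alpha> i f (T g)))"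

definition op_sqrt :: "real \<Rightarrow> quat \<Rightarrow> qop \<Rightarrow> qop"
  where "op_sqrt \<alpha> i P = (THE S. S \<in> bounded_ops \<alpha> i \<and> positive_op \<alpha> i S \<and>
    compose (bergman \<alpha> i) S S = P)"

definition op_abs :: "real \<Rightarrow> quat \<Rightarrow> qop \<Rightarrow> qop"
  where "op_abs \<alpha> i T = op_sqrt \<alpha> i (compose (bergman \<alpha> i) (op_adjoint \<alpha> i T) T)"

definition compact_op :: "real \<Rightarrow> quat \<Rightarrow> qop \<Rightarrow> bool"
  where "compact_op \<alpha> i T \<longleftrightarrow> T \<in> bounded_ops \<alpha> i \<and>
    (\<forall>F :: nat \<Rightarrow> quat \<Rightarrow> quat. \<forall>C. (\<forall>n. F n \<in> bergman \<alpha> i \<and> bnorm \<alpha> i (F n) \<le> C) \<longrightarrow>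
      (\<exists>r :: nat \<Rightarrow> nat. \<exists>g\<in>bergman \<alpha> i. strict_mono r \<and>
        (\<lambda>n. bnorm \<alpha> i (\<lambda>x. T (F (r n)) x - g x)) \<longlonglongrightarrow> 0))"

text \<open>The library's notion of dimension needs a commutative field of scalars. Here \<open>V\<close> has a
  finite basis of \<open>n\<close> elements as a right quaternionic vector space.\<close>

definition has_right_dim :: "(quat \<Rightarrow> quat) set \<Rightarrow> nat \<Rightarrow> bool"
  where "has_right_dim V n \<longleftrightarrow> (\<exists>B. finite B \<and> card B = n \<and>
    V = {f. \<exists>c. f = (\<lambda>x. \<Sum>b\<in>B. b x * c b)} \<and>
    (\<forall>c. (\<forall>x. (\<Sum>b\<in>B. b x * c b) = 0) \<longrightarrow> (\<forall>b\<in>B. c b = 0)))"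

definition eigenspace :: "real \<Rightarrow> quat \<Rightarrow> qop \<Rightarrow> real \<Rightarrow> (quat \<Rightarrow> quat) set"
  where "eigenspace \<alpha> i A \<mu> = {f \<in> bergman \<alpha> i. A f = (\<lambda>x. f x * of_real \<mu>)}"

text \<open>The decreasing sequence of eigenvalues of \<open>|T|\<close>, in which each \<open>\<mu> > 0\<close> occurs as often as the
  quaternionic dimension of its eigenspace; it is filled up with zeros if \<open>|T|\<close> has only finitely
  many positive eigenvalues. All eigenvalues of \<open>|T|\<close> are real, since \<open>|T|\<close> is positive.\<close>

definition singular_value :: "real \<Rightarrow> quat \<Rightarrow> qop \<Rightarrow> nat \<Rightarrow> real"
  where "singular_value \<alpha> i T = (THE s. decseq s \<and> (\<forall>n. 0 \<le> s n) \<and>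
    (\<forall>\<mu>>0. finite {n. s n = \<mu>} \<and>
      has_right_dim (eigenspace \<alpha> i (op_abs \<alpha> i T) \<mu>) (card {n. s n = \<mu>})))"

definition schatten_class :: "real \<Rightarrow> quat \<Rightarrow> qop \<Rightarrow> real \<Rightarrow> qop set"
  where "schatten_class \<alpha> i J p = {T. compact_op \<alpha> i T \<and> op_commutator \<alpha> i T J = zero_op \<alpha> i \<and>
    summable (\<lambda>n. singular_value \<alpha> i T n powr p)}"

definition berezin :: "real \<Rightarrow> quat \<Rightarrow> qop \<Rightarrow> quat \<Rightarrow> quat"
  where "berezin \<alpha> i T z =
    bip \<alpha> i (normalized_kernel \<alpha> i z) (T (normalized_kernel \<alpha> i z))"

end

theory Submission
  imports Defs "HOL-Complex_Analysis.Complex_Analysis" "HOL-Real_Asymp.Real_Asymp"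
    "HOL-Library.Function_Algebras"
begin

text \<open>
  A compact positive \<open>T\<close> has an orthonormal system of eigenvectors \<open>e\<^sub>k\<close> with eigenvalues \<open>\<lambda>\<^sub>k\<close>, so
  its Berezin transform at \<open>z\<close> is the mean of the \<open>\<lambda>\<^sub>k\<close> with weights
  \<open>w\<^sub>k(z) = |e\<^sub>k(z)|\<^sup>2 / K\<^sub>z(z)\<close>. These weights have total mass at most 1 for fixed \<open>z\<close> (Bessel), and
  \<open>\<integral> w\<^sub>k d\<mu>\<^sub>i = 1 / (\<alpha> + 1)\<close> for fixed \<open>k\<close>, because \<open>K\<^sub>z(z)\<close> is \<open>1 - |z|\<^sup>2\<close> to the power \<open>- (\<alpha> + 2)\<close>.
  Jensen's inequality, integrated in \<open>z\<close>, therefore compares \<open>\<Sum>\<^sub>k \<lambda>\<^sub>k\<^sup>p\<close> with the integral of the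
  \<open>p\<close>-th power of the Berezin transform, in one direction for \<open>p \<ge> 1\<close> and in the other for \<open>p \<le> 1\<close>.

  In (ii) compactness comes first. The Berezin transform is bounded, hence integrable. If
  \<open>v\<^sub>1, \<dots>, v\<^sub>n\<close> are orthonormal for the form \<open>\<langle>f, T g\<rangle>\<close>, then Bessel's inequality for this form bounds
  \<open>\<Sum>\<^sub>k |T v\<^sub>k(z)|\<^sup>2 / K\<^sub>z(z)\<close> by the Berezin transform, so \<open>\<Sum>\<^sub>k \<parallel>T v\<^sub>k\<parallel>\<^sup>2\<close> is bounded by a constant. A
  system nearly attaining the supremum leaves a remainder of \<open>T\<close> of small norm, so \<open>T\<close> is a limit of
  operators of finite rank.
\<close>

section \<open>Lebesgue measure on the complex disc\<close>

text \<open>In (ii) compactness has to be shown before any eigenvector exists, and no square root of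
  \<open>T\<close> is at hand. Orthonormality for the form <f, T g> replaces it: the vectors g_k =
  T^(1/2) v_k would be orthonormal in the ordinary sense and |T v_k|^2 = <g_k, T g_k>, so the
  bounded sums are partial traces of \<open>T\<close>. The kernel, the adjoint, the square root and
  the singular values are definite descriptions, hence each needs existence and uniqueness. For the
  singular values this amounts to |T| = T, to uniqueness of the positive square root of T^2 (where
  the eigenvectors decide, \<open>T\<close> being compact by then), and to the invariance of
  dimension over a noncommutative division ring. All integrals are moved from the slice to the unit
  disc of \<open>complex\<close>. There an element of the Bergman space is a pair of holomorphic
  functions, and power series and rotations of the disc give the reproducing kernel.\<close>

lemma borel_measurable_Complex [measurable (raw)]:
  assumes "f \<in> borel_measurable M" "g \<in> borel_measurable M"
  shows "(\<lambda>x. Complex (f x) (g x)) \<in> borel_measurable M"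
  using assms by (simp add: Complex_eq)

text \<open>Lebesgue measure is determined by its values on boxes. The identification opens Fubini
  on the complex plane.\<close>

lemma lborel_complex_eq_pair:
  "(lborel :: complex measure) = distr (lborel \<Otimes>\<^sub>M lborel) borel (\<lambda>(x, y). Complex x y)"
proof (rule lborel_eqI)
  have meas: "(\<lambda>(x, y). Complex x y) \<in> borel_measurable (lborel \<Otimes>\<^sub>M lborel)"
    by (simp add: split_beta' cong: measurable_cong_sets)
  fix l u :: complex
  assume le: "\<And>b. b \<in> Basis \<Longrightarrow> l \<bullet> b \<le> u \<bullet> b"
  have 1: "Re l \<le> Re u" "Im l \<le> Im u"
    using le[of 1] le[of \<i>] by (simp_all add: Basis_complex_def inner_complex_def)
  have "(\<lambda>(x, y). Complex x y) -` box l u \<inter> space (lborel \<Otimes>\<^sub>M lborel)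
      = {Re l<..<Re u} \<times> {Im l<..<Im u}"
    by (auto simp: box_def Basis_complex_def inner_complex_def space_pair_measure)
  with meas have "emeasure (distr (lborel \<Otimes>\<^sub>M lborel) borel (\<lambda>(x, y). Complex x y)) (box l u)
      = emeasure (lborel \<Otimes>\<^sub>M lborel) ({Re l<..<Re u} \<times> {Im l<..<Im u})"
    by (simp add: emeasure_distr)
  also have "\<dots> = ennreal ((Re u - Re l) * (Im u - Im l))"
    using 1 by (subst lborel.emeasure_pair_measure_Times) (auto simp: ennreal_mult)
  finally show "emeasure (distr (lborel \<Otimes>\<^sub>M lborel) borel (\<lambda>(x, y). Complex x y)) (box l u)
      = (\<Prod>b\<in>Basis. (u - l) \<bullet> b)"
    by (simp add: Basis_complex_def inner_complex_def)
qed simp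

lemma nn_integral_complex:
  fixes f :: "complex \<Rightarrow> ennreal"
  assumes [measurable]: "f \<in> borel_measurable borel"
  shows "(\<integral>\<^sup>+z. f z \<partial>lborel) = (\<integral>\<^sup>+y. \<integral>\<^sup>+x. f (Complex x y) \<partial>lborel \<partial>lborel)"
    and "(\<integral>\<^sup>+z. f z \<partial>lborel) = (\<integral>\<^sup>+x. \<integral>\<^sup>+y. f (Complex x y) \<partial>lborel \<partial>lborel)"
proof -
  have meas: "(\<lambda>(x, y). Complex x y) \<in> borel_measurable (lborel \<Otimes>\<^sub>M lborel)"
    by (simp add: split_beta' cong: measurable_cong_sets)
  have [measurable]: "(\<lambda>p. f (Complex (fst p) (snd p))) \<in> borel_measurable (lborel \<Otimes>\<^sub>M lborel)"
    using measurable_compose[OF meas assms] by (simp add: split_beta')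
  have eq: "(\<integral>\<^sup>+z. f z \<partial>lborel) = (\<integral>\<^sup>+p. f (Complex (fst p) (snd p)) \<partial>(lborel \<Otimes>\<^sub>M lborel))"
    by (subst lborel_complex_eq_pair) (use meas in \<open>simp add: nn_integral_distr split_beta'\<close>)
  show 2: "(\<integral>\<^sup>+z. f z \<partial>lborel) = (\<integral>\<^sup>+x. \<integral>\<^sup>+y. f (Complex x y) \<partial>lborel \<partial>lborel)"
    unfolding eq by (subst lborel.nn_integral_fst[symmetric]) simp_all
  show "(\<integral>\<^sup>+z. f z \<partial>lborel) = (\<integral>\<^sup>+y. \<integral>\<^sup>+x. f (Complex x y) \<partial>lborel \<partial>lborel)"
    unfolding 2
    by (subst lborel_pair.Fubini'[symmetric]) (simp_all add: split_beta')
qed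

text \<open>For a fixed value of the unchanged coordinate a shear is a translation of the other one,
  so each identity follows from Fubini with the translated coordinate innermost.\<close>

lemma nn_integral_shear:
  fixes f :: "complex \<Rightarrow> ennreal"
  assumes [measurable]: "f \<in> borel_measurable borel"
  shows "(\<integral>\<^sup>+z. f (Complex (Re z + t * Im z) (Im z)) \<partial>lborel) = (\<integral>\<^sup>+z. f z \<partial>lborel)"
    and "(\<integral>\<^sup>+z. f (Complex (Re z) (Im z + t * Re z)) \<partial>lborel) = (\<integral>\<^sup>+z. f z \<partial>lborel)"
proof -
  have transl: "(\<integral>\<^sup>+x. g (x + c) \<partial>lborel) = (\<integral>\<^sup>+x. g x \<partial>lborel)"
    if "g \<in> borel_measurable borel" for g :: "real \<Rightarrow> ennreal" and c
    using nn_integral_real_affine[OF that, of 1 c] by (simp add: add.commute)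
  have m: "(\<lambda>x. Complex x y) \<in> borel_measurable borel"
      "(\<lambda>y. Complex x y) \<in> borel_measurable borel" for x y
    by measurable
  have m1: "(\<lambda>x. f (Complex x y)) \<in> borel_measurable borel"
      "(\<lambda>y. f (Complex x y)) \<in> borel_measurable borel" for x y
    using measurable_compose[OF m(1) assms] measurable_compose[OF m(2) assms] by auto
  have m2: "(\<lambda>z. Complex (Re z + t * Im z) (Im z)) \<in> borel_measurable borel"
      "(\<lambda>z. Complex (Re z) (Im z + t * Re z)) \<in> borel_measurable borel"
    by measurable
  show "(\<integral>\<^sup>+z. f (Complex (Re z + t * Im z) (Im z)) \<partial>lborel) = (\<integral>\<^sup>+z. f z \<partial>lborel)"
    by (subst (1 2) nn_integral_complex(1))
      (use measurable_compose[OF m2(1) assms] transl[OF m1(1)] in auto)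
  show "(\<integral>\<^sup>+z. f (Complex (Re z) (Im z + t * Re z)) \<partial>lborel) = (\<integral>\<^sup>+z. f z \<partial>lborel)"
    by (subst (1 2) nn_integral_complex(2))
      (use measurable_compose[OF m2(2) assms] transl[OF m1(2)] in auto)
qed

text \<open>A rotation is a product of three shears.\<close>

lemma nn_integral_rotate:
  fixes f :: "complex \<Rightarrow> ennreal"
  assumes [measurable]: "f \<in> borel_measurable borel" and \<omega>: "norm \<omega> = 1" "Im \<omega> \<noteq> 0"
  shows "(\<integral>\<^sup>+z. f (\<omega> * z) \<partial>lborel) = (\<integral>\<^sup>+z. f z \<partial>lborel)"
proof -
  define s where "s = Im \<omega>"
  define c where "c = Re \<omega>"
  \<comment> \<open>For \<omega> = cis \<theta> this is tan (\<theta> / 2), the half-angle parameter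
    of the outer shears; the division needs \<open>Im \<omega>\<close> to be nonzero.\<close>
  define t where "t = (1 - c) / s"
  have sc: "c\<^sup>2 + s\<^sup>2 = 1" "s \<noteq> 0"
    using \<omega> cmod_power2[of \<omega>] by (simp_all add: s_def c_def)
  have st: "s * t = 1 - c" using sc by (simp add: t_def)
  have tc: "t * (1 + c) = s"
    using sc by (simp add: t_def field_simps power2_eq_square)
  have stt: "s * t * t = (1 - c) * t" using st by simp
  define S where "S = (\<lambda>a z. Complex (Re z + a * Im z) (Im z))"
  define R where "R = (\<lambda>a z. Complex (Re z) (Im z + a * Re z))"
  have [measurable]: "S a \<in> borel_measurable borel" "R a \<in> borel_measurable borel" for a
    unfolding S_def R_def by measurable
  have "\<omega> * z = S (-t) (R s (S (-t) z))" for z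
  proof -
    have "Re (S (-t) (R s (S (-t) z))) = (1 - s * t) * Re z - (t + t * (1 - s * t)) * Im z"
      by (simp add: S_def R_def algebra_simps)
    also have "t + t * (1 - s * t) = s" using tc stt by (simp add: algebra_simps)
    finally have 1: "Re (S (-t) (R s (S (-t) z))) = Re (\<omega> * z)"
      using st by (simp add: s_def c_def)
    have "Im (S (-t) (R s (S (-t) z))) = (1 - s * t) * Im z + s * Re z"
      by (simp add: S_def R_def algebra_simps)
    then have "Im (S (-t) (R s (S (-t) z))) = Im (\<omega> * z)"
      using st by (simp add: s_def c_def)
    with 1 show ?thesis by (simp add: complex_eq_iff)
  qed
  then have "(\<integral>\<^sup>+z. f (\<omega> * z) \<partial>lborel) = (\<integral>\<^sup>+z. f (S (-t) (R s (S (-t) z))) \<partial>lborel)"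
    by simp
  also have "\<dots> = (\<integral>\<^sup>+z. f (S (-t) (R s z)) \<partial>lborel)"
    by (subst nn_integral_shear(1)[of "\<lambda>z. f (S (-t) (R s z))" "-t", symmetric])
      (simp_all add: S_def)
  also have "\<dots> = (\<integral>\<^sup>+z. f (S (-t) z) \<partial>lborel)"
    by (subst nn_integral_shear(2)[of "\<lambda>z. f (S (-t) z)" s, symmetric])
      (simp_all add: R_def)
  also have "\<dots> = (\<integral>\<^sup>+z. f z \<partial>lborel)"
    by (subst nn_integral_shear(1)[of f "-t", symmetric]) (simp_all add: S_def)
  finally show ?thesis .
qed

text \<open>The annulus x < |z|^2 < 1 has area pi (1 - x), so the map z to |z|^2 sends area on the
  disc to pi times Lebesgue measure on [0, 1). Working with the square of the modulus keeps the
  density constant.\<close>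

lemma nn_integral_disc_radial:
  fixes g :: "real \<Rightarrow> ennreal"
  assumes [measurable]: "g \<in> borel_measurable borel"
  shows "(\<integral>\<^sup>+z. g ((norm z)\<^sup>2) * indicator (ball 0 1) z \<partial>(lborel :: complex measure))
    = ennreal pi * (\<integral>\<^sup>+t. g t * indicator {0..<1} t \<partial>lborel)"
proof -
  let ?h = "\<lambda>z::complex. (norm z)\<^sup>2"
  define M where "M = distr (density lborel (indicator (ball 0 1))) borel ?h"
  define N :: "real measure" where "N = density lborel (\<lambda>t. ennreal pi * indicator {0..<1} t :: ennreal)"
  have eM: "emeasure M {x<..} = ennreal (pi * (1 - max 0 (min 1 x)))" for x
  proof -
    let ?B = "ball 0 1 :: complex set"
    have "emeasure M {x<..} = emeasure lborel ({z. x < ?h z} \<inter> ?B)"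
    proof -
      have "emeasure M {x<..} = emeasure (density lborel (indicator ?B)) {z. x < ?h z}"
        unfolding M_def by (subst emeasure_distr) (auto simp: vimage_def)
      also have "\<dots> = (\<integral>\<^sup>+z. indicator ({z. x < ?h z} \<inter> ?B) z \<partial>lborel)"
        by (subst emeasure_density)
          (auto intro!: nn_integral_cong borel_measurable_indicator split: split_indicator
            simp del: nn_integral_indicator)
      finally show ?thesis by simp
    qed
    also have "\<dots> = ennreal (pi * (1 - max 0 (min 1 x)))"
    proof (cases "x < 0 \<or> 1 \<le> x")
      case True
      then show ?thesis
      proof
        assume "x < 0"
        then have "{z. x < ?h z} \<inter> ?B = ?B" by (auto intro: less_le_trans)
        with \<open>x < 0\<close> show ?thesis by (simp add: emeasure_ball unit_ball_vol_2)
      next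
        assume "1 \<le> x"
        have "?h z < 1" if "z \<in> ?B" for z
          using that by (simp add: power_less_one_iff)
        with \<open>1 \<le> x\<close> have "{z. x < ?h z} \<inter> ?B = {}" by fastforce
        with \<open>1 \<le> x\<close> show ?thesis by simp
      qed
    next
      case False
      then have x: "0 \<le> x" "x < 1" by auto
      have "{z. x < ?h z} = {z::complex. sqrt x < norm z}"
        by (intro Collect_cong) (subst real_sqrt_less_iff[symmetric], simp)
      then have "{z. x < ?h z} \<inter> ?B = ?B - cball 0 (sqrt x)"
        by (simp only:) (simp add: set_eq_iff not_le conj_commute)
      moreover have "cball 0 (sqrt x) \<subseteq> ?B"
        using x by (simp add: cball_subset_ball_iff)
      ultimately have "emeasure lborel ({z. x < ?h z} \<inter> ?B)
          = emeasure lborel ?B - emeasure lborel (cball (0::complex) (sqrt x))"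
        using x by (simp add: emeasure_Diff emeasure_cball)
      also have "\<dots> = ennreal (pi * (1 - x))"
        using x by (simp add: emeasure_ball emeasure_cball unit_ball_vol_2 ennreal_minus
            algebra_simps)
      finally show ?thesis using x by simp
    qed
    finally show ?thesis .
  qed
  have eN: "emeasure N {x<..} = ennreal (pi * (1 - max 0 (min 1 x)))" for x
  proof -
    have "emeasure N {x<..} = ennreal pi * (\<integral>\<^sup>+t. indicator ({0..<1} \<inter> {x<..}) t \<partial>lborel)"
      unfolding N_def
      by (simp add: emeasure_density nn_integral_cmult mult.assoc indicator_inter_arith)
    also have "(\<integral>\<^sup>+t. indicator ({0..<1} \<inter> {x<..}) t \<partial>lborel) = emeasure lborel ({0..<1} \<inter> {x<..})"
      by simp
    also have "{0..<1} \<inter> {x<..} = (if x < 0 then {0..<1} else {x<..<1})" by auto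
    also have "emeasure lborel \<dots> = ennreal (1 - max 0 (min 1 x))" by (auto simp: max_def min_def)
    finally show ?thesis by (simp add: ennreal_mult)
  qed
  have "M = N"
    by (rule measure_eqI_lessThan) (simp_all add: eM eN, simp_all add: M_def N_def)
  have "(\<integral>\<^sup>+z. g (?h z) * indicator (ball 0 1) z \<partial>lborel) = (\<integral>\<^sup>+t. g t \<partial>M)"
    unfolding M_def
    by (subst nn_integral_distr, simp_all, subst nn_integral_density)
      (auto intro!: borel_measurable_indicator simp: mult.commute)
  also have "\<dots> = ennreal pi * (\<integral>\<^sup>+t. g t * indicator {0..<1} t \<partial>lborel)"
    unfolding \<open>M = N\<close> N_def
    by (subst nn_integral_cmult[symmetric]) (simp_all add: nn_integral_density mult_ac)
  finally show ?thesis .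
qed

section \<open>Radially weighted measures on the disc: rotation invariance and orthogonality of
  monomials\<close>

lemma borel_measurable_cnj [measurable]: "cnj \<in> borel_measurable borel"
  by (intro borel_measurable_continuous_onI continuous_intros)

lemma sets_borel_ball [measurable]: "ball (x :: 'a::metric_space) r \<in> sets borel"
  by simp

text \<open>The weight is a function of |z|^2, so that one development serves both the Bergman
  measure and the Moebius invariant measure.\<close>

definition disc_measure :: "(real \<Rightarrow> real) \<Rightarrow> complex measure" where
  "disc_measure w = density (restrict_space lborel (ball 0 1)) (\<lambda>z. ennreal (w ((norm z)\<^sup>2)))"

lemma space_disc_measure [simp]: "space (disc_measure w) = ball 0 1"
  by (simp add: disc_measure_def space_restrict_space)

lemma sets_disc_measure [measurable_cong]:
  "sets (disc_measure w) = sets (restrict_space borel (ball 0 1))"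
  by (simp add: disc_measure_def sets_restrict_space)

lemma measurable_disc_measure_continuous:
  fixes f :: "complex \<Rightarrow> 'a::topological_space"
  assumes "continuous_on (ball 0 1) f"
  shows "f \<in> borel_measurable (disc_measure w)"
  unfolding measurable_cong_sets[OF sets_disc_measure refl]
  by (rule borel_measurable_continuous_on_restrict[OF assms])

lemma measurable_disc_measure_borel:
  "f \<in> borel_measurable borel \<Longrightarrow> f \<in> borel_measurable (disc_measure w)"
  unfolding measurable_cong_sets[OF sets_disc_measure refl]
  by (rule measurable_restrict_space1)

lemma nn_integral_disc_measure:
  assumes [measurable]: "w \<in> borel_measurable borel" and f: "f \<in> borel_measurable (disc_measure w)"
  shows "(\<integral>\<^sup>+z. f z \<partial>disc_measure w)
    = (\<integral>\<^sup>+z. ennreal (w ((norm z)\<^sup>2)) * f z * indicator (ball 0 1) z \<partial>lborel)"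
proof -
  have f': "f \<in> borel_measurable (restrict_space lborel (ball 0 1))"
    using f measurable_cong_sets[of "disc_measure w" "restrict_space lborel (ball 0 1)" borel borel]
    by (simp add: sets_disc_measure sets_restrict_space)
  have w: "(\<lambda>z::complex. ennreal (w ((norm z)\<^sup>2))) \<in> borel_measurable (restrict_space lborel (ball 0 1))"
    by (rule measurable_restrict_space1) measurable
  show ?thesis
    unfolding disc_measure_def
    by (subst nn_integral_density[OF w f']) (simp add: nn_integral_restrict_space)
qed

lemma nn_integral_disc_measure_radial:
  assumes [measurable]: "w \<in> borel_measurable borel" "g \<in> borel_measurable borel"
  shows "(\<integral>\<^sup>+z. g ((norm z)\<^sup>2) \<partial>disc_measure w)
    = ennreal pi * (\<integral>\<^sup>+t. ennreal (w t) * g t * indicator {0..<1} t \<partial>lborel)"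
  by (subst nn_integral_disc_measure)
    (simp_all add: measurable_disc_measure_borel nn_integral_disc_radial[of "\<lambda>t. ennreal (w t) * g t"])

lemma measurable_disc_measure_rotate:
  assumes "norm \<omega> = 1"
  shows "(\<lambda>z. \<omega> * z) \<in> measurable (disc_measure w) (disc_measure w)"
  unfolding measurable_cong_sets[OF sets_disc_measure sets_disc_measure]
  by (rule measurable_restrict_space3) (auto simp: norm_mult assms)

lemma distr_disc_measure_rotate:
  assumes [measurable]: "w \<in> borel_measurable borel" and \<omega>: "norm \<omega> = 1" "Im \<omega> \<noteq> 0"
  shows "distr (disc_measure w) (disc_measure w) (\<lambda>z. \<omega> * z) = disc_measure w"
proof (rule measure_eqI)
  note m = measurable_disc_measure_rotate[OF \<omega>(1), of w]
  fix A assume A: "A \<in> sets (distr (disc_measure w) (disc_measure w) (\<lambda>z. \<omega> * z))"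
  then have A': "A \<in> sets (disc_measure w)" by simp
  then have [measurable]: "A \<in> sets borel" and sub: "A \<subseteq> ball 0 1"
    by (auto simp: sets_disc_measure sets_restrict_space)
  let ?g = "\<lambda>z. ennreal (w ((norm z)\<^sup>2)) * indicator A z * indicator (ball 0 1) z"
  have "emeasure (distr (disc_measure w) (disc_measure w) (\<lambda>z. \<omega> * z)) A
      = (\<integral>\<^sup>+z. indicator A z \<partial>distr (disc_measure w) (disc_measure w) (\<lambda>z. \<omega> * z))"
    using A by simp
  also have "\<dots> = (\<integral>\<^sup>+z. indicator A (\<omega> * z) \<partial>disc_measure w)"
    by (subst nn_integral_distr[OF m]) (use A' in auto)
  also have "\<dots> = (\<integral>\<^sup>+z. ?g (\<omega> * z) \<partial>lborel)"
    by (subst nn_integral_disc_measure)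
      (auto intro!: measurable_disc_measure_borel nn_integral_cong
         simp: norm_mult \<omega> split: split_indicator)
  also have "\<dots> = (\<integral>\<^sup>+z. ?g z \<partial>lborel)"
    by (rule nn_integral_rotate[OF _ \<omega>]) measurable
  also have "\<dots> = (\<integral>\<^sup>+z. indicator A z \<partial>disc_measure w)"
    by (subst nn_integral_disc_measure) (auto intro!: measurable_disc_measure_borel)
  finally show "emeasure (distr (disc_measure w) (disc_measure w) (\<lambda>z. \<omega> * z)) A
      = emeasure (disc_measure w) A"
    using A' by simp
qed simp

text \<open>Invariance under the rotation turns the integral I into c I.\<close>

lemma integral_disc_measure_rotate_eq_0:
  fixes f :: "complex \<Rightarrow> complex"
  assumes "w \<in> borel_measurable borel" and f: "f \<in> borel_measurable (disc_measure w)"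
    and \<omega>: "norm \<omega> = 1" "Im \<omega> \<noteq> 0" and c: "c \<noteq> 1" "\<And>z. f (\<omega> * z) = c * f z"
  shows "(LINT z|disc_measure w. f z) = 0"
proof -
  note m = measurable_disc_measure_rotate[OF \<omega>(1), of w]
  have "(LINT z|disc_measure w. f z) = (LINT z|disc_measure w. f (\<omega> * z))"
    by (subst distr_disc_measure_rotate[OF assms(1) \<omega>, symmetric], subst integral_distr[OF m f]) simp
  also have "\<dots> = c * (LINT z|disc_measure w. f z)"
    by (simp add: c)
  finally show ?thesis using c(1) by simp
qed

text \<open>The cut-off to a smaller concentric disc is invariant under rotations as well; it is
  there because power series are integrated termwise only on smaller discs.\<close>

lemma integral_disc_measure_monomials:
  assumes w: "w \<in> borel_measurable borel" and "m \<noteq> n"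
  shows "(LINT z|disc_measure w. indicator (ball 0 R) z * (cnj z ^ m * z ^ n)) = 0"
proof -
  define k where "k = (if m < n then n - m else m - n)"
  \<comment> \<open>The rotation multiplies the integrand by the k-th power of \<omega> or of its
    conjugate, hence by i or -i. The more obvious choice of a factor -1 would give a real \<omega>
    for k = 1, which the three shears exclude.\<close>
  define \<omega> where "\<omega> = cis (pi / (2 * real k))"
  have k: "k \<noteq> 0" using \<open>m \<noteq> n\<close> by (simp add: k_def)
  have "\<omega> ^ k = cis (real k * (pi / (2 * real k)))"
    by (simp only: \<omega>_def Complex.DeMoivre)
  also have "real k * (pi / (2 * real k)) = pi / 2" using k by simp
  finally have wk: "\<omega> ^ k = \<i>" by simp
  have "0 < pi / (2 * real k)" "pi / (2 * real k) < pi"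
    using k by (simp_all add: field_simps)
  then have im: "Im \<omega> \<noteq> 0" using sin_gt_zero by (force simp: \<omega>_def)
  have n1: "norm \<omega> = 1" by (simp add: \<omega>_def)
  then have cw: "cnj \<omega> * \<omega> = 1"
    using complex_norm_square[of \<omega>] by (simp add: mult.commute)
  have cwp: "cnj \<omega> ^ j * \<omega> ^ j = 1" for j
    by (simp add: power_mult_distrib[symmetric] cw)
  define c where "c = cnj \<omega> ^ m * \<omega> ^ n"
  have "c = (if m < n then \<i> else - \<i>)"
  proof (cases "m < n")
    case True
    then have "\<omega> ^ n = \<omega> ^ m * \<omega> ^ k" by (simp add: k_def power_add[symmetric])
    with cwp[of m] True show ?thesis by (simp add: c_def wk mult.assoc[symmetric])
  next
    case False
    then have "cnj \<omega> ^ m = cnj \<omega> ^ k * cnj \<omega> ^ n" by (simp add: k_def power_add[symmetric])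
    moreover have "cnj \<omega> ^ k = - \<i>" using wk by (simp flip: complex_cnj_power)
    ultimately show ?thesis using False cwp[of n] by (simp add: c_def mult.assoc)
  qed
  then have "c \<noteq> 1" by (auto simp: complex_eq_iff)
  show ?thesis
    by (rule integral_disc_measure_rotate_eq_0[OF w _ n1 im \<open>c \<noteq> 1\<close>])
      (auto intro!: measurable_disc_measure_borel simp: c_def power_mult_distrib norm_mult n1
        indicator_def mult_ac)
qed

text \<open>On a disc of radius R < 1 the Taylor series of \<open>F\<close> converges absolutely and
  uniformly, so it may be integrated termwise, and orthogonality leaves only the n-th term.
  Dominated convergence then lets R tend to 1, where termwise integration is not directly
  available.\<close>

lemma integral_disc_measure_monomial_times:
  assumes w: "w \<in> borel_measurable borel" and fin: "finite_measure (disc_measure w)"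
    and F: "F holomorphic_on ball 0 1" and int: "integrable (disc_measure w) F"
  shows "(LINT z|disc_measure w. cnj z ^ n * F z)
    = (deriv ^^ n) F 0 / fact n * of_real (LINT z|disc_measure w. norm z ^ (2 * n))"
proof -
  define a where "a = (\<lambda>n. (deriv ^^ n) F 0 / fact n)"
  let ?M = "disc_measure w"
  interpret finite_measure ?M by fact
  have sums: "(\<lambda>n. a n * z ^ n) sums F z" if "z \<in> ball 0 1" for z
    using holomorphic_power_series[OF F that] by (simp add: a_def)
  have mF: "F \<in> borel_measurable ?M" using int by simp
  have bnd: "integrable ?M f" if "f \<in> borel_measurable borel" "\<And>z. z \<in> ball 0 1 \<Longrightarrow> norm (f z) \<le> B"
    for f :: "complex \<Rightarrow> 'b::{banach, second_countable_topology}" and B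
    by (rule integrable_const_bound[of _ B]) (use that measurable_disc_measure_borel in \<open>auto intro!: AE_I2\<close>)
  have part: "(LINT z|?M. indicator (ball 0 R) z * (cnj z ^ n * F z))
      = a n * (LINT z|?M. indicator (ball 0 R) z * (cnj z ^ n * z ^ n))" if R: "0 < R" "R < 1" for R
  proof -
    define f where "f = (\<lambda>m z. indicator (ball 0 R) z * (cnj z ^ n * (a m * z ^ m)) :: complex)"
    \<comment> \<open>Convergence at the larger radius gives absolute convergence at R.\<close>
    obtain R' where R': "R < R'" "R' < 1" using R dense by blast
    have "summable (\<lambda>m. norm (a m * of_real R ^ m))"
      by (rule powser_insidea[of _ "of_real R'"])
        (use R R' sums[of "of_real R'"] in \<open>auto simp: sums_iff\<close>)
    then have sm: "summable (\<lambda>m. norm (a m) * R ^ m)"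
      using R by (simp add: norm_mult norm_power)
    have fle: "norm (f m z) \<le> norm (a m) * R ^ m" if "z \<in> ball 0 1" for m z
    proof (cases "z \<in> ball 0 R")
      case True
      then have "norm z ^ n * norm z ^ m \<le> 1 * R ^ m"
        using that by (intro mult_mono power_mono power_le_one) auto
      then have "norm (a m) * (norm z ^ n * norm z ^ m) \<le> norm (a m) * R ^ m"
        by (intro mult_left_mono) auto
      with True show ?thesis by (simp add: f_def norm_mult norm_power mult_ac)
    qed (use R in \<open>simp add: f_def\<close>)
    have fi: "integrable ?M (f m)" for m
    proof (rule bnd[OF _ fle])
      show "f m \<in> borel_measurable borel" unfolding f_def by measurable
    qed
    have fn: "(LINT z|?M. norm (f m z)) \<le> norm (a m) * R ^ m * measure ?M (space ?M)" for m
      using integral_mono[of ?M "\<lambda>z. norm (f m z)" "\<lambda>_. norm (a m) * R ^ m"] fi fle by (simp add: mult_ac)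
    have 1: "(\<lambda>m. LINT z|?M. f m z) sums (LINT z|?M. (\<Sum>m. f m z))"
    proof (rule sums_integral[OF fi])
      show "AE z in ?M. summable (\<lambda>m. norm (f m z))"
        by (rule AE_I2) (rule summable_comparison_test'[OF sm, of 0], use fle in auto)
      show "summable (\<lambda>m. LINT z|?M. norm (f m z))"
        by (rule summable_comparison_test'[OF summable_mult2[OF sm], of 0 _ "measure ?M (space ?M)"])
          (use fn in \<open>simp add: abs_of_nonneg\<close>)
    qed
    have "(\<Sum>m. f m z) = indicator (ball 0 R) z * (cnj z ^ n * F z)" if "z \<in> ball 0 1" for z
      unfolding f_def using sums_mult[OF sums_mult[OF sums[OF that], of "cnj z ^ n"], of "indicator (ball 0 R) z"]
      by (simp add: sums_iff)
    then have 2: "(LINT z|?M. (\<Sum>m. f m z)) = (LINT z|?M. indicator (ball 0 R) z * (cnj z ^ n * F z))"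
      by (intro Bochner_Integration.integral_cong) auto
    have 3: "(LINT z|?M. f m z) = a m * (LINT z|?M. indicator (ball 0 R) z * (cnj z ^ n * z ^ m))" for m
      by (subst integral_mult_right_zero[symmetric]) (simp add: f_def mult_ac)
    then have "(LINT z|?M. f m z) = (if m = n then a n * (LINT z|?M. indicator (ball 0 R) z * (cnj z ^ n * z ^ n)) else 0)" for m
      using integral_disc_measure_monomials[OF w, of n m R] by auto
    then have "(\<lambda>m. LINT z|?M. f m z) sums (a n * (LINT z|?M. indicator (ball 0 R) z * (cnj z ^ n * z ^ n)))"
      using sums_single[of n "\<lambda>_. a n * (LINT z|?M. indicator (ball 0 R) z * (cnj z ^ n * z ^ n))"] by simp
    with 1 2 show ?thesis using sums_unique2 by metis
  qed
  define R where "R = (\<lambda>k::nat. 1 - 1 / (real k + 2))"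
  have R: "0 < R k" "R k < 1" for k by (simp_all add: R_def field_simps)
  have Rlim: "R \<longlonglongrightarrow> 1" unfolding R_def by real_asymp
  have lim: "(\<lambda>k. LINT z|?M. indicator (ball 0 (R k)) z * G z) \<longlonglongrightarrow> (LINT z|?M. G z)"
    if G: "integrable ?M G" for G :: "complex \<Rightarrow> complex"
  proof (rule integral_dominated_convergence[where w = "\<lambda>z. norm (G z)"])
    have [measurable]: "G \<in> borel_measurable ?M" using G by simp
    have [measurable]: "indicator (ball 0 (R k)) \<in> borel_measurable ?M" for k
      by (rule measurable_disc_measure_borel) simp
    show "G \<in> borel_measurable ?M" "integrable ?M (\<lambda>z. norm (G z))" using G by auto
    show "(\<lambda>z. indicator (ball 0 (R k)) z * G z) \<in> borel_measurable ?M" for k by measurable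
    show "AE z in ?M. norm (indicator (ball 0 (R k)) z * G z) \<le> norm (G z)" for k
      by (auto intro!: AE_I2 simp: indicator_def)
    show "AE z in ?M. (\<lambda>k. indicator (ball 0 (R k)) z * G z) \<longlonglongrightarrow> G z"
    proof (rule AE_I2)
      fix z assume "z \<in> space ?M"
      then have "norm z < 1" by simp
      then have "eventually (\<lambda>k. norm z < R k) sequentially"
        using Rlim by (rule order_tendstoD(1)[rotated])
      then have "eventually (\<lambda>k. indicator (ball 0 (R k)) z * G z = G z) sequentially"
        by eventually_elim simp
      then show "(\<lambda>k. indicator (ball 0 (R k)) z * G z) \<longlonglongrightarrow> G z"
        by (simp add: tendsto_eventually)
    qed
  qed
  have i1: "integrable ?M (\<lambda>z. cnj z ^ n * F z)"
  proof (rule Bochner_Integration.integrable_bound[OF int])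
    show "(\<lambda>z. cnj z ^ n * F z) \<in> borel_measurable ?M"
      by (intro borel_measurable_times measurable_disc_measure_borel mF) measurable
    show "AE z in ?M. norm (cnj z ^ n * F z) \<le> norm (F z)"
    proof (rule AE_I2)
      fix z assume "z \<in> space ?M"
      then show "norm (cnj z ^ n * F z) \<le> norm (F z)"
        unfolding norm_mult norm_power complex_mod_cnj
        by (intro mult_left_le_one_le) (auto simp: power_le_one)
    qed
  qed
  have i2: "integrable ?M (\<lambda>z. cnj z ^ n * z ^ n)"
  proof (rule bnd)
    fix z :: complex assume "z \<in> ball 0 1"
    then show "norm (cnj z ^ n * z ^ n) \<le> 1"
      unfolding norm_mult norm_power complex_mod_cnj
      by (intro mult_le_one) (auto simp: power_le_one)
  qed measurable
  have "(\<lambda>k. LINT z|?M. indicator (ball 0 (R k)) z * (cnj z ^ n * F z))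
      \<longlonglongrightarrow> a n * (LINT z|?M. cnj z ^ n * z ^ n)"
    by (simp only: part[OF R]) (intro tendsto_intros lim i2)
  with lim[OF i1] have "(LINT z|?M. cnj z ^ n * F z) = a n * (LINT z|?M. cnj z ^ n * z ^ n)"
    using LIMSEQ_unique by blast
  also have "(LINT z|?M. cnj z ^ n * z ^ n) = (LINT z|?M. of_real (norm z ^ (2 * n)))"
    by (intro Bochner_Integration.integral_cong refl)
      (metis complex_norm_square mult.commute of_real_power power_mult power_mult_distrib)
  finally show ?thesis unfolding a_def integral_complex_of_real .
qed

section \<open>The Bergman kernel of the disc\<close>

definition bergman_weight :: "real \<Rightarrow> real \<Rightarrow> real" where
  "bergman_weight \<alpha> t = (\<alpha> + 1) / pi * (1 - t) powr \<alpha>"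

text \<open>The binomial coefficients of the expansion of (1 - x)^(-(\<alpha> + 2)), which are also
  the reciprocals of the squared norms of the monomials.\<close>

definition kernel_coeff :: "real \<Rightarrow> nat \<Rightarrow> real" where
  "kernel_coeff \<alpha> n = pochhammer (\<alpha> + 2) n / fact n"

text \<open>The power series of (1 - z cnj w)^(-(2 + \<alpha>)); as a series it needs no branch of a
  complex power and can be paired with monomials directly.\<close>

definition disc_kernel :: "real \<Rightarrow> complex \<Rightarrow> complex \<Rightarrow> complex" where
  "disc_kernel \<alpha> w z = (\<Sum>n. of_real (kernel_coeff \<alpha> n) * (cnj w * z) ^ n)"

lemma borel_measurable_bergman_weight [measurable]: "bergman_weight \<alpha> \<in> borel_measurable borel"
  unfolding bergman_weight_def by measurable

lemma bergman_weight_pos: "\<alpha> > -1 \<Longrightarrow> t < 1 \<Longrightarrow> bergman_weight \<alpha> t > 0"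
  by (simp add: bergman_weight_def)

lemma kernel_coeff_pos: "\<alpha> > -1 \<Longrightarrow> kernel_coeff \<alpha> n > 0"
  by (simp add: kernel_coeff_def pochhammer_pos)

lemma kernel_coeff_Beta:
  assumes "\<alpha> > -1"
  shows "(\<alpha> + 1) * Beta (real n + 1) (\<alpha> + 1) = 1 / kernel_coeff \<alpha> n"
proof -
  have "pochhammer (\<alpha> + 2) n = Gamma (\<alpha> + 2 + real n) / Gamma (\<alpha> + 2)"
    by (rule pochhammer_Gamma) (use assms in \<open>auto elim!: nonpos_Ints_cases\<close>)
  moreover have "Gamma (\<alpha> + 2) = (\<alpha> + 1) * Gamma (\<alpha> + 1)"
    using Gamma_plus1[of "\<alpha> + 1"] assms nonpos_Ints_nonpos[of "\<alpha> + 1"]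
    by (auto simp: add.assoc)
  moreover have "Gamma (real n + 1) = fact n"
    using Gamma_fact[of n, where 'a = real] by (simp add: add.commute)
  moreover have "Gamma (\<alpha> + 1) > 0" "Gamma (\<alpha> + 2 + real n) > 0"
    using assms by (auto intro!: Gamma_real_pos)
  moreover have "real n + 1 + (\<alpha> + 1) = \<alpha> + 2 + real n" by simp
  ultimately show ?thesis
    using assms by (simp add: Beta_def kernel_coeff_def add_ac mult_ac)
qed

text \<open>The substitution t = |z|^2 turns the integral into the Beta integral with parameters n +
  1 and \<alpha> + 1.\<close>

lemma nn_integral_disc_norm_power:
  assumes "\<alpha> > -1"
  shows "(\<integral>\<^sup>+z. ennreal (norm z ^ (2 * n)) \<partial>disc_measure (bergman_weight \<alpha>))
    = ennreal (1 / kernel_coeff \<alpha> n)"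
proof -
  let ?f = "\<lambda>t. if t \<in> {0..1} then t powr real n * (1 - t) powr \<alpha> else 0"
  have f: "(?f has_integral Beta (real n + 1) (\<alpha> + 1)) UNIV"
    using has_integral_Beta_real[of "real n + 1" "\<alpha> + 1"] assms
    by (subst has_integral_restrict_UNIV) simp
  have mf: "?f \<in> borel_measurable borel" by measurable
  have "(\<integral>\<^sup>+z. ennreal (norm z ^ (2 * n)) \<partial>disc_measure (bergman_weight \<alpha>))
      = ennreal pi * (\<integral>\<^sup>+t. ennreal (bergman_weight \<alpha> t) * ennreal (t ^ n) * indicator {0..<1} t \<partial>lborel)"
    by (subst nn_integral_disc_measure_radial[of _ "\<lambda>t. ennreal (t ^ n)", symmetric])
      (simp_all add: power_mult)
  also have "(\<integral>\<^sup>+t. ennreal (bergman_weight \<alpha> t) * ennreal (t ^ n) * indicator {0..<1} t \<partial>lborel)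
      = (\<integral>\<^sup>+t. ennreal ((\<alpha> + 1) / pi) * ennreal (?f t) \<partial>lborel)"
  proof (rule nn_integral_cong_AE)
    \<comment> \<open>At t = 0 the integrands differ when n = 0, because \<open>0 powr 0 = 0\<close>
      while \<open>0 ^ 0 = 1\<close>.\<close>
    have "AE t in lborel. t \<noteq> (0::real)" by (rule AE_lborel_singleton)
    then show "AE t in lborel. ennreal (bergman_weight \<alpha> t) * ennreal (t ^ n) * indicator {0..<1} t
        = ennreal ((\<alpha> + 1) / pi) * ennreal (?f t)"
    proof eventually_elim
      case (elim t)
      then consider "t < 0" | "0 < t" "t < 1" | "t = 1" | "t > 1" by fastforce
      then show ?case
      proof cases
        case 2
        then show ?thesis
          using assms by (simp add: bergman_weight_def powr_realpow ennreal_mult[symmetric] mult_ac)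
      qed (simp_all)
    qed
  qed
  also have "\<dots> = ennreal ((\<alpha> + 1) / pi) * ennreal (Beta (real n + 1) (\<alpha> + 1))"
  proof -
    have "?f t \<ge> 0" for t by simp
    from nn_integral_has_integral_lborel[OF mf this f] show ?thesis
      using mf by (subst nn_integral_cmult) auto
  qed
  also have "ennreal pi * \<dots> = ennreal (1 / kernel_coeff \<alpha> n)"
    using assms by (simp add: kernel_coeff_Beta[OF assms, symmetric] ennreal_mult'[symmetric])
  finally show ?thesis .
qed

lemma finite_measure_disc_bergman:
  assumes "\<alpha> > -1" shows "finite_measure (disc_measure (bergman_weight \<alpha>))"
  by (rule finite_measureI)
    (use nn_integral_disc_norm_power[OF assms, of 0] in \<open>simp add: kernel_coeff_def\<close>)

lemma integral_disc_norm_power: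
  assumes "\<alpha> > -1"
  shows "(LINT z|disc_measure (bergman_weight \<alpha>). norm z ^ (2 * n)) = 1 / kernel_coeff \<alpha> n"
  by (subst integral_eq_nn_integral)
    (use kernel_coeff_pos[OF assms, of n] in \<open>auto simp: nn_integral_disc_norm_power[OF assms]
      intro!: measurable_disc_measure_borel\<close>)

lemma kernel_coeff_sums:
  assumes "\<bar>x\<bar> < 1"
  shows "(\<lambda>n. kernel_coeff \<alpha> n * x ^ n) sums (1 - x) powr (- (\<alpha> + 2))"
proof -
  have "(\<lambda>n. (- (\<alpha> + 2) gchoose n) * (- x) ^ n) sums (1 + - x) powr (- (\<alpha> + 2))"
    using assms by (intro gen_binomial_real) simp
  moreover have "(- (\<alpha> + 2) gchoose n) * (- x) ^ n = kernel_coeff \<alpha> n * x ^ n" for n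
    by (simp add: gbinomial_pochhammer kernel_coeff_def power_mult_distrib[symmetric]
        del: minus_add_distrib flip: mult.assoc)
  ultimately show ?thesis by simp
qed

text \<open>The series with |w| in place of cnj w * z is a majorant that does not depend on z. The
  resulting bound is not sharp, but it makes the kernel a bounded function of z, which is all that
  integrability requires.\<close>

lemma summable_disc_kernel:
  assumes "\<alpha> > -1" "norm w < 1" "norm z \<le> 1"
  shows "summable (\<lambda>n. norm (of_real (kernel_coeff \<alpha> n) * (cnj w * z) ^ n))"
    and "summable (\<lambda>n. of_real (kernel_coeff \<alpha> n) * (cnj w * z) ^ n)"
    and "norm (disc_kernel \<alpha> w z) \<le> (1 - norm w) powr (- (\<alpha> + 2))"
proof -
  have s: "(\<lambda>n. kernel_coeff \<alpha> n * norm w ^ n) sums (1 - norm w) powr (- (\<alpha> + 2))"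
    using assms by (intro kernel_coeff_sums) simp
  have le: "norm (of_real (kernel_coeff \<alpha> n) * (cnj w * z) ^ n) \<le> kernel_coeff \<alpha> n * norm w ^ n" for n
  proof -
    have "norm w * norm z \<le> norm w" using assms by (simp add: mult_left_le)
    then have "(norm w * norm z) ^ n \<le> norm w ^ n" by (intro power_mono) auto
    then show ?thesis
      using kernel_coeff_pos[OF assms(1), of n] by (simp add: norm_mult norm_power)
  qed
  show 1: "summable (\<lambda>n. norm (of_real (kernel_coeff \<alpha> n) * (cnj w * z) ^ n))"
    by (rule summable_comparison_test'[of _ 0, OF sums_summable[OF s]]) (use le in simp)
  then show "summable (\<lambda>n. of_real (kernel_coeff \<alpha> n) * (cnj w * z) ^ n)"
    by (rule summable_norm_cancel)
  have "norm (disc_kernel \<alpha> w z) \<le> (\<Sum>n. norm (of_real (kernel_coeff \<alpha> n) * (cnj w * z) ^ n))"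
    unfolding disc_kernel_def by (rule summable_norm[OF 1])
  also have "\<dots> \<le> (\<Sum>n. kernel_coeff \<alpha> n * norm w ^ n)"
    by (rule suminf_le[OF le 1 sums_summable[OF s]])
  finally show "norm (disc_kernel \<alpha> w z) \<le> (1 - norm w) powr (- (\<alpha> + 2))"
    using sums_unique[OF s] by simp
qed

lemma disc_kernel_diag:
  assumes "norm w < 1"
  shows "disc_kernel \<alpha> w w = of_real ((1 - (norm w)\<^sup>2) powr (- (\<alpha> + 2)))"
proof -
  have s: "(\<lambda>n. kernel_coeff \<alpha> n * ((norm w)\<^sup>2) ^ n) sums (1 - (norm w)\<^sup>2) powr (- (\<alpha> + 2))"
    using assms by (intro kernel_coeff_sums) (simp add: power_less_one_iff)
  have h: "complex_of_real ((norm w)\<^sup>2) = cnj w * w"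
    by (metis complex_norm_square mult.commute)
  from s have "(\<lambda>n. of_real (kernel_coeff \<alpha> n * ((norm w)\<^sup>2) ^ n))
      sums (of_real ((1 - (norm w)\<^sup>2) powr (- (\<alpha> + 2))) :: complex)"
    by (rule sums_of_real)
  moreover have "of_real (kernel_coeff \<alpha> n * ((norm w)\<^sup>2) ^ n)
      = of_real (kernel_coeff \<alpha> n) * (cnj w * w) ^ n" for n
    by (simp only: h[symmetric] of_real_mult of_real_power)
  ultimately have "(\<lambda>n. of_real (kernel_coeff \<alpha> n) * (cnj w * w) ^ n)
      sums of_real ((1 - (norm w)\<^sup>2) powr (- (\<alpha> + 2)))"
    by (simp only:)
  then show ?thesis
    unfolding disc_kernel_def by (rule sums_unique[symmetric])
qed

lemma holomorphic_disc_kernel: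
  assumes "\<alpha> > -1" "norm w < 1"
  shows "disc_kernel \<alpha> w holomorphic_on ball 0 1"
proof (rule power_series_holomorphic)
  fix z :: complex assume "z \<in> ball 0 1"
  then have "(\<lambda>n. of_real (kernel_coeff \<alpha> n) * (cnj w * z) ^ n) sums disc_kernel \<alpha> w z"
    unfolding disc_kernel_def by (intro summable_sums summable_disc_kernel(2) assms) auto
  then show "(\<lambda>n. (of_real (kernel_coeff \<alpha> n) * cnj w ^ n) * (z - 0) ^ n) sums disc_kernel \<alpha> w z"
    by (simp add: power_mult_distrib mult_ac)
qed

text \<open>Integrating the conjugated kernel series against \<open>F\<close> termwise, the
  coefficient of the kernel cancels the squared norm of the monomial, and the Taylor series of
  \<open>F\<close> at w remains. Square integrability gives integrability of \<open>F\<close>, since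
  the measure is finite; this dominates the termwise integration.\<close>

lemma disc_kernel_reproducing:
  assumes \<alpha>: "\<alpha> > -1" and w: "norm w < 1" and F: "F holomorphic_on ball 0 1"
    and int: "integrable (disc_measure (bergman_weight \<alpha>)) (\<lambda>z. (norm (F z))\<^sup>2)"
  shows "(LINT z|disc_measure (bergman_weight \<alpha>). cnj (disc_kernel \<alpha> w z) * F z) = F w"
proof -
  let ?M = "disc_measure (bergman_weight \<alpha>)"
  interpret finite_measure ?M by (rule finite_measure_disc_bergman[OF \<alpha>])
  have mF: "F \<in> borel_measurable ?M"
    by (intro measurable_disc_measure_continuous holomorphic_on_imp_continuous_on F)
  have iF: "integrable ?M F"
    using square_integrable_imp_integrable[of "\<lambda>z. norm (F z)"] mF int
    by (simp add: integrable_norm_iff)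
  define f where "f = (\<lambda>n z. of_real (kernel_coeff \<alpha> n) * w ^ n * (cnj z ^ n * F z))"
  have s: "(\<lambda>n. kernel_coeff \<alpha> n * norm w ^ n) sums (1 - norm w) powr (- (\<alpha> + 2))"
    using w by (intro kernel_coeff_sums) simp
  have fle: "norm (f n z) \<le> kernel_coeff \<alpha> n * norm w ^ n * norm (F z)" if "z \<in> ball 0 1" for n z
  proof -
    have "norm z ^ n * norm (F z) \<le> norm (F z)"
      using that by (intro mult_left_le_one_le) (auto simp: power_le_one)
    then have "kernel_coeff \<alpha> n * norm w ^ n * (norm z ^ n * norm (F z))
        \<le> kernel_coeff \<alpha> n * norm w ^ n * norm (F z)"
      using kernel_coeff_pos[OF \<alpha>, of n] by (intro mult_left_mono) auto
    then show ?thesis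
      using kernel_coeff_pos[OF \<alpha>, of n] by (simp add: f_def norm_mult norm_power)
  qed
  have fi: "integrable ?M (f n)" for n
  proof (rule Bochner_Integration.integrable_bound)
    show "integrable ?M (\<lambda>z. kernel_coeff \<alpha> n * norm w ^ n * norm (F z))" using iF by simp
    show "f n \<in> borel_measurable ?M"
      unfolding f_def
      by (intro borel_measurable_times borel_measurable_const measurable_disc_measure_borel mF)
        measurable
    show "AE z in ?M. norm (f n z) \<le> norm (kernel_coeff \<alpha> n * norm w ^ n * norm (F z))"
      using fle kernel_coeff_pos[OF \<alpha>, of n] by (auto intro!: AE_I2 simp: abs_mult)
  qed
  have fn: "(LINT z|?M. norm (f n z)) \<le> kernel_coeff \<alpha> n * norm w ^ n * (LINT z|?M. norm (F z))" for n
    using integral_mono[of ?M "\<lambda>z. norm (f n z)" "\<lambda>z. kernel_coeff \<alpha> n * norm w ^ n * norm (F z)"]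
      fi fle iF by simp
  have 1: "(\<lambda>n. LINT z|?M. f n z) sums (LINT z|?M. (\<Sum>n. f n z))"
  proof (rule sums_integral[OF fi])
    show "AE z in ?M. summable (\<lambda>n. norm (f n z))"
      by (rule AE_I2, rule summable_comparison_test'[OF summable_mult2[OF sums_summable[OF s]], of 0])
        (use fle in auto)
    show "summable (\<lambda>n. LINT z|?M. norm (f n z))"
      by (rule summable_comparison_test'[OF summable_mult2[OF sums_summable[OF s]], of 0])
        (use fn in \<open>simp add: abs_of_nonneg\<close>)
  qed
  have 2: "(LINT z|?M. (\<Sum>n. f n z)) = (LINT z|?M. cnj (disc_kernel \<alpha> w z) * F z)"
  proof (intro Bochner_Integration.integral_cong refl)
    fix z assume "z \<in> space ?M"
    then have "norm z \<le> 1" by simp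
    from summable_sums[OF summable_disc_kernel(2)[OF \<alpha> w this]]
    have "(\<lambda>n. cnj (of_real (kernel_coeff \<alpha> n) * (cnj w * z) ^ n) * F z)
        sums (cnj (disc_kernel \<alpha> w z) * F z)"
      unfolding disc_kernel_def by (intro sums_mult2) (simp only: sums_cnj)
    then show "(\<Sum>n. f n z) = cnj (disc_kernel \<alpha> w z) * F z"
      by (simp add: sums_iff f_def power_mult_distrib mult_ac)
  qed
  have 3: "(LINT z|?M. f n z) = (deriv ^^ n) F 0 / fact n * w ^ n" for n
  proof -
    have "(LINT z|?M. f n z) = of_real (kernel_coeff \<alpha> n) * w ^ n
        * ((deriv ^^ n) F 0 / fact n * of_real (1 / kernel_coeff \<alpha> n))"
      unfolding f_def
      by (subst integral_mult_right_zero, subst integral_disc_measure_monomial_times[OF _ _ F iF])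
        (simp_all add: integral_disc_norm_power[OF \<alpha>] finite_measure_disc_bergman[OF \<alpha>])
    then show ?thesis using kernel_coeff_pos[OF \<alpha>, of n] by simp
  qed
  have 4: "(\<lambda>n. (deriv ^^ n) F 0 / fact n * w ^ n) sums F w"
    using holomorphic_power_series[OF F, of w] w by simp
  from 1 have "(\<lambda>n. (deriv ^^ n) F 0 / fact n * w ^ n)
      sums (LINT z|?M. cnj (disc_kernel \<alpha> w z) * F z)"
    unfolding 2 3 .
  with 4 show ?thesis by (rule sums_unique2[symmetric])
qed

section \<open>Quaternions and slices\<close>

lemma qRe_mult_commute: "qRe (x * y) = qRe (y * x)"
  by (simp add: quat_mult_components mult.commute)

lemma qcnj_components [simp]:
  "qRe (qcnj x) = qRe x" "qI (qcnj x) = - qI x" "qJ (qcnj x) = - qJ x" "qK (qcnj x) = - qK x"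
  by (simp_all add: qcnj_def)

lemma qcnj_simps [simp]:
  "qcnj 0 = 0" "qcnj 1 = 1" "qcnj (x + y) = qcnj x + qcnj y" "qcnj (x - y) = qcnj x - qcnj y"
  "qcnj (- x) = - qcnj x" "qcnj (qcnj x) = x" "qcnj (of_real r) = of_real r"
  "qcnj (r *\<^sub>R x) = r *\<^sub>R qcnj x"
  by (simp_all add: quat_eq_iff)

lemma qcnj_mult [simp]: "qcnj (x * y) = qcnj y * qcnj x"
  by (simp add: quat_eq_iff quat_mult_components algebra_simps)

lemma quat_norm_squared: "(norm (x :: quat))\<^sup>2 = inner x x"
  by (simp add: power2_norm_eq_inner)

lemma qcnj_mult_self: "qcnj x * x = of_real ((norm x)\<^sup>2)" "x * qcnj x = of_real ((norm x)\<^sup>2)"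
  unfolding quat_norm_squared by (simp_all add: quat_eq_iff quat_mult_components inner_quat_def)

lemma norm_qcnj [simp]: "norm (qcnj x) = norm x"
  by (simp add: norm_eq_sqrt_inner inner_quat_def)

lemma abs_qRe_le_norm: "\<bar>qRe x\<bar> \<le> norm x"
  using Cauchy_Schwarz_ineq2[of x 1] by (simp add: inner_quat_def)

lemma quat_of_real_commute: "of_real r * x = x * (of_real r :: quat)"
  by (simp add: of_real_def)

lemma bounded_linear_qRe: "bounded_linear qRe"
  by (rule bounded_linear_intro[of _ 1]) (simp_all add: abs_qRe_le_norm)

lemma bounded_linear_qcnj: "bounded_linear qcnj"
  by (rule bounded_linear_intro[of _ 1]) simp_all

lemma bounded_linear_qIm: "bounded_linear qIm"
proof (rule bounded_linear_intro[of _ 2])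
  fix x
  have "norm (qIm x) \<le> norm x + norm (of_real (qRe x) :: quat)"
    unfolding qIm_def by (rule norm_triangle_ineq4)
  then show "norm (qIm x) \<le> norm x * 2" using abs_qRe_le_norm[of x] by simp
qed (simp_all add: qIm_def quat_eq_iff quat_mult_components algebra_simps)

lemma qIm_components [simp]: "qRe (qIm x) = 0" "qI (qIm x) = qI x" "qJ (qIm x) = qJ x" "qK (qIm x) = qK x"
  by (simp_all add: qIm_def)

lemma quat_norm_components: "norm x = sqrt ((qRe x)\<^sup>2 + (qI x)\<^sup>2 + (qJ x)\<^sup>2 + (qK x)\<^sup>2)"
  by (simp add: norm_eq_sqrt_inner inner_quat_def power2_eq_square)

lemma quat_norm_qIm: "(norm x)\<^sup>2 = (qRe x)\<^sup>2 + (norm (qIm x))\<^sup>2"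
  by (simp add: quat_norm_components)

text \<open>The orthogonal projection onto the plane spanned by 1 and i, read as a complex number:
  for imaginary i, \<open>- qRe (i * q)\<close> is the inner product of i and q.\<close>

definition slice_coord :: "quat \<Rightarrow> quat \<Rightarrow> complex" where
  "slice_coord i q = Complex (qRe q) (- qRe (i * q))"

locale slice =
  fixes i :: quat
  assumes i_sphere: "i \<in> imag_sphere"
begin

abbreviation emb :: "complex \<Rightarrow> quat" where "emb \<equiv> slice_emb i"

lemma qRe_i: "qRe i = 0" and norm_i: "norm i = 1"
  using i_sphere by (auto simp: imag_sphere_def)

lemma i_components: "(qI i)\<^sup>2 + (qJ i)\<^sup>2 + (qK i)\<^sup>2 = 1"
  using quat_norm_components[of i] by (simp add: qRe_i norm_i)

lemma qcnj_i: "qcnj i = - i"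
  by (simp add: quat_eq_iff qRe_i)

lemma i_square: "i * i = - 1"
proof -
  have "- (i * i) = 1"
    using qcnj_mult_self(1)[of i] by (simp add: qcnj_i norm_i)
  then show ?thesis by (metis add.inverse_inverse)
qed

lemma emb_simps [simp]:
  "emb 0 = 0" "emb 1 = 1" "emb \<i> = i" "emb (z + w) = emb z + emb w" "emb (z - w) = emb z - emb w"
  "emb (- z) = - emb z" "emb (of_real r) = of_real r" "emb (r *\<^sub>R z) = r *\<^sub>R emb z"
  by (simp_all add: slice_emb_def quat_eq_iff quat_mult_components algebra_simps)

lemma emb_mult: "emb (z * w) = emb z * emb w"
proof -
  have [simp]: "i * (i * x) = - x" for x by (simp add: mult.assoc[symmetric] i_square)
  have c: "of_real r * i = i * of_real r" for r by (rule quat_of_real_commute)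
  have c': "of_real r * (i * x) = i * (of_real r * x)" for r x
    by (simp add: c mult.assoc[symmetric])
  show ?thesis
    by (simp add: slice_emb_def algebra_simps c c' i_square mult.assoc del: of_real_mult
        flip: of_real_mult)
qed

lemma qcnj_emb: "qcnj (emb z) = emb (cnj z)"
  by (simp add: slice_emb_def qcnj_i quat_of_real_commute)

lemma norm_emb [simp]: "norm (emb z) = norm z"
proof -
  have "of_real ((norm (emb z))\<^sup>2) = emb (cnj z * z)"
    by (simp only: qcnj_mult_self(1)[symmetric] qcnj_emb emb_mult)
  also have "cnj z * z = of_real ((norm z)\<^sup>2)"
    by (metis complex_norm_square mult.commute)
  finally have "(norm (emb z))\<^sup>2 = (norm z)\<^sup>2"
    by (simp only: emb_simps of_real_eq_iff)
  then show ?thesis by simp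
qed

lemma bounded_linear_emb: "bounded_linear emb"
  by (rule bounded_linear_intro[of _ 1]) simp_all

lemma emb_eq_iff [simp]: "emb z = emb w \<longleftrightarrow> z = w"
  using norm_emb[of "z - w"] by (simp del: norm_emb) (metis norm_emb eq_iff_diff_eq_0 emb_simps(5) norm_eq_zero)

lemma qRe_emb [simp]: "qRe (emb z) = Re z"
  by (simp add: slice_emb_def quat_mult_components qRe_i)

lemma qIm_emb: "qIm (emb z) = i * of_real (Im z)"
  unfolding qIm_def qRe_emb by (simp add: slice_emb_def)

lemma norm_qIm_emb: "norm (qIm (emb z)) = \<bar>Im z\<bar>"
  by (simp add: qIm_emb norm_mult norm_i)

abbreviation coord :: "quat \<Rightarrow> complex" where "coord \<equiv> slice_coord i"

lemma coord_simps [simp]: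
  "coord (x + y) = coord x + coord y" "coord (x - y) = coord x - coord y"
  "coord (- x) = - coord x" "coord 0 = 0" "coord (r *\<^sub>R x) = r *\<^sub>R coord x"
  by (simp_all add: slice_coord_def complex_eq_iff algebra_simps)

lemma coord_emb_mult: "coord (emb z * x) = z * coord x"
proof -
  have "i * (i * x) = - x" by (simp add: mult.assoc[symmetric] i_square)
  then have "qRe (i * (i * x)) = - qRe x" by simp
  then show ?thesis
    by (simp add: slice_coord_def slice_emb_def complex_eq_iff algebra_simps of_real_def)
qed

lemma coord_emb [simp]: "coord (emb z) = z"
  using coord_emb_mult[of z 1] by (simp add: slice_coord_def qRe_i complex_eq_iff)

lemma bounded_linear_coord: "bounded_linear coord"
proof (rule bounded_linear_intro[of _ 2])
  fix x
  have "norm (coord x) \<le> \<bar>qRe x\<bar> + \<bar>qRe (i * x)\<bar>"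
    using cmod_le[of "coord x"] by (simp add: slice_coord_def)
  then show "norm (coord x) \<le> norm x * 2"
    using abs_qRe_le_norm[of x] abs_qRe_le_norm[of "i * x"] by (simp add: norm_mult norm_i)
qed simp_all

text \<open>The mean of q and its conjugate under i is the projection of q onto the quaternions that
  commute with i.\<close>

lemma emb_coord: "emb (coord x) = (1/2) *\<^sub>R (x - i * x * i)"
  using i_components
  by (simp add: quat_eq_iff slice_emb_def slice_coord_def quat_mult_components qRe_i) algebra

lemma coord_commuting:
  assumes "i * x = x * i" shows "x = emb (coord x)"
proof -
  have "i * x * i = - x" by (simp add: assms mult.assoc i_square)
  then show ?thesis by (simp add: emb_coord scaleR_2[symmetric] del: scaleR_2)
qed

end

text \<open>A second imaginary unit orthogonal to the first. It splits the quaternions into two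
  copies of the complex plane of the slice, the second one multiplied by j from the right, so that
  left multiplication by slice numbers acts on both components separately.\<close>

locale slice_split = slice +
  fixes j :: quat
  assumes j_sphere: "j \<in> imag_sphere" and j_orth: "qRe (i * j) = 0"
begin

sublocale j: slice j by unfold_locales (rule j_sphere)

definition coord2 :: "quat \<Rightarrow> complex" where "coord2 q = coord (- (q * j))"

lemma pure_anticommute:
  assumes "qRe x = 0" "qRe (i * x) = 0" shows "x * i = - (i * x)"
  using assms qRe_i by (simp add: quat_eq_iff quat_mult_components mult.commute)

text \<open>What the projection leaves over is orthogonal to 1 and i, so it anticommutes with i; so
  does j. Their product therefore commutes with i and lies in the plane of the slice.\<close>

lemma quat_split: "q = emb (coord q) + emb (coord2 q) * j"
proof -
  define r where "r = q - emb (coord q)"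
  have cr: "coord r = 0" by (simp add: r_def)
  then have "r * i = - (i * r)"
    by (intro pure_anticommute) (auto simp: slice_coord_def complex_eq_iff)
  moreover have "j * i = - (i * j)"
    by (rule pure_anticommute[OF j.qRe_i j_orth])
  ultimately have "(r * j) * i = i * (r * j)"
    by (simp add: mult.assoc) (simp add: mult.assoc[symmetric])
  then have "- (r * j) = emb (coord (- (r * j)))"
    by (intro coord_commuting) simp
  also have "coord (- (r * j)) = coord2 q - coord (- (emb (coord q) * j))"
    by (simp add: coord2_def r_def algebra_simps)
  also have "coord (- (emb (coord q) * j)) = - (coord q * coord j)"
    by (simp add: coord_emb_mult)
  also have "coord j = 0" by (simp add: slice_coord_def j.qRe_i j_orth complex_eq_iff)
  finally have "- (r * j) * j = emb (coord2 q) * j" by simp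
  moreover have "- (r * j) * j = r" by (simp add: mult.assoc j.i_square)
  ultimately show ?thesis by (simp add: r_def)
qed

lemma norm_split: "(norm q)\<^sup>2 = (norm (coord q))\<^sup>2 + (norm (coord2 q))\<^sup>2"
proof -
  let ?a = "emb (coord q)" and ?b = "emb (coord2 q)"
  have o: "qRe (emb z * j) = 0" for z
  proof -
    have "qRe (emb z * j) = Re z * qRe j + Im z * qRe (i * j)"
      by (simp add: slice_emb_def quat_mult_components qRe_i algebra_simps)
    then show ?thesis by (simp add: j.qRe_i j_orth)
  qed
  have "qRe (qcnj q * q) = qRe (qcnj ?a * ?a) + qRe (qcnj (?b * j) * (?b * j))
      + qRe (qcnj ?a * (?b * j)) + qRe (qcnj (?b * j) * ?a)"
    by (subst (1 2) quat_split[of q]) (simp add: algebra_simps)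
  also have "qRe (qcnj (?b * j) * ?a) = qRe (qcnj ?a * (?b * j))"
    by (subst qcnj_components(1)[symmetric]) (simp add: mult.assoc)
  also have "qRe (qcnj ?a * (?b * j)) = 0"
    using o by (simp add: qcnj_emb mult.assoc[symmetric] emb_mult[symmetric])
  finally show ?thesis
    by (simp add: qcnj_mult_self norm_mult j.norm_i del: qcnj_mult of_real_power)
qed

end

lemma (in slice) split_exists: obtains j where "slice_split i j"
proof (cases "qJ i = 0 \<and> qK i = 0")
  case True
  then have "slice_split i (Quat 0 0 1 0)"
    by unfold_locales (simp_all add: imag_sphere_def quat_norm_components quat_mult_components qRe_i)
  then show ?thesis by (rule that)
next
  case False
  define c where "c = sqrt ((qJ i)\<^sup>2 + (qK i)\<^sup>2)"
  have c: "c > 0" "c\<^sup>2 = (qJ i)\<^sup>2 + (qK i)\<^sup>2"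
    using False by (auto simp: c_def sum_power2_gt_zero_iff)
  have "(qK i)\<^sup>2 / c\<^sup>2 + (qJ i)\<^sup>2 / c\<^sup>2 = 1"
    using c(1) unfolding add_divide_distrib[symmetric] add.commute[of "(qK i)\<^sup>2"] c(2)[symmetric]
    by simp
  \<comment> \<open>The last two components of i, turned by a right angle and normalised, give a
    unit orthogonal to i.\<close>
  then have "slice_split i (Quat 0 0 (- qK i / c) (qJ i / c))"
    by unfold_locales (simp_all add: imag_sphere_def quat_norm_components quat_mult_components
        qRe_i power_divide mult.commute)
  then show ?thesis by (rule that)
qed

section \<open>Slice hyperholomorphic functions\<close>

definition slice_CR :: "(real \<Rightarrow> real \<Rightarrow> quat) \<Rightarrow> (real \<Rightarrow> real \<Rightarrow> quat) \<Rightarrow> real \<Rightarrow> real \<Rightarrow> bool" where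
  "slice_CR u v a b \<longleftrightarrow> (\<exists>ua ub va vb.
     ((\<lambda>s. u s b) has_vector_derivative ua) (at a) \<and>
     ((\<lambda>t. u a t) has_vector_derivative ub) (at b) \<and>
     ((\<lambda>s. v s b) has_vector_derivative va) (at a) \<and>
     ((\<lambda>t. v a t) has_vector_derivative vb) (at b) \<and>
     ua = vb \<and> va = - ub)"

definition slice_form :: "(quat \<Rightarrow> quat) \<Rightarrow> (real \<Rightarrow> real \<Rightarrow> quat) \<Rightarrow> (real \<Rightarrow> real \<Rightarrow> quat) \<Rightarrow> bool" where
  "slice_form f u v \<longleftrightarrow>
     (\<forall>x\<in>qball. \<forall>\<iota>\<in>imag_sphere. x = of_real (qRe x) + \<iota> * of_real (norm (qIm x)) \<longrightarrow>
        f x = u (qRe x) (norm (qIm x)) + \<iota> * v (qRe x) (norm (qIm x))) \<and>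
     (\<forall>a b. a\<^sup>2 + b\<^sup>2 < 1 \<longrightarrow> u a b = u a (- b) \<and> v a b = - v a (- b) \<and> slice_CR u v a b)"

lemma slice_hol_space_iff:
  "f \<in> slice_hol_space \<longleftrightarrow>
    f differentiable_on qball \<and> (\<exists>u v. slice_form f u v) \<and> (\<forall>x. x \<notin> qball \<longrightarrow> f x = 0)"
  unfolding slice_hol_space_def slice_hyperholomorphic_def slice_form_def slice_CR_def mem_Collect_eq
  by (rule conj_assoc)

lemma slice_CR_add:
  assumes "slice_CR u v a b" "slice_CR u' v' a b"
  shows "slice_CR (\<lambda>a b. u a b + u' a b) (\<lambda>a b. v a b + v' a b) a b"
proof -
  obtain ua ub where
    1: "((\<lambda>s. u s b) has_vector_derivative ua) (at a)" "((\<lambda>t. u a t) has_vector_derivative ub) (at b)"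
      "((\<lambda>s. v s b) has_vector_derivative - ub) (at a)" "((\<lambda>t. v a t) has_vector_derivative ua) (at b)"
    using assms(1) unfolding slice_CR_def by auto
  obtain ua' ub' where
    2: "((\<lambda>s. u' s b) has_vector_derivative ua') (at a)" "((\<lambda>t. u' a t) has_vector_derivative ub') (at b)"
      "((\<lambda>s. v' s b) has_vector_derivative - ub') (at a)" "((\<lambda>t. v' a t) has_vector_derivative ua') (at b)"
    using assms(2) unfolding slice_CR_def by auto
  have "((\<lambda>s. v s b + v' s b) has_vector_derivative - (ub + ub')) (at a)"
    using has_vector_derivative_add[OF 1(3) 2(3)] by simp
  with has_vector_derivative_add[OF 1(1) 2(1)] has_vector_derivative_add[OF 1(2) 2(2)]
    has_vector_derivative_add[OF 1(4) 2(4)]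
  show ?thesis unfolding slice_CR_def by blast
qed

lemma slice_CR_mult_right:
  assumes "slice_CR u v a b"
  shows "slice_CR (\<lambda>a b. u a b * c) (\<lambda>a b. v a b * c) a b"
proof -
  obtain ua ub where
    1: "((\<lambda>s. u s b) has_vector_derivative ua) (at a)" "((\<lambda>t. u a t) has_vector_derivative ub) (at b)"
      "((\<lambda>s. v s b) has_vector_derivative - ub) (at a)" "((\<lambda>t. v a t) has_vector_derivative ua) (at b)"
    using assms(1) unfolding slice_CR_def by auto
  note * = bounded_linear.has_vector_derivative[OF bounded_linear_mult_left[of c]]
  from *[OF 1(1)] *[OF 1(2)] *[OF 1(3)] *[OF 1(4)] show ?thesis
    unfolding slice_CR_def by auto
qed

lemma slice_hol_space_add:
  assumes "f \<in> slice_hol_space" "g \<in> slice_hol_space"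
  shows "(\<lambda>x. f x + g x) \<in> slice_hol_space"
proof -
  obtain u v where uv: "slice_form f u v" using assms(1) unfolding slice_hol_space_iff by blast
  obtain u' v' where uv': "slice_form g u' v'" using assms(2) unfolding slice_hol_space_iff by blast
  have "slice_form (\<lambda>x. f x + g x) (\<lambda>a b. u a b + u' a b) (\<lambda>a b. v a b + v' a b)"
    unfolding slice_form_def
  proof (intro conjI ballI allI impI)
    fix x \<iota> assume "x \<in> qball" "\<iota> \<in> imag_sphere" "x = of_real (qRe x) + \<iota> * of_real (norm (qIm x))"
    then have "f x = u (qRe x) (norm (qIm x)) + \<iota> * v (qRe x) (norm (qIm x))"
      "g x = u' (qRe x) (norm (qIm x)) + \<iota> * v' (qRe x) (norm (qIm x))"
      using uv uv' unfolding slice_form_def by blast+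
    then show "f x + g x = u (qRe x) (norm (qIm x)) + u' (qRe x) (norm (qIm x))
        + \<iota> * (v (qRe x) (norm (qIm x)) + v' (qRe x) (norm (qIm x)))"
      by (simp only:) (simp add: algebra_simps)
  next
    fix a b :: real assume "a\<^sup>2 + b\<^sup>2 < 1"
    then have 1: "u a b = u a (- b)" "v a b = - v a (- b)" "slice_CR u v a b"
      and 2: "u' a b = u' a (- b)" "v' a b = - v' a (- b)" "slice_CR u' v' a b"
      using uv uv' unfolding slice_form_def by blast+
    show "u a b + u' a b = u a (- b) + u' a (- b)" "v a b + v' a b = - (v a (- b) + v' a (- b))"
      unfolding 1(1,2) 2(1,2) by simp_all
    show "slice_CR (\<lambda>a b. u a b + u' a b) (\<lambda>a b. v a b + v' a b) a b"
      by (rule slice_CR_add[OF 1(3) 2(3)])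
  qed
  with assms show ?thesis unfolding slice_hol_space_iff by auto
qed

lemma slice_hol_space_mult_right:
  assumes "f \<in> slice_hol_space"
  shows "(\<lambda>x. f x * c) \<in> slice_hol_space"
proof -
  obtain u v where uv: "slice_form f u v" using assms(1) unfolding slice_hol_space_iff by blast
  have "slice_form (\<lambda>x. f x * c) (\<lambda>a b. u a b * c) (\<lambda>a b. v a b * c)"
    unfolding slice_form_def
  proof (intro conjI ballI allI impI)
    fix x \<iota> assume "x \<in> qball" "\<iota> \<in> imag_sphere" "x = of_real (qRe x) + \<iota> * of_real (norm (qIm x))"
    then have "f x = u (qRe x) (norm (qIm x)) + \<iota> * v (qRe x) (norm (qIm x))"
      using uv unfolding slice_form_def by blast
    then show "f x * c = u (qRe x) (norm (qIm x)) * c + \<iota> * (v (qRe x) (norm (qIm x)) * c)"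
      by (simp only:) (simp add: algebra_simps)
  next
    fix a b :: real assume "a\<^sup>2 + b\<^sup>2 < 1"
    then have 1: "u a b = u a (- b)" "v a b = - v a (- b)" "slice_CR u v a b"
      using uv unfolding slice_form_def by blast+
    show "u a b * c = u a (- b) * c" "v a b * c = - (v a (- b) * c)"
      unfolding 1(1,2) by simp_all
    show "slice_CR (\<lambda>a b. u a b * c) (\<lambda>a b. v a b * c) a b"
      by (rule slice_CR_mult_right[OF 1(3)])
  qed
  moreover have "(\<lambda>x. f x * c) differentiable_on qball"
    using assms unfolding slice_hol_space_iff by (intro differentiable_on_mult) auto
  ultimately show ?thesis using assms unfolding slice_hol_space_iff by auto
qed

context slice
begin

lemma emb_in_qball [simp]: "emb z \<in> qball \<longleftrightarrow> z \<in> ball 0 1"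
  by (simp add: qball_def)

lemma minus_i_sphere: "- i \<in> imag_sphere"
  using i_sphere by (simp add: imag_sphere_def)

text \<open>The defining representation only uses a nonnegative second coordinate. In the lower half
  of the slice the unit is -i, and the parities of u and v absorb the sign.\<close>

lemma slice_form_emb:
  assumes uv: "slice_form f u v" and z: "z \<in> ball 0 1"
  shows "f (emb z) = u (Re z) (Im z) + i * v (Re z) (Im z)"
proof (cases "Im z \<ge> 0")
  case True
  have "emb z = of_real (qRe (emb z)) + i * of_real (norm (qIm (emb z)))"
    using True by (simp add: norm_qIm_emb) (simp add: slice_emb_def)
  with uv i_sphere z have "f (emb z) = u (qRe (emb z)) (norm (qIm (emb z)))
      + i * v (qRe (emb z)) (norm (qIm (emb z)))"
    unfolding slice_form_def emb_in_qball[symmetric] by blast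
  with True show ?thesis by (simp add: norm_qIm_emb)
next
  case False
  have "emb z = of_real (qRe (emb z)) + (- i) * of_real (norm (qIm (emb z)))"
    using False by (simp add: norm_qIm_emb) (simp add: slice_emb_def)
  with uv minus_i_sphere z have "f (emb z) = u (qRe (emb z)) (norm (qIm (emb z)))
      + (- i) * v (qRe (emb z)) (norm (qIm (emb z)))"
    unfolding slice_form_def emb_in_qball[symmetric] by blast
  with False have "f (emb z) = u (Re z) (- Im z) - i * v (Re z) (- Im z)" by (simp add: norm_qIm_emb)
  moreover have "(Re z)\<^sup>2 + (Im z)\<^sup>2 < 1"
    using z by (simp add: cmod_def)
  then have "u (Re z) (Im z) = u (Re z) (- Im z)" "v (Re z) (Im z) = - v (Re z) (- Im z)"
    using uv unfolding slice_form_def by blast+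
  ultimately show ?thesis by simp
qed

text \<open>The equations for u and v say that the derivative D of f satisfies
  \<open>D i = i * D 1\<close>, hence it is linear over the slice plane acting from the left. Taking
  coordinates respects this left action, and a constant factor on the right does not disturb it; its
  choice selects the component of f. Real differentiability of f supplies D, since the equations for
  u and v concern partial derivatives only.\<close>

lemma slice_hol_coord_holomorphic:
  assumes f: "f \<in> slice_hol_space"
  shows "(\<lambda>z. coord (f (emb z) * c)) holomorphic_on ball 0 1"
proof -
  obtain u v where form: "slice_form f u v" using f unfolding slice_hol_space_iff by blast
  note uv = slice_form_emb[OF form]
  have dC: "((\<lambda>s. Complex s b) has_derivative (\<lambda>s. of_real s)) (at a)"
    "((\<lambda>t. Complex a t) has_derivative (\<lambda>t. \<i> * of_real t)) (at b)" for a b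
    unfolding Complex_eq by (auto intro!: derivative_eq_intros)
  show ?thesis
  proof (rule holomorphic_onI)
    fix z :: complex assume z: "z \<in> ball 0 1"
    define a b where "a = Re z" and "b = Im z"
    have z_eq: "z = Complex a b" by (simp add: a_def b_def)
    have ab: "a\<^sup>2 + b\<^sup>2 < 1" using z by (simp add: z_eq cmod_def)
    have "f differentiable (at (emb z))"
      using f z by (auto simp: slice_hol_space_def slice_hyperholomorphic_def differentiable_on_def
          qball_def at_within_open[of _ "ball 0 1"])
    then obtain D where D: "(f has_derivative D) (at (emb z))" by (auto simp: differentiable_def)
    define F where "F = (\<lambda>z. f (emb z))"
    have dF: "(F has_derivative (\<lambda>h. D (emb h))) (at z)"
      unfolding F_def
      by (rule has_derivative_compose[OF bounded_linear_imp_has_derivative[OF bounded_linear_emb] D])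
    have "slice_CR u v a b" using form ab unfolding slice_form_def by blast
    then obtain ua ub where d:
      "((\<lambda>s. u s b) has_vector_derivative ua) (at a)" "((\<lambda>t. u a t) has_vector_derivative ub) (at b)"
      "((\<lambda>s. v s b) has_vector_derivative - ub) (at a)" "((\<lambda>t. v a t) has_vector_derivative ua) (at b)"
      unfolding slice_CR_def by auto
    have lD: "linear D" using D by (auto dest: has_derivative_linear)
    have opens: "open {s. s\<^sup>2 + b\<^sup>2 < 1}" "open {t. a\<^sup>2 + t\<^sup>2 < 1}"
      by (auto intro!: open_Collect_less continuous_intros)
    have "((\<lambda>s. u s b + i * v s b) has_vector_derivative (ua + i * (- ub))) (at a)"
      by (intro has_vector_derivative_add d
          bounded_linear.has_vector_derivative[OF bounded_linear_mult_right])
    then have "((\<lambda>s. F (Complex s b)) has_vector_derivative (ua + i * (- ub))) (at a)"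
      by (rule has_vector_derivative_transform_within_open[OF _ opens(1)])
        (use ab uv in \<open>auto simp: F_def cmod_def\<close>)
    moreover have "((\<lambda>s. F (Complex s b)) has_vector_derivative (D 1)) (at a)"
      unfolding has_vector_derivative_def
      using has_derivative_compose[OF dC(1)[of b a], of F "\<lambda>h. D (emb h)"] dF
      by (simp add: z_eq linear_scale[OF lD] of_real_def)
    ultimately have A: "D 1 = ua + i * (- ub)" by (rule vector_derivative_unique_at[symmetric])
    have "((\<lambda>t. u a t + i * v a t) has_vector_derivative (ub + i * ua)) (at b)"
      by (intro has_vector_derivative_add d
          bounded_linear.has_vector_derivative[OF bounded_linear_mult_right])
    then have "((\<lambda>t. F (Complex a t)) has_vector_derivative (ub + i * ua)) (at b)"
      by (rule has_vector_derivative_transform_within_open[OF _ opens(2)])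
        (use ab uv in \<open>auto simp: F_def cmod_def\<close>)
    moreover have "((\<lambda>t. F (Complex a t)) has_vector_derivative (D i)) (at b)"
      unfolding has_vector_derivative_def
      using has_derivative_compose[OF dC(2)[of a b], of F "\<lambda>h. D (emb h)"] dF
      by (simp add: z_eq linear_scale[OF lD] of_real_def emb_mult)
    ultimately have "D i = ub + i * ua" by (rule vector_derivative_unique_at[symmetric])
    then have B: "D i = i * D 1"
      unfolding A by (simp add: algebra_simps mult.assoc[symmetric] i_square)
    have "D (emb h) = emb h * D 1" for h
    proof -
      have "emb h = Re h *\<^sub>R 1 + Im h *\<^sub>R i"
        by (simp add: slice_emb_def of_real_def)
      then show ?thesis
        by (simp add: linear_add[OF lD] linear_scale[OF lD] B algebra_simps)
    qed
    then have "(\<lambda>h. coord (D (emb h) * c)) = (\<lambda>h. coord (D 1 * c) * h)"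
      by (simp add: mult.assoc coord_emb_mult mult.commute)
    moreover have "((\<lambda>z. coord (F z * c)) has_derivative (\<lambda>h. coord (D (emb h) * c))) (at z)"
      by (rule bounded_linear.has_derivative[OF bounded_linear_compose[OF bounded_linear_coord
              bounded_linear_mult_left] dF])
    ultimately have "((\<lambda>z. coord (F z * c)) has_field_derivative coord (D 1 * c)) (at z)"
      by (simp add: has_field_derivative_def)
    then show "(\<lambda>z. coord (f (emb z) * c)) field_differentiable at z within ball 0 1"
      unfolding F_def by (metis field_differentiable_at_within field_differentiable_def)
  qed
qed

text \<open>The values at z and its conjugate on one slice determine u as their mean and v as -i
  times half their difference; these then give f on every slice.\<close>

lemma slice_representation:
  assumes f: "f \<in> slice_hol_space" and x: "x \<in> qball" "\<iota> \<in> imag_sphere"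
    and eq: "x = of_real (qRe x) + \<iota> * of_real (norm (qIm x))"
  defines "z \<equiv> Complex (qRe x) (norm (qIm x))"
  shows "f x = (1/2) *\<^sub>R (f (emb z) + f (emb (cnj z)))
      - (1/2) *\<^sub>R (\<iota> * i * (f (emb z) - f (emb (cnj z))))"
proof -
  obtain u v where form: "slice_form f u v" using f unfolding slice_hol_space_iff by blast
  note uv = slice_form_emb[OF form]
  have nz: "norm z = norm x"
    unfolding z_def cmod_def quat_norm_qIm[of x, symmetric] complex.sel by simp
  then have z: "z \<in> ball 0 1" "cnj z \<in> ball 0 1" using x by (auto simp: qball_def)
  have "(Re z)\<^sup>2 + (Im z)\<^sup>2 < 1" using z by (simp add: cmod_def)
  then have e': "u (Re z) (Im z) = u (Re z) (- Im z)" "v (Re z) (Im z) = - v (Re z) (- Im z)"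
    using form unfolding slice_form_def by blast+
  then have e: "u (Re z) (- Im z) = u (Re z) (Im z)" "v (Re z) (- Im z) = - v (Re z) (Im z)"
    by simp_all
  have 1: "f (emb z) + f (emb (cnj z)) = 2 *\<^sub>R u (Re z) (Im z)"
    using uv[OF z(1)] uv[OF z(2)] e by (simp add: scaleR_2)
  have "f (emb z) - f (emb (cnj z)) = 2 *\<^sub>R (i * v (Re z) (Im z))"
    using uv[OF z(1)] uv[OF z(2)] e by (simp add: scaleR_2)
  then have 2: "\<iota> * i * (f (emb z) - f (emb (cnj z))) = - (2 *\<^sub>R (\<iota> * v (Re z) (Im z)))"
    by (simp add: mult.assoc mult.assoc[of i i, symmetric] i_square)
  have "f x = u (Re z) (Im z) + \<iota> * v (Re z) (Im z)"
    using form x eq unfolding slice_form_def z_def complex.sel by blast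
  then show ?thesis unfolding 1 2 by simp
qed

lemma quat_slice_form:
  obtains \<iota> where "\<iota> \<in> imag_sphere" "x = of_real (qRe x) + \<iota> * of_real (norm (qIm x))"
proof (cases "qIm x = 0")
  case True
  then show ?thesis using that[OF i_sphere] by (simp add: qIm_def)
next
  case False
  then have "sgn (qIm x) \<in> imag_sphere"
    by (simp add: imag_sphere_def norm_sgn) (simp add: sgn_div_norm)
  moreover have "sgn (qIm x) * of_real (norm (qIm x)) = qIm x"
    using False by (simp add: sgn_div_norm of_real_def)
  then have "x = of_real (qRe x) + sgn (qIm x) * of_real (norm (qIm x))" by (simp add: qIm_def)
  ultimately show ?thesis by (rule that)
qed

lemma slice_hol_eqI:
  assumes f: "f \<in> slice_hol_space" and g: "g \<in> slice_hol_space"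
    and eq: "\<And>z. z \<in> ball 0 1 \<Longrightarrow> f (emb z) = g (emb z)"
  shows "f = g"
proof
  fix x
  show "f x = g x"
  proof (cases "x \<in> qball")
    case True
    obtain \<iota> where \<iota>: "\<iota> \<in> imag_sphere" "x = of_real (qRe x) + \<iota> * of_real (norm (qIm x))"
      by (rule quat_slice_form)
    let ?z = "Complex (qRe x) (norm (qIm x))"
    have "norm ?z = norm x"
      unfolding cmod_def quat_norm_qIm[of x, symmetric] complex.sel by simp
    then have "?z \<in> ball 0 1" "cnj ?z \<in> ball 0 1" using True by (auto simp: qball_def)
    then show ?thesis
      by (subst slice_representation[OF f True \<iota>], subst slice_representation[OF g True \<iota>])
        (simp only: eq)
  next
    case False
    then show ?thesis using f g by (simp add: slice_hol_space_def)
  qed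
qed

lemma slice_extension_differentiable_nonreal:
  fixes h1 h2 :: "complex \<Rightarrow> complex"
  assumes h1: "\<And>z. z \<in> ball 0 1 \<Longrightarrow> h1 differentiable (at z)"
    and h2: "\<And>z. z \<in> ball 0 1 \<Longrightarrow> h2 differentiable (at z)"
    and x: "x \<in> qball" "qIm x \<noteq> 0"
  shows "(\<lambda>x. emb (h1 (Complex (qRe x) (norm (qIm x))))
      + sgn (qIm x) * emb (h2 (Complex (qRe x) (norm (qIm x))))) differentiable (at x)"
proof -
  let ?\<zeta> = "\<lambda>x. Complex (qRe x) (norm (qIm x))"
  have dIm: "qIm differentiable (at x)"
    by (rule bounded_linear_imp_differentiable[OF bounded_linear_qIm])
  have dRe: "qRe differentiable (at x)"
    by (rule bounded_linear_imp_differentiable[OF bounded_linear_qRe])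
  have dn: "(\<lambda>x. norm (qIm x)) differentiable (at x)"
    by (rule differentiable_compose[OF differentiable_norm_at[OF x(2)] dIm])
  have "?\<zeta> = (\<lambda>x. of_real (qRe x) + \<i> * of_real (norm (qIm x)))"
    by (simp add: Complex_eq)
  then have d\<zeta>: "?\<zeta> differentiable (at x)"
    using dRe dn
    by (auto intro!: differentiable_add differentiable_mult differentiable_const
        differentiable_compose[OF bounded_linear_imp_differentiable[OF bounded_linear_of_real]])
  have "norm (?\<zeta> x) = norm x"
    unfolding cmod_def quat_norm_qIm[of x, symmetric] complex.sel by simp
  then have z: "?\<zeta> x \<in> ball 0 1" using x by (simp add: qball_def)
  have e: "(\<lambda>x. emb (k (?\<zeta> x))) differentiable (at x)"
    if "\<And>z. z \<in> ball 0 1 \<Longrightarrow> k differentiable (at z)" for k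
    by (rule differentiable_compose[OF bounded_linear_imp_differentiable[OF bounded_linear_emb]],
        rule differentiable_compose[OF that[OF z] d\<zeta>])
  have "(\<lambda>x. inverse (norm (qIm x)) *\<^sub>R qIm x) differentiable (at x)"
    using dn dIm x(2) by (intro differentiable_scaleR differentiable_inverse) auto
  then have "(\<lambda>x. sgn (qIm x)) differentiable (at x)"
    by (simp add: sgn_div_norm)
  with e[OF h1] e[OF h2] show ?thesis
    by (intro differentiable_add differentiable_mult)
qed

text \<open>At real points the direction \<open>sgn (qIm x)\<close> jumps, so product and chain
  rules fail. The first-order remainder is estimated directly: it consists of the remainders of h at
  z and at its conjugate, and the direction has norm at most 1.\<close>

lemma slice_extension_has_derivative_real:
  fixes h :: "complex \<Rightarrow> complex"
  defines "h1 \<equiv> \<lambda>z. (h z + h (cnj z)) / 2" and "h2 \<equiv> \<lambda>z. (h z - h (cnj z)) / (2 * \<i>)"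
  assumes h: "(h has_field_derivative d) (at (of_real a))"
  shows "((\<lambda>x. emb (h1 (Complex (qRe x) (norm (qIm x))))
      + sgn (qIm x) * emb (h2 (Complex (qRe x) (norm (qIm x))))) has_derivative (\<lambda>y. y * emb d))
      (at (of_real a))" (is "(?f has_derivative _) _")
  unfolding has_derivative_at_alt
proof (intro conjI allI impI)
  show "bounded_linear (\<lambda>y. y * emb d)" by (rule bounded_linear_mult_left)
  fix e :: real assume "e > 0"
  \<comment> \<open>Each of the two remainders enters two averages with weight one half, hence the
    bound \<open>e / 2\<close>.\<close>
  then obtain \<delta> where \<delta>: "\<delta> > 0"
    "\<And>y. norm (y - of_real a) < \<delta> \<Longrightarrow>
      norm (h y - h (of_real a) - d * (y - of_real a)) \<le> e / 2 * norm (y - of_real a)"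
    using h unfolding has_field_derivative_def has_derivative_at_alt by (meson half_gt_zero)
  show "\<exists>\<delta>>0. \<forall>y. norm (y - of_real a) < \<delta> \<longrightarrow>
      norm (?f y - ?f (of_real a) - (y - of_real a) * emb d) \<le> e * norm (y - of_real a)"
  proof (intro exI[of _ \<delta>] conjI allI impI \<delta>(1))
    fix y :: quat assume y: "norm (y - of_real a) < \<delta>"
    define z where "z = Complex (qRe y) (norm (qIm y))"
    define c where "c = complex_of_real a"
    define r where "r = (\<lambda>z. h z - h c - d * (z - c))"
    have "qIm (y - of_real a) = qIm y" by (simp add: qIm_def)
    then have nz: "norm (z - c) = norm (y - of_real a)"
      using quat_norm_qIm[of "y - of_real a"] by (simp add: z_def c_def cmod_def real_sqrt_unique)
    have "cnj z - c = cnj (z - c)" by (simp add: c_def)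
    then have nz': "norm (cnj z - c) = norm (y - of_real a)"
      using nz by (simp only: complex_mod_cnj)
    have r: "norm (r z) \<le> e / 2 * norm (y - of_real a)" "norm (r (cnj z)) \<le> e / 2 * norm (y - of_real a)"
      using \<delta>(2)[of z] \<delta>(2)[of "cnj z"] y nz nz' unfolding r_def c_def by auto
    have hz: "h z = h c + d * (z - c) + r z" "h (cnj z) = h c + d * (cnj z - c) + r (cnj z)"
      by (simp_all add: r_def)
    have "z + cnj z = 2 * of_real (Re z)" "z - cnj z = 2 * \<i> * of_real (Im z)"
      by (simp_all add: complex_eq_iff)
    then have zc: "(z - c) + (cnj z - c) = 2 * of_real (Re z - a)"
      "(z - c) - (cnj z - c) = 2 * \<i> * of_real (Im z)"
      by (simp_all add: c_def algebra_simps)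
    have E1: "h z + h (cnj z) = 2 * h c + d * ((z - c) + (cnj z - c)) + (r z + r (cnj z))"
      by (simp add: hz algebra_simps)
    have h1: "h1 z = h c + of_real (Re z - a) * d + (r z + r (cnj z)) / 2"
      unfolding h1_def E1 zc by (simp add: add_divide_distrib)
    have E2: "h z - h (cnj z) = d * ((z - c) - (cnj z - c)) + (r z - r (cnj z))"
      by (simp add: hz algebra_simps)
    have h2: "h2 z = of_real (Im z) * d + (r z - r (cnj z)) / (2 * \<i>)"
      unfolding h2_def E2 zc by (simp only: add_divide_distrib) (simp add: complex_eq_iff)
    have s: "sgn (qIm y) * of_real (norm (qIm y)) = qIm y"
      by (cases "qIm y = 0") (simp_all add: sgn_div_norm of_real_def)
    have yd: "y - of_real a = of_real (qRe y - a) + qIm y" by (simp add: qIm_def)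
    have fa: "?f (of_real a) = emb (h c)"
      by (simp add: qIm_def h1_def h2_def c_def complex_of_real_def[symmetric])
    have "?f y = emb (h c) + of_real (Re z - a) * emb d + emb ((r z + r (cnj z)) / 2)
        + sgn (qIm y) * (of_real (Im z) * emb d + emb ((r z - r (cnj z)) / (2 * \<i>)))"
      unfolding z_def[symmetric] h1 h2 emb_simps emb_mult ..
    also have "\<dots> = emb (h c) + (of_real (qRe y - a) + qIm y) * emb d + emb ((r z + r (cnj z)) / 2)
        + sgn (qIm y) * emb ((r z - r (cnj z)) / (2 * \<i>))"
      using s by (simp add: z_def algebra_simps mult.assoc[symmetric])
    finally have "?f y - ?f (of_real a) - (y - of_real a) * emb d
        = emb ((r z + r (cnj z)) / 2) + sgn (qIm y) * emb ((r z - r (cnj z)) / (2 * \<i>))"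
      unfolding fa yd by simp
    also have "norm \<dots> \<le> norm ((r z + r (cnj z)) / 2) + 1 * norm ((r z - r (cnj z)) / (2 * \<i>))"
      by (intro order_trans[OF norm_triangle_ineq] add_mono)
        (auto simp: norm_mult norm_sgn intro!: mult_right_mono)
    also have "\<dots> \<le> (norm (r z) + norm (r (cnj z))) / 2 + (norm (r z) + norm (r (cnj z))) / 2"
      using norm_triangle_ineq[of "r z" "r (cnj z)"] norm_triangle_ineq4[of "r z" "r (cnj z)"]
      by (simp add: norm_divide norm_mult)
    also have "\<dots> \<le> e * norm (y - of_real a)" using r by simp
    finally show "norm (?f y - ?f (of_real a) - (y - of_real a) * emb d) \<le> e * norm (y - of_real a)" .
  qed
qed

text \<open>The representation formula is read backwards: \<open>h1\<close> and \<open>h2\<close>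
  are even and odd under conjugation with h = h1 + i h2, and they serve as u and v.\<close>

lemma slice_extension:
  assumes h: "h holomorphic_on ball 0 1"
  obtains f where "f \<in> slice_hol_space" "\<And>z. z \<in> ball 0 1 \<Longrightarrow> f (emb z) = emb (h z)"
proof -
  define h1 where "h1 = (\<lambda>z. (h z + h (cnj z)) / 2)"
  define h2 where "h2 = (\<lambda>z. (h z - h (cnj z)) / (2 * \<i>))"
  define g where "g = (\<lambda>x. emb (h1 (Complex (qRe x) (norm (qIm x))))
      + sgn (qIm x) * emb (h2 (Complex (qRe x) (norm (qIm x)))))"
  define f where "f = (\<lambda>x. if x \<in> qball then g x else 0)"
  define u where "u = (\<lambda>a b. emb (h1 (Complex a b)))"
  define v where "v = (\<lambda>a b. emb (h2 (Complex a b)))"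
  have hd: "(h has_field_derivative deriv h z) (at z)" if "z \<in> ball 0 1" for z
    by (rule holomorphic_derivI[OF h open_ball that])
  have cnj_ball: "cnj z \<in> ball 0 1 \<longleftrightarrow> z \<in> ball 0 1" for z by simp
  have dcnj: "cnj differentiable (at z)" for z
    by (rule bounded_linear_imp_differentiable[OF bounded_linear_cnj])
  have dh: "h differentiable (at z)" if "z \<in> ball 0 1" for z
    using hd[OF that] by (auto simp: has_field_derivative_def differentiable_def)
  have dh': "(\<lambda>z. h (cnj z)) differentiable (at z)" if "z \<in> ball 0 1" for z
    by (rule differentiable_compose[OF dh dcnj]) (use that in simp)
  have d12: "h1 differentiable (at z)" "h2 differentiable (at z)" if "z \<in> ball 0 1" for z
    using dh[OF that] dh'[OF that] unfolding h1_def h2_def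
    by (auto intro!: differentiable_add differentiable_diff differentiable_divide differentiable_const)
  have "g differentiable (at x)" if x: "x \<in> qball" for x
  proof (cases "qIm x = 0")
    case False
    then show ?thesis
      unfolding g_def by (intro slice_extension_differentiable_nonreal d12 x)
  next
    case True
    then have xe: "x = of_real (qRe x)" by (simp add: qIm_def)
    then have "norm x = \<bar>qRe x\<bar>" by (metis norm_of_real)
    then have "complex_of_real (qRe x) \<in> ball 0 1" using x by (simp add: qball_def)
    from slice_extension_has_derivative_real[OF hd[OF this]] show ?thesis
      unfolding g_def h1_def h2_def differentiable_def xe[symmetric] by blast
  qed
  then have gd: "g differentiable (at x within qball)" if "x \<in> qball" for x
    using that by (simp add: differentiable_at_withinI)
  have f_diff: "f differentiable_on qball"
    unfolding differentiable_on_def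
  proof
    fix x assume x: "x \<in> qball"
    show "f differentiable (at x within qball)"
      by (rule differentiable_transform_within[OF gd[OF x] zero_less_one x]) (simp add: f_def)
  qed
  have ev: "h1 (cnj z) = h1 z" and odd: "h2 (cnj z) = - h2 z" for z
    by (simp_all add: h1_def h2_def field_simps)
  have cnjC: "cnj (Complex a b) = Complex a (- b)" for a b by (simp add: complex_eq_iff)
  have form: "slice_form f u v"
    unfolding slice_form_def
  proof (intro conjI ballI allI impI)
    fix x \<iota> assume x: "x \<in> qball" "\<iota> \<in> imag_sphere" "x = of_real (qRe x) + \<iota> * of_real (norm (qIm x))"
    have q: "qIm x = \<iota> * of_real (norm (qIm x))" using x(3) by (simp add: qIm_def algebra_simps)
    have "sgn (qIm x) * v (qRe x) (norm (qIm x)) = \<iota> * v (qRe x) (norm (qIm x))"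
    proof (cases "qIm x = 0")
      case True
      then show ?thesis
        using odd[of "of_real (qRe x)"] by (simp add: v_def complex_of_real_def[symmetric])
    next
      case False
      have "sgn (qIm x) = inverse (norm (qIm x)) *\<^sub>R (\<iota> * of_real (norm (qIm x)))"
        unfolding sgn_div_norm by (simp only: q[symmetric])
      with False have "sgn (qIm x) = \<iota>" by (simp add: of_real_def)
      then show ?thesis by simp
    qed
    with x(1) show "f x = u (qRe x) (norm (qIm x)) + \<iota> * v (qRe x) (norm (qIm x))"
      by (simp add: f_def g_def u_def v_def)
  next
    fix a b :: real assume ab: "a\<^sup>2 + b\<^sup>2 < 1"
    show "u a b = u a (- b)" "v a b = - v a (- b)"
      using ev[of "Complex a b"] odd[of "Complex a b"] by (simp_all add: u_def v_def cnjC)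
    define z where "z = Complex a b"
    have z: "z \<in> ball 0 1" "cnj z \<in> ball 0 1" using ab by (auto simp: z_def cmod_def)
    have c1: "((\<lambda>s. Complex s b) has_vector_derivative 1) (at a)"
      "((\<lambda>t. Complex a t) has_vector_derivative \<i>) (at b)"
      "((\<lambda>s. Complex s (- b)) has_vector_derivative 1) (at a)"
      "((\<lambda>t. Complex a (- t)) has_vector_derivative - \<i>) (at b)"
      unfolding Complex_eq has_vector_derivative_def
      by (auto intro!: derivative_eq_intros simp: scaleR_conv_of_real)
    have chain: "((\<lambda>s. h (\<gamma> s)) has_vector_derivative (\<gamma>' * deriv h (\<gamma> t))) (at t)"
      if "(\<gamma> has_vector_derivative \<gamma>') (at t)" "\<gamma> t \<in> ball 0 1" for \<gamma> \<gamma>' t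
      using field_vector_diff_chain_at[OF that(1) hd[OF that(2)]] by (simp add: o_def)
    have H: "((\<lambda>s. h (Complex s b)) has_vector_derivative deriv h z) (at a)"
      "((\<lambda>t. h (Complex a t)) has_vector_derivative \<i> * deriv h z) (at b)"
      "((\<lambda>s. h (Complex s (- b))) has_vector_derivative deriv h (cnj z)) (at a)"
      "((\<lambda>t. h (Complex a (- t))) has_vector_derivative - \<i> * deriv h (cnj z)) (at b)"
      using chain[OF c1(1)] chain[OF c1(2)] chain[OF c1(3)] chain[OF c1(4)] z
      by (simp_all add: z_def cnjC)
    note E = bounded_linear.has_vector_derivative[OF bounded_linear_emb]
    have half: "bounded_linear (\<lambda>z::complex. z / 2)" "bounded_linear (\<lambda>z::complex. z / (2 * \<i>))"
      by (rule bounded_linear_divide)+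
    note E1 = E[OF bounded_linear.has_vector_derivative[OF half(1)]]
    note E2 = E[OF bounded_linear.has_vector_derivative[OF half(2)]]
    define p where "p = emb ((deriv h z + deriv h (cnj z)) / 2)"
    define q where "q = emb ((\<i> * deriv h z + - \<i> * deriv h (cnj z)) / 2)"
    have "((\<lambda>s. u s b) has_vector_derivative p) (at a)" "((\<lambda>t. u a t) has_vector_derivative q) (at b)"
      unfolding u_def h1_def cnjC p_def q_def by (intro E1 has_vector_derivative_add H)+
    moreover have "((\<lambda>s. v s b) has_vector_derivative emb ((deriv h z - deriv h (cnj z)) / (2 * \<i>))) (at a)"
      "((\<lambda>t. v a t) has_vector_derivative emb ((\<i> * deriv h z - - \<i> * deriv h (cnj z)) / (2 * \<i>))) (at b)"
      unfolding v_def h2_def cnjC by (intro E2 has_vector_derivative_diff H)+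
    moreover have "emb ((\<i> * deriv h z - - \<i> * deriv h (cnj z)) / (2 * \<i>)) = p"
      by (simp add: p_def field_simps)
    moreover have "emb ((deriv h z - deriv h (cnj z)) / (2 * \<i>)) = - q"
    proof -
      have "(x - y) / (2 * \<i>) = - ((\<i> * x + - \<i> * y) / 2)" for x y :: complex
        by (simp add: field_simps)
      then show ?thesis unfolding q_def emb_simps(6)[symmetric] by (simp only:)
    qed
    ultimately show "slice_CR u v a b"
      unfolding slice_CR_def by (metis (no_types))
  qed
  have f: "f \<in> slice_hol_space"
    unfolding slice_hol_space_iff using f_diff form by (auto simp: f_def)
  moreover have "f (emb z) = emb (h z)" if z: "z \<in> ball 0 1" for z
  proof -
    have "h1 z + \<i> * h2 z = h z" by (simp add: h1_def h2_def field_simps)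
    moreover have "f (emb z) = emb (h1 z) + emb \<i> * emb (h2 z)"
      using slice_form_emb[OF form z] by (simp add: u_def v_def)
    ultimately show ?thesis by (metis emb_mult emb_simps(4))
  qed
  ultimately show ?thesis by (rule that)
qed

end

section \<open>Quaternionic inner product spaces\<close>

definition rscale :: "('a \<Rightarrow> quat) \<Rightarrow> quat \<Rightarrow> 'a \<Rightarrow> quat" (infixl "\<cdot>" 75) where
  "f \<cdot> a = (\<lambda>x. f x * a)"

lemma rscale_apply [simp]: "(f \<cdot> a) x = f x * a"
  by (simp add: rscale_def)

lemma rscale_simps [simp]:
  "f \<cdot> 1 = f" "f \<cdot> 0 = 0" "0 \<cdot> a = 0" "f \<cdot> a \<cdot> b = f \<cdot> (a * b)" "f \<cdot> (- a) = - (f \<cdot> a)" "(- f) \<cdot> a = - (f \<cdot> a)"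
  by (simp_all add: fun_eq_iff mult.assoc)

lemma rscale_distrib:
  "(f + g) \<cdot> a = f \<cdot> a + g \<cdot> a" "f \<cdot> (a + b) = f \<cdot> a + f \<cdot> b"
  "(f - g) \<cdot> a = f \<cdot> a - g \<cdot> a" "f \<cdot> (a - b) = f \<cdot> a - f \<cdot> b"
  by (simp_all add: fun_eq_iff algebra_simps)

lemma sum_fun_apply: "(\<Sum>k\<in>I. f k) x = (\<Sum>k\<in>I. f k x)"
  by (induction I rule: infinite_finite_induct) simp_all

lemma rscale_sum: "(\<Sum>k\<in>I. f k) \<cdot> a = (\<Sum>k\<in>I. f k \<cdot> a)" "g \<cdot> (\<Sum>k\<in>I. c k) = (\<Sum>k\<in>I. g \<cdot> c k)"
  by (simp_all add: fun_eq_iff sum_fun_apply sum_distrib_left sum_distrib_right)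

text \<open>Definiteness is left out on purpose, so that Cauchy-Schwarz, Bessel and residuals apply
  both to the inner product and to the form <f, T g> of a positive operator, which may
  degenerate.\<close>

locale quat_semi_inner =
  fixes A :: "('a \<Rightarrow> quat) set" and ip :: "('a \<Rightarrow> quat) \<Rightarrow> ('a \<Rightarrow> quat) \<Rightarrow> quat"
  assumes zero_mem [simp]: "0 \<in> A"
    and add_mem [simp]: "f \<in> A \<Longrightarrow> g \<in> A \<Longrightarrow> f + g \<in> A"
    and rscale_mem [simp]: "f \<in> A \<Longrightarrow> f \<cdot> a \<in> A"
    and ip_add_right: "f \<in> A \<Longrightarrow> g \<in> A \<Longrightarrow> h \<in> A \<Longrightarrow> ip f (g + h) = ip f g + ip f h"
    and ip_rscale_right: "f \<in> A \<Longrightarrow> g \<in> A \<Longrightarrow> ip f (g \<cdot> a) = ip f g * a"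
    and qcnj_ip: "f \<in> A \<Longrightarrow> g \<in> A \<Longrightarrow> qcnj (ip f g) = ip g f"
    and ip_nonneg: "f \<in> A \<Longrightarrow> 0 \<le> qRe (ip f f)"
begin

definition sq :: "('a \<Rightarrow> quat) \<Rightarrow> real" where "sq f = qRe (ip f f)"

definition orthonormal :: "('i \<Rightarrow> 'a \<Rightarrow> quat) \<Rightarrow> 'i set \<Rightarrow> bool" where
  "orthonormal e I \<longleftrightarrow> (\<forall>k\<in>I. e k \<in> A) \<and> (\<forall>k\<in>I. \<forall>l\<in>I. ip (e k) (e l) = (if k = l then 1 else 0))"

lemma minus_mem [simp]: "f \<in> A \<Longrightarrow> - f \<in> A"
  using rscale_mem[of f "-1"] by simp

lemma diff_mem [simp]: "f \<in> A \<Longrightarrow> g \<in> A \<Longrightarrow> f - g \<in> A"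
  using add_mem[of f "- g"] by simp

lemma sum_mem [simp]: "(\<And>k. k \<in> I \<Longrightarrow> f k \<in> A) \<Longrightarrow> (\<Sum>k\<in>I. f k) \<in> A"
  by (induction I rule: infinite_finite_induct) simp_all

lemma ip_zero_right [simp]: "f \<in> A \<Longrightarrow> ip f 0 = 0"
  using ip_rscale_right[of f 0 0] by simp

lemma ip_minus_right: "f \<in> A \<Longrightarrow> g \<in> A \<Longrightarrow> ip f (- g) = - ip f g"
  using ip_rscale_right[of f g "-1"] by simp

lemma ip_diff_right: "f \<in> A \<Longrightarrow> g \<in> A \<Longrightarrow> h \<in> A \<Longrightarrow> ip f (g - h) = ip f g - ip f h"
  using ip_add_right[of f g "- h"] by (simp add: ip_minus_right)

lemma ip_sum_right:
  "f \<in> A \<Longrightarrow> (\<And>k. k \<in> I \<Longrightarrow> g k \<in> A) \<Longrightarrow> ip f (\<Sum>k\<in>I. g k) = (\<Sum>k\<in>I. ip f (g k))"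
  by (induction I rule: infinite_finite_induct) (simp_all add: ip_add_right)

lemma ip_add_left: "f \<in> A \<Longrightarrow> g \<in> A \<Longrightarrow> h \<in> A \<Longrightarrow> ip (f + g) h = ip f h + ip g h"
  using qcnj_ip[of h "f + g"] by (simp add: ip_add_right qcnj_ip)

lemma ip_diff_left: "f \<in> A \<Longrightarrow> g \<in> A \<Longrightarrow> h \<in> A \<Longrightarrow> ip (f - g) h = ip f h - ip g h"
  using qcnj_ip[of h "f - g"] by (simp add: ip_diff_right qcnj_ip)

lemma ip_rscale_left: "f \<in> A \<Longrightarrow> g \<in> A \<Longrightarrow> ip (f \<cdot> a) g = qcnj a * ip f g"
  using qcnj_ip[of g "f \<cdot> a"] by (simp add: ip_rscale_right qcnj_ip)

lemma ip_self: assumes "f \<in> A" shows "ip f f = of_real (sq f)"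
proof -
  have "qcnj (ip f f) = ip f f" using qcnj_ip assms by simp
  then show ?thesis by (simp add: quat_eq_iff sq_def)
qed

lemma sq_nonneg [simp]: "f \<in> A \<Longrightarrow> 0 \<le> sq f"
  by (simp add: sq_def ip_nonneg)

lemma sq_zero [simp]: "sq 0 = 0"
  by (simp add: sq_def)

lemma qRe_ip_commute: "f \<in> A \<Longrightarrow> g \<in> A \<Longrightarrow> qRe (ip f g) = qRe (ip g f)"
  using qcnj_ip[of f g] by (metis qcnj_components(1))

lemma norm_ip_commute: "f \<in> A \<Longrightarrow> g \<in> A \<Longrightarrow> norm (ip f g) = norm (ip g f)"
  using qcnj_ip[of f g] by (metis norm_qcnj)

lemma sq_rscale: "f \<in> A \<Longrightarrow> sq (f \<cdot> a) = (norm a)\<^sup>2 * sq f"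
proof -
  assume f: "f \<in> A"
  have "ip (f \<cdot> a) (f \<cdot> a) = qcnj a * (of_real (sq f) * a)"
    using f by (subst ip_rscale_left) (simp_all add: ip_rscale_right ip_self mult.assoc)
  also have "\<dots> = of_real ((norm a)\<^sup>2 * sq f)"
    unfolding quat_of_real_commute[of "sq f" a] mult.assoc[symmetric] qcnj_mult_self by simp
  finally show ?thesis unfolding sq_def by (simp only: quat_of_real_components)
qed

lemma sq_add: "f \<in> A \<Longrightarrow> g \<in> A \<Longrightarrow> sq (f + g) = sq f + sq g + 2 * qRe (ip f g)"
  using qRe_ip_commute[of f g] by (simp add: sq_def ip_add_left ip_add_right)

lemma sq_diff: "f \<in> A \<Longrightarrow> g \<in> A \<Longrightarrow> sq (f - g) = sq f + sq g - 2 * qRe (ip f g)"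
  using qRe_ip_commute[of f g] by (simp add: sq_def ip_diff_left ip_diff_right)

lemma sq_minus_commute: "f \<in> A \<Longrightarrow> g \<in> A \<Longrightarrow> sq (f - g) = sq (g - f)"
  using qRe_ip_commute[of f g] by (simp add: sq_diff)

lemma sq_add_le: "f \<in> A \<Longrightarrow> g \<in> A \<Longrightarrow> sq (f + g) \<le> 2 * sq f + 2 * sq g"
  using sq_nonneg[of "f - g"] by (simp add: sq_add sq_diff)

text \<open>The inequality \<open>sq (f - g \<cdot> (t *\<^sub>R c)) \<ge> 0\<close> for real t,
  where c = <g, f> aligns the quaternionic phase. For \<open>sq g > 0\<close> the optimal t is its
  reciprocal; for \<open>sq g = 0\<close> a large t forces c = 0.\<close>

lemma Cauchy_Schwarz:
  assumes f: "f \<in> A" and g: "g \<in> A"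
  shows "(norm (ip f g))\<^sup>2 \<le> sq f * sq g"
proof -
  define c where "c = ip g f"
  have nc: "norm (ip f g) = norm c" using norm_ip_commute f g by (simp add: c_def)
  have key: "2 * t * (norm c)\<^sup>2 \<le> sq f + t\<^sup>2 * (norm c)\<^sup>2 * sq g" for t
  proof -
    have "ip f (g \<cdot> (t *\<^sub>R c)) = t *\<^sub>R (qcnj c * c)"
      using f g qcnj_ip[of g f] by (simp add: ip_rscale_right c_def)
    then have "qRe (ip f (g \<cdot> (t *\<^sub>R c))) = t * (norm c)\<^sup>2"
      by (simp add: qcnj_mult_self del: of_real_power)
    moreover have "0 \<le> sq (f - g \<cdot> (t *\<^sub>R c))" using f g by simp
    ultimately show ?thesis
      using f g by (simp add: sq_diff sq_rscale power_mult_distrib)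
  qed
  show ?thesis
  proof (cases "sq g = 0")
    case True
    have "(norm c)\<^sup>2 = 0"
    proof (rule ccontr)
      assume "(norm c)\<^sup>2 \<noteq> 0"
      then have "2 * ((sq f + 1) / (norm c)\<^sup>2) * (norm c)\<^sup>2 = 2 * (sq f + 1)" by simp
      with key[of "(sq f + 1) / (norm c)\<^sup>2"] True sq_nonneg[OF f] show False by simp
    qed
    then show ?thesis using True nc by simp
  next
    case False
    then have "sq g > 0" using sq_nonneg[OF g] by simp
    with key[of "1 / sq g"] have "2 * (norm c)\<^sup>2 / sq g \<le> sq f + (norm c)\<^sup>2 / sq g"
      by (simp add: power2_eq_square)
    with \<open>sq g > 0\<close> show ?thesis by (simp add: nc field_simps)
  qed
qed

lemma orthonormalD:
  "orthonormal e I \<Longrightarrow> k \<in> I \<Longrightarrow> e k \<in> A"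
  "orthonormal e I \<Longrightarrow> k \<in> I \<Longrightarrow> l \<in> I \<Longrightarrow> ip (e k) (e l) = (if k = l then 1 else 0)"
  by (auto simp: orthonormal_def)

lemma orthonormal_subset: "orthonormal e I \<Longrightarrow> J \<subseteq> I \<Longrightarrow> orthonormal e J"
  unfolding orthonormal_def by blast

lemma sq_orthonormal: "orthonormal e I \<Longrightarrow> k \<in> I \<Longrightarrow> sq (e k) = 1"
  by (simp add: sq_def orthonormalD)

definition resid :: "('i \<Rightarrow> 'a \<Rightarrow> quat) \<Rightarrow> 'i set \<Rightarrow> ('a \<Rightarrow> quat) \<Rightarrow> 'a \<Rightarrow> quat" where
  "resid e I f = f - (\<Sum>k\<in>I. e k \<cdot> ip (e k) f)"

lemma
  assumes I: "finite I" "orthonormal e I" and f: "f \<in> A"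
  shows resid_mem: "resid e I f \<in> A"
    and ip_resid: "k \<in> I \<Longrightarrow> ip (e k) (resid e I f) = 0"
    and sq_resid: "sq (resid e I f) = sq f - (\<Sum>k\<in>I. (norm (ip (e k) f))\<^sup>2)"
proof -
  have e: "e k \<in> A" if "k \<in> I" for k using I that by (rule_tac orthonormalD)
  show r: "resid e I f \<in> A" unfolding resid_def using e f by simp
  have o: "ip (e k) (resid e I f) = 0" if k: "k \<in> I" for k
  proof -
    have "ip (e k) (\<Sum>l\<in>I. e l \<cdot> ip (e l) f) = (\<Sum>l\<in>I. (if l = k then ip (e k) f else 0))"
      using e k orthonormalD(2)[OF I(2) k]
      by (subst ip_sum_right) (auto simp: ip_rscale_right intro!: sum.cong)
    also have "\<dots> = ip (e k) f" using I k by simp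
    finally show ?thesis using e k f by (simp add: resid_def ip_diff_right)
  qed
  then show "k \<in> I \<Longrightarrow> ip (e k) (resid e I f) = 0" .
  have "ip (resid e I f) (e k) = 0" if "k \<in> I" for k
    using o[OF that] qcnj_ip[OF e[OF that] r] by simp
  then have "ip (resid e I f) (\<Sum>k\<in>I. e k \<cdot> ip (e k) f) = 0"
    using r e by (subst ip_sum_right) (auto simp: ip_rscale_right)
  then have "sq (resid e I f) = qRe (ip (resid e I f) f)"
    using r e f unfolding sq_def by (subst (2) resid_def) (simp add: ip_diff_right)
  also have "\<dots> = qRe (ip f (resid e I f))" using r f by (rule qRe_ip_commute)
  also have "\<dots> = sq f - (\<Sum>k\<in>I. qRe (ip f (e k) * ip (e k) f))"
    using e f unfolding resid_def
    by (simp add: ip_diff_right ip_sum_right ip_rscale_right sq_def bounded_linear.linear[OF bounded_linear_qRe, THEN linear_sum])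
  also have "(\<Sum>k\<in>I. qRe (ip f (e k) * ip (e k) f)) = (\<Sum>k\<in>I. (norm (ip (e k) f))\<^sup>2)"
  proof (rule sum.cong[OF refl])
    fix k assume "k \<in> I"
    then have "ip f (e k) = qcnj (ip (e k) f)" using e f by (simp add: qcnj_ip)
    then show "qRe (ip f (e k) * ip (e k) f) = (norm (ip (e k) f))\<^sup>2"
      by (simp add: qcnj_mult_self del: of_real_power)
  qed
  finally show "sq (resid e I f) = sq f - (\<Sum>k\<in>I. (norm (ip (e k) f))\<^sup>2)" .
qed

lemma Bessel:
  "finite I \<Longrightarrow> orthonormal e I \<Longrightarrow> f \<in> A \<Longrightarrow> (\<Sum>k\<in>I. (norm (ip (e k) f))\<^sup>2) \<le> sq f"
  using sq_nonneg[OF resid_mem] sq_resid by fastforce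

lemma sqrt_sq_triangle:
  assumes "f \<in> A" "g \<in> A"
  shows "sqrt (sq (f + g)) \<le> sqrt (sq f) + sqrt (sq g)"
proof (rule real_le_lsqrt)
  have "qRe (ip f g) \<le> sqrt (sq f) * sqrt (sq g)"
  proof -
    have "norm (ip f g) \<le> sqrt (sq f * sq g)"
      using Cauchy_Schwarz[OF assms] by (simp add: real_le_rsqrt)
    then show ?thesis using abs_qRe_le_norm[of "ip f g"] by (simp add: real_sqrt_mult)
  qed
  then show "sq (f + g) \<le> (sqrt (sq f) + sqrt (sq g))\<^sup>2"
    using assms by (simp add: sq_add power2_sum)
qed (use assms in simp)

lemma sqrt_sq_sum:
  "(\<And>k. k \<in> I \<Longrightarrow> f k \<in> A) \<Longrightarrow> sqrt (sq (\<Sum>k\<in>I. f k)) \<le> (\<Sum>k\<in>I. sqrt (sq (f k)))"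
proof (induction I rule: infinite_finite_induct)
  case (insert k I)
  then have "sqrt (sq (f k + (\<Sum>k\<in>I. f k))) \<le> sqrt (sq (f k)) + sqrt (sq (\<Sum>k\<in>I. f k))"
    by (intro sqrt_sq_triangle) auto
  moreover have "sqrt (sq (\<Sum>k\<in>I. f k)) \<le> (\<Sum>k\<in>I. sqrt (sq (f k)))"
    using insert by simp
  ultimately show ?case unfolding sum.insert[OF insert.hyps(1,2)] by linarith
qed auto

end

locale quat_inner_space = quat_semi_inner +
  assumes ip_definite: "f \<in> A \<Longrightarrow> sq f = 0 \<Longrightarrow> f = 0"
begin

lemma eq_iff_sq_diff: "f \<in> A \<Longrightarrow> g \<in> A \<Longrightarrow> sq (f - g) = 0 \<Longrightarrow> f = g"
  using ip_definite[of "f - g"] by simp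

lemma eqI_ip:
  assumes "f \<in> A" "g \<in> A" "\<And>h. h \<in> A \<Longrightarrow> ip h f = ip h g"
  shows "f = g"
proof -
  have "ip (f - g) (f - g) = 0" using assms by (simp add: ip_diff_right)
  then show ?thesis using assms by (intro eq_iff_sq_diff) (simp_all add: sq_def)
qed

lemma sq_limit_unique:
  assumes "f \<in> A" "g \<in> A" "\<And>n. F n \<in> A" "(\<lambda>n. sq (F n - f)) \<longlonglongrightarrow> 0" "(\<lambda>n. sq (F n - g)) \<longlonglongrightarrow> 0"
  shows "f = g"
proof -
  have "sq (f - g) \<le> 2 * sq (F n - f) + 2 * sq (F n - g)" for n
  proof -
    have "sq ((f - F n) + (F n - g)) \<le> 2 * sq (f - F n) + 2 * sq (F n - g)"
      using assms by (intro sq_add_le) auto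
    then show ?thesis using assms sq_minus_commute[of f "F n"] by simp
  qed
  moreover have "(\<lambda>n. 2 * sq (F n - f) + 2 * sq (F n - g)) \<longlonglongrightarrow> 2 * 0 + 2 * 0"
    by (intro tendsto_intros assms)
  ultimately have "sq (f - g) \<le> 0" by (intro LIMSEQ_le_const) auto
  moreover have "0 \<le> sq (f - g)" using assms by (intro sq_nonneg) simp
  ultimately show ?thesis using assms by (intro eq_iff_sq_diff) auto
qed

end

section \<open>Compact positive operators\<close>

lemma LIMSEQ_null_squeeze:
  fixes f g :: "nat \<Rightarrow> real"
  assumes "\<And>n. 0 \<le> f n" "\<And>n. f n \<le> g n" "g \<longlonglongrightarrow> 0"
  shows "f \<longlonglongrightarrow> 0"
  by (rule tendsto_sandwich[OF _ _ tendsto_const assms(3)]) (use assms(1,2) in auto)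

text \<open>\<open>C\<close> bounds the square of the operator norm, which explains the square root
  in bounds of the form. Positivity includes that <f, T f> is real; symmetry is derived from
  it.\<close>

locale positive_operator = quat_inner_space +
  fixes T :: "('a \<Rightarrow> quat) \<Rightarrow> 'a \<Rightarrow> quat" and C :: real
  assumes T_mem [simp]: "f \<in> A \<Longrightarrow> T f \<in> A"
    and T_add: "f \<in> A \<Longrightarrow> g \<in> A \<Longrightarrow> T (f + g) = T f + T g"
    and T_rscale: "f \<in> A \<Longrightarrow> T (f \<cdot> a) = T f \<cdot> a"
    and T_bounded: "f \<in> A \<Longrightarrow> sq (T f) \<le> C * sq f"
    and T_pos: "f \<in> A \<Longrightarrow> \<exists>r\<ge>0. ip f (T f) = of_real r"
begin

lemma T_zero [simp]: "T 0 = 0"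
  using T_rscale[of 0 0] by simp

lemma T_minus: "f \<in> A \<Longrightarrow> T (- f) = - T f"
  using T_rscale[of f "-1"] by simp

lemma T_diff: "f \<in> A \<Longrightarrow> g \<in> A \<Longrightarrow> T (f - g) = T f - T g"
  using T_add[of f "- g"] by (simp add: T_minus)

lemma T_sum: "(\<And>k. k \<in> I \<Longrightarrow> f k \<in> A) \<Longrightarrow> T (\<Sum>k\<in>I. f k) = (\<Sum>k\<in>I. T (f k))"
  by (induction I rule: infinite_finite_induct) (simp_all add: T_add)

text \<open>Polarisation: \<open>\<langle>f, T g\<rangle> q + q\<^sup>* \<langle>g, T f\<rangle>\<close> is real for every quaternion \<open>q\<close>; the
  basis units \<open>q\<close> give all components.\<close>

lemma T_symmetric:
  assumes f: "f \<in> A" and g: "g \<in> A"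
  shows "ip f (T g) = ip (T f) g"
proof -
  define a b where "a = ip f (T g)" and "b = ip g (T f)"
  have "\<exists>r. a * q + qcnj q * b = of_real r" for q
  proof -
    let ?h = "g \<cdot> q"
    obtain r1 r2 r3 where "ip (f + ?h) (T (f + ?h)) = of_real r1" "ip f (T f) = of_real r2"
      "ip ?h (T ?h) = of_real r3"
      using T_pos f g by (metis add_mem rscale_mem)
    moreover have "ip (f + ?h) (T (f + ?h)) = ip f (T f) + ip ?h (T ?h) + (a * q + qcnj q * b)"
    proof -
      have "ip f (T ?h) = a * q" "ip ?h (T f) = qcnj q * b"
        using f g by (simp_all add: T_rscale ip_rscale_right ip_rscale_left a_def b_def)
      then show ?thesis using f g by (simp add: T_add ip_add_left ip_add_right)
    qed
    ultimately have "a * q + qcnj q * b = of_real (r1 - r2 - r3)" by (simp add: algebra_simps)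
    then show ?thesis ..
  qed
  note real = this
  obtain r where "a * 1 + qcnj 1 * b = of_real r" using real by blast
  then have 1: "qI a = - qI b" "qJ a = - qJ b" "qK a = - qK b"
    by (simp_all add: quat_eq_iff)
  obtain s where "a * Quat 0 1 0 0 + qcnj (Quat 0 1 0 0) * b = of_real s" using real by blast
  then have "qRe a = qRe b"
    by (simp add: quat_eq_iff quat_mult_components)
  with 1 have "b = qcnj a" by (simp add: quat_eq_iff)
  then have "a = qcnj b" by simp
  then show ?thesis using f g by (simp add: a_def b_def qcnj_ip)
qed

text \<open>From here on the names prefixed by \<open>form\<close> refer to <f, T g> as a second,
  possibly degenerate, inner product.\<close>

sublocale form: quat_semi_inner A "\<lambda>f g. ip f (T g)"
proof
  fix f g h a
  assume "f \<in> A" "g \<in> A"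
  then show "ip f (T (g \<cdot> a)) = ip f (T g) * a"
    by (simp add: T_rscale ip_rscale_right)
  show "qcnj (ip f (T g)) = ip g (T f)"
    using \<open>f \<in> A\<close> \<open>g \<in> A\<close> by (simp add: qcnj_ip T_symmetric)
next
  fix f assume "f \<in> A"
  then show "0 \<le> qRe (ip f (T f))" using T_pos[of f] by auto
qed (simp_all add: T_add ip_add_right)

abbreviation "tf \<equiv> form.sq"

lemma ip_T_self: "f \<in> A \<Longrightarrow> ip f (T f) = of_real (tf f)"
  by (rule form.ip_self)

lemma tf_def: "tf f = qRe (ip f (T f))"
  by (simp add: form.sq_def)

lemma tf_le_sq: "f \<in> A \<Longrightarrow> tf f \<le> sqrt \<bar>C\<bar> * sq f"
proof -
  assume f: "f \<in> A"
  have "(norm (ip f (T f)))\<^sup>2 \<le> sq f * sq (T f)" using f by (intro Cauchy_Schwarz) auto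
  also have "\<dots> \<le> sq f * (\<bar>C\<bar> * sq f)"
    using f by (intro mult_left_mono order_trans[OF T_bounded mult_right_mono]) auto
  also have "\<dots> = (sqrt \<bar>C\<bar> * sq f)\<^sup>2" by (simp add: power_mult_distrib power2_eq_square)
  finally have "(tf f)\<^sup>2 \<le> (sqrt \<bar>C\<bar> * sq f)\<^sup>2" using f by (simp add: ip_T_self)
  then show ?thesis using f by (simp add: power2_le_iff_abs_le)
qed

text \<open>Cauchy-Schwarz for the form, applied to T f and f. The bound M is asked for at the
  single vector T f, so that M can be the bound on an invariant subspace instead of the norm of
  T.\<close>

lemma sq_T_le:
  assumes f: "f \<in> A" and M: "tf (T f) \<le> M * sq (T f)" and "M \<ge> 0"
  shows "sq (T f) \<le> M * tf f"
proof (cases "sq (T f) = 0")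
  case True then show ?thesis using f \<open>M \<ge> 0\<close> by simp
next
  case False
  then have pos: "sq (T f) > 0" using sq_nonneg[OF T_mem[OF f]] by linarith
  have "(norm (ip (T f) (T f)))\<^sup>2 \<le> tf (T f) * tf f"
    using f by (intro form.Cauchy_Schwarz) auto
  also have "\<dots> \<le> M * sq (T f) * tf f" using M f by (intro mult_right_mono) auto
  finally have "sq (T f) * sq (T f) \<le> sq (T f) * (M * tf f)"
    using f by (simp add: ip_self power2_eq_square mult_ac)
  with pos show ?thesis by simp
qed

lemma tf_zero_imp:
  assumes f: "f \<in> A" and "tf f = 0" shows "T f = 0"
proof (rule ip_definite)
  have "sq (T f) \<le> sqrt \<bar>C\<bar> * tf f"
    using f tf_le_sq[of "T f"] by (intro sq_T_le) auto
  then show "sq (T f) = 0" using assms(2) sq_nonneg[OF T_mem[OF f]] by simp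
qed (use f in simp)

definition T_compact :: bool where
  "T_compact \<longleftrightarrow> (\<forall>F B. (\<forall>n. F n \<in> A \<and> sq (F n) \<le> B) \<longrightarrow>
     (\<exists>r :: nat \<Rightarrow> nat. \<exists>g\<in>A. strict_mono r \<and> (\<lambda>n. sq (T (F (r n)) - g)) \<longlonglongrightarrow> 0))"

text \<open>A maximising sequence \<open>f\<^sub>n\<close> for \<open>\<langle>f, T f\<rangle>\<close> satisfies \<open>\<parallel>T f\<^sub>n - \<mu> f\<^sub>n\<parallel>\<^sup>2 \<le> \<mu> (\<mu> - \<langle>f\<^sub>n, T f\<^sub>n\<rangle>)\<close>, so a
  limit point of \<open>T f\<^sub>n\<close> is an eigenvector.\<close>

lemma maximal_eigenvector:
  assumes cpt: T_compact and X: "\<And>x. x \<in> X \<Longrightarrow> x \<in> A" "\<And>x. x \<in> X \<Longrightarrow> \<exists>\<mu>. T x = x \<cdot> of_real \<mu>"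
    and V: "V = {f \<in> A. \<forall>x\<in>X. ip x f = 0}" and ne: "u \<in> V" "sq u = 1"
  obtains e \<mu> where "e \<in> V" "sq e = 1" "0 \<le> \<mu>" "T e = e \<cdot> of_real \<mu>" "\<And>f. f \<in> V \<Longrightarrow> tf f \<le> \<mu> * sq f"
proof -
  have VA: "f \<in> A" if "f \<in> V" for f using that V by simp
  have TV: "T f \<in> V" if f: "f \<in> V" for f
  proof -
    have "ip x (T f) = 0" if x: "x \<in> X" for x
    proof -
      obtain \<mu> where "T x = x \<cdot> of_real \<mu>" using X(2)[OF x] by blast
      then show ?thesis
        using X(1)[OF x] VA[OF f] f x V by (simp add: T_symmetric ip_rscale_left)
    qed
    then show ?thesis using f V by simp
  qed
  have rV: "f \<cdot> a \<in> V" if "f \<in> V" for f a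
    using that X(1) V by (simp add: ip_rscale_right)
  define S where "S = tf ` {f \<in> V. sq f = 1}"
  define \<mu> where "\<mu> = Sup S"
  have bdd: "bdd_above S"
    using tf_le_sq VA by (intro bdd_aboveI[of _ "sqrt \<bar>C\<bar>"]) (fastforce simp: S_def)
  have S_le: "tf f \<le> \<mu>" if "f \<in> V" "sq f = 1" for f
    unfolding \<mu>_def by (rule cSup_upper[OF _ bdd]) (use that in \<open>auto simp: S_def\<close>)
  have \<mu>0: "0 \<le> \<mu>" using S_le[OF ne] form.sq_nonneg[OF VA[OF ne(1)]] by simp
  have le: "tf f \<le> \<mu> * sq f" if f: "f \<in> V" for f
  proof (cases "sq f = 0")
    case True
    then have "f = 0" using VA[OF f] by (intro ip_definite)
    then show ?thesis by simp
  next
    case False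
    then have pos: "sq f > 0" using sq_nonneg[OF VA[OF f]] by simp
    let ?c = "of_real (1 / sqrt (sq f)) :: quat"
    have "tf (f \<cdot> ?c) \<le> \<mu>"
      by (rule S_le[OF rV[OF f]]) (use pos VA[OF f] in \<open>simp add: sq_rscale power_divide del: of_real_divide\<close>)
    then have "1 / sq f * tf f \<le> \<mu>" using VA[OF f] by (simp add: form.sq_rscale power_divide del: of_real_divide)
    then show ?thesis using pos by (simp add: field_simps)
  qed
  show ?thesis
  \<comment> \<open>If the supremum is 0, the form vanishes at the given unit vector u, which then
    lies in the kernel of T and is itself the eigenvector.\<close>
  proof (cases "\<mu> = 0")
    case True
    have "tf u \<le> 0" using le[OF ne(1)] True by simp
    then have "T u = 0"
      using VA[OF ne(1)] form.sq_nonneg[OF VA[OF ne(1)]] by (intro tf_zero_imp antisym)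
    then show ?thesis using that[OF ne \<mu>0 _ le] True by simp
  next
    case False
    then have \<mu>: "\<mu> > 0" using \<mu>0 by simp
    have "\<exists>f\<in>V. sq f = 1 \<and> \<mu> - 1 / real (Suc n) < tf f" for n
    proof -
      have "\<mu> - 1 / real (Suc n) < Sup S" by (simp add: \<mu>_def)
      then obtain s where "s \<in> S" "\<mu> - 1 / real (Suc n) < s"
        using less_cSupD[of S] ne by (auto simp: S_def)
      then show ?thesis by (auto simp: S_def)
    qed
    then obtain F where F: "\<And>n. F n \<in> V" "\<And>n. sq (F n) = 1" "\<And>n. \<mu> - 1 / real (Suc n) < tf (F n)"
      by metis
    note FA = VA[OF F(1)]
    obtain r :: "nat \<Rightarrow> nat" and g where r: "strict_mono r" and g: "g \<in> A"
      and lim: "(\<lambda>n. sq (T (F (r n)) - g)) \<longlonglongrightarrow> 0"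
      using cpt FA F(2) unfolding T_compact_def by (metis order_refl)
    define H where "H = (\<lambda>n. F (r n))"
    have H: "H n \<in> V" "H n \<in> A" "sq (H n) = 1" for n using F FA by (auto simp: H_def)
    have "(\<lambda>n. tf (F n)) \<longlonglongrightarrow> \<mu>"
    proof (rule tendsto_sandwich[of "\<lambda>n. \<mu> - 1 / real (Suc n)" _ _ "\<lambda>_. \<mu>"])
      show "(\<lambda>n. \<mu> - 1 / real (Suc n)) \<longlonglongrightarrow> \<mu>"
        using tendsto_diff[OF tendsto_const LIMSEQ_Suc[OF lim_1_over_n], of \<mu>] by simp
    qed (use F S_le in \<open>auto intro!: eventuallyI less_imp_le\<close>)
    then have tfH: "(\<lambda>n. tf (H n)) \<longlonglongrightarrow> \<mu>"
      using r LIMSEQ_subseq_LIMSEQ by (fastforce simp: H_def o_def)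
    let ?m = "of_real \<mu> :: quat"
    have d_le: "sq (T (H n) - H n \<cdot> ?m) \<le> \<mu> * (\<mu> - tf (H n))" for n
    proof -
      have "sq (T (H n)) \<le> \<mu> * tf (H n)"
        using H le[OF TV] \<mu>0 by (intro sq_T_le) auto
      moreover have "qRe (ip (T (H n)) (H n \<cdot> ?m)) = \<mu> * tf (H n)"
        using H by (simp add: ip_rscale_right tf_def T_symmetric quat_mult_components)
      ultimately show ?thesis using H by (simp add: sq_diff sq_rscale algebra_simps power2_eq_square)
    qed
    have "(\<lambda>n. \<mu> * (\<mu> - tf (H n))) \<longlonglongrightarrow> \<mu> * (\<mu> - \<mu>)" by (intro tendsto_intros tfH)
    then have d0: "(\<lambda>n. sq (T (H n) - H n \<cdot> ?m)) \<longlonglongrightarrow> 0"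
      by (intro LIMSEQ_null_squeeze[OF _ d_le]) (use H in auto)
    have limH: "(\<lambda>n. sq (H n \<cdot> ?m - g)) \<longlonglongrightarrow> 0"
    proof (rule LIMSEQ_null_squeeze)
      show "(\<lambda>n. 2 * sq (T (H n) - H n \<cdot> ?m) + 2 * sq (T (H n) - g)) \<longlonglongrightarrow> 0"
        using tendsto_add[OF tendsto_mult_right_zero[OF d0, of 2] tendsto_mult_right_zero[OF lim, of 2]]
        by (simp add: H_def)
      fix n
      have "sq ((H n \<cdot> ?m - T (H n)) + (T (H n) - g)) \<le> 2 * sq (H n \<cdot> ?m - T (H n)) + 2 * sq (T (H n) - g)"
        using H g by (intro sq_add_le) auto
      then show "sq (H n \<cdot> ?m - g) \<le> 2 * sq (T (H n) - H n \<cdot> ?m) + 2 * sq (T (H n) - g)"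
        using H sq_minus_commute[of "H n \<cdot> ?m" "T (H n)"] by simp
    qed (use H g in auto)
    have Tg: "T g = g \<cdot> ?m"
    proof (rule sq_limit_unique[where F = "\<lambda>n. T (H n) \<cdot> ?m"])
      show "(\<lambda>n. sq (T (H n) \<cdot> ?m - T g)) \<longlonglongrightarrow> 0"
      proof (rule LIMSEQ_null_squeeze)
        show "(\<lambda>n. \<bar>C\<bar> * sq (H n \<cdot> ?m - g)) \<longlonglongrightarrow> 0" by (rule tendsto_mult_right_zero[OF limH])
        fix n
        have "sq (T (H n \<cdot> ?m - g)) \<le> C * sq (H n \<cdot> ?m - g)"
          using H g by (intro T_bounded) auto
        also have "\<dots> \<le> \<bar>C\<bar> * sq (H n \<cdot> ?m - g)" using H g by (intro mult_right_mono) auto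
        finally show "sq (T (H n) \<cdot> ?m - T g) \<le> \<bar>C\<bar> * sq (H n \<cdot> ?m - g)"
          using H g by (simp add: T_diff T_rscale)
      qed (use H g in auto)
      have "(\<lambda>n. \<mu>\<^sup>2 * sq (T (H n) - g)) \<longlonglongrightarrow> 0"
        by (rule tendsto_mult_right_zero) (use lim in \<open>simp add: H_def\<close>)
      moreover have "sq (T (H n) \<cdot> ?m - g \<cdot> ?m) = \<mu>\<^sup>2 * sq (T (H n) - g)" for n
        using H g by (simp add: sq_rscale flip: rscale_distrib(3))
      ultimately show "(\<lambda>n. sq (T (H n) \<cdot> ?m - g \<cdot> ?m)) \<longlonglongrightarrow> 0" by simp
    qed (use H g in auto)
    have "\<mu>\<^sup>2 \<le> 2 * sq (H n \<cdot> ?m - g) + 2 * sq g" for n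
      using sq_add_le[of "H n \<cdot> ?m - g" g] H g by (simp add: sq_rscale)
    moreover have "(\<lambda>n. 2 * sq (H n \<cdot> ?m - g) + 2 * sq g) \<longlonglongrightarrow> 2 * 0 + 2 * sq g"
      by (intro tendsto_intros limH)
    ultimately have "\<mu>\<^sup>2 \<le> 2 * 0 + 2 * sq g" by (intro LIMSEQ_le_const) auto
    moreover have "\<mu>\<^sup>2 > 0" using \<mu> by simp
    ultimately have sg: "sq g > 0" by linarith
    have gV: "g \<in> V"
    proof -
      have "ip x g = 0" if x: "x \<in> X" for x
      proof -
        have "(norm (ip x g))\<^sup>2 \<le> sq x * sq (H n \<cdot> ?m - g)" for n
        proof -
          have "ip x (H n \<cdot> ?m) = 0" using rV[OF H(1)] x V by simp
          then have "ip x (H n \<cdot> ?m - g) = - ip x g"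
            using X(1)[OF x] H g by (simp add: ip_diff_right)
          then show ?thesis
            using Cauchy_Schwarz[of x "H n \<cdot> ?m - g"] X(1)[OF x] H g by simp
        qed
        moreover have "(\<lambda>n. sq x * sq (H n \<cdot> ?m - g)) \<longlonglongrightarrow> 0" by (rule tendsto_mult_right_zero[OF limH])
        ultimately have "(norm (ip x g))\<^sup>2 \<le> 0" by (intro LIMSEQ_le_const) auto
        then show ?thesis by simp
      qed
      then show ?thesis using g V by simp
    qed
    let ?c = "of_real (1 / sqrt (sq g)) :: quat"
    show ?thesis
    proof (rule that[of "g \<cdot> ?c" \<mu>])
      show "sq (g \<cdot> ?c) = 1" using sg g by (simp add: sq_rscale power_divide del: of_real_divide)
      show "T (g \<cdot> ?c) = g \<cdot> ?c \<cdot> ?m"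
        unfolding T_rscale[OF g] Tg rscale_simps quat_of_real_commute[of \<mu> ?c] ..
    qed (use gV rV \<mu>0 le in auto)
  qed
qed

text \<open>A finite system cannot exhaust a space of infinite dimension. If all residuals of the
  first card X + 1 vectors u_k vanished, the sum of all |<x, u_k>|^2 would be card X + 1, whereas
  Bessel for u, applied to each x, bounds it by card X.\<close>

lemma exists_unit_orthogonal:
  assumes u: "orthonormal u (UNIV :: nat set)" and X: "finite X" "orthonormal (\<lambda>x. x) X"
  obtains f where "f \<in> A" "\<And>x. x \<in> X \<Longrightarrow> ip x f = 0" "sq f = 1"
proof -
  have uA: "u k \<in> A" for k using orthonormalD(1)[OF u] by simp
  have XA: "x \<in> A" if "x \<in> X" for x using orthonormalD(1)[OF X(2) that] by simp
  have "\<exists>k. sq (resid (\<lambda>x. x) X (u k)) \<noteq> 0"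
  proof (rule ccontr)
    assume "\<not> ?thesis"
    then have 1: "(\<Sum>x\<in>X. (norm (ip x (u k)))\<^sup>2) = 1" for k
      using sq_resid[OF X uA, of k] sq_orthonormal[OF u, of k] by simp
    let ?K = "{..card X}"
    have "real (card X) + 1 = (\<Sum>k\<in>?K. \<Sum>x\<in>X. (norm (ip x (u k)))\<^sup>2)"
      by (simp add: 1)
    also have "\<dots> = (\<Sum>x\<in>X. \<Sum>k\<in>?K. (norm (ip (u k) x))\<^sup>2)"
      by (subst sum.swap) (auto intro!: sum.cong simp: norm_ip_commute[OF XA uA])
    also have "\<dots> \<le> (\<Sum>x\<in>X. sq x)"
      by (intro sum_mono Bessel orthonormal_subset[OF u]) (auto simp: XA)
    also have "\<dots> = real (card X)" using sq_orthonormal[OF X(2)] by simp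
    finally show False by simp
  qed
  then obtain k where k: "sq (resid (\<lambda>x. x) X (u k)) \<noteq> 0" by blast
  define g where "g = resid (\<lambda>x. x) X (u k)"
  have g: "g \<in> A" "sq g > 0"
    using k resid_mem[OF X uA, of k] sq_nonneg[of g] by (auto simp: g_def less_le)
  show ?thesis
  proof (rule that[of "g \<cdot> of_real (1 / sqrt (sq g))"])
    show "sq (g \<cdot> of_real (1 / sqrt (sq g))) = 1"
      using g by (simp add: sq_rscale power_divide del: of_real_divide)
    fix x assume "x \<in> X"
    then show "ip x (g \<cdot> of_real (1 / sqrt (sq g))) = 0"
      using ip_resid[OF X uA] XA g by (simp add: ip_rscale_right g_def)
  qed (use g in simp)
qed

text \<open>Eigenvectors are chosen greedily, each maximal on the orthogonal complement of its
  predecessors; the infinite orthonormal system u keeps the choice from stopping. The last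
  conclusion retains this maximality, which later stands in for completeness of the system: vectors
  of the kernel of T may be missing from it.\<close>

lemma spectral_theorem:
  assumes cpt: T_compact and u: "orthonormal u (UNIV :: nat set)"
  obtains e :: "nat \<Rightarrow> 'a \<Rightarrow> quat" and \<mu> :: "nat \<Rightarrow> real"
  where "orthonormal e UNIV" "\<And>n. T (e n) = e n \<cdot> of_real (\<mu> n)" "\<And>n. 0 \<le> \<mu> n" "decseq \<mu>" "\<mu> \<longlonglongrightarrow> 0"
    "\<And>n f. f \<in> A \<Longrightarrow> (\<And>k. k < n \<Longrightarrow> ip (e k) f = 0) \<Longrightarrow> tf f \<le> \<mu> n * sq f"
proof -
  define P where "P = (\<lambda>X e \<mu>. e \<in> A \<and> (\<forall>x\<in>X. ip x e = 0) \<and> sq e = 1 \<and> 0 \<le> \<mu> \<and> T e = e \<cdot> of_real \<mu>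
    \<and> (\<forall>f\<in>A. (\<forall>x\<in>X. ip x f = 0) \<longrightarrow> tf f \<le> \<mu> * sq f))"
  define good where "good = (\<lambda>X. finite X \<and> orthonormal (\<lambda>x. x) X \<and> (\<forall>x\<in>X. \<exists>\<mu>. T x = x \<cdot> of_real \<mu>))"
  have next_ex: "\<exists>e \<mu>. P X e \<mu>" if "good X" for X
  proof -
    have X: "finite X" "orthonormal (\<lambda>x. x) X" "\<And>x. x \<in> X \<Longrightarrow> \<exists>\<mu>. T x = x \<cdot> of_real \<mu>"
      using that by (auto simp: good_def)
    obtain v where v: "v \<in> A" "\<And>x. x \<in> X \<Longrightarrow> ip x v = 0" "sq v = 1"
      using exists_unit_orthogonal[OF u X(1,2)] by blast
    have "v \<in> {f \<in> A. \<forall>x\<in>X. ip x f = 0}" using v by simp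
    from maximal_eigenvector[OF cpt orthonormalD(1)[OF X(2)] X(3) refl this v(3)]
    show ?thesis unfolding P_def mem_Collect_eq by (metis (no_types, lifting))
  qed
  define E where "E = (\<lambda>X. SOME e. \<exists>\<mu>. P X e \<mu>)"
  \<comment> \<open>The recursion carries the set of all vectors chosen so far, since each choice
    depends on all of them.\<close>
  define Xs where "Xs = rec_nat {} (\<lambda>_ X. insert (E X) X)"
  have Xs: "Xs 0 = {}" "Xs (Suc n) = insert (E (Xs n)) (Xs n)" for n by (simp_all add: Xs_def)
  define e where "e = (\<lambda>n. E (Xs n))"
  have Xs_e: "Xs n = e ` {..<n}" for n
    by (induction n) (simp_all add: Xs e_def lessThan_Suc)
  have PE: "\<exists>\<mu>. P X (E X) \<mu>" if "good X" for X
    unfolding E_def by (rule someI_ex[of "\<lambda>e. \<exists>\<mu>. P X e \<mu>"]) (rule next_ex[OF that])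
  have good: "good (Xs n)" for n
  proof (induction n)
    case 0 then show ?case by (simp add: Xs good_def orthonormal_def)
  next
    case (Suc n)
    from PE[OF Suc] obtain \<mu> where p: "P (Xs n) (E (Xs n)) \<mu>" by blast
    then have 1: "E (Xs n) \<in> A" "\<And>x. x \<in> Xs n \<Longrightarrow> ip x (E (Xs n)) = 0" "ip (E (Xs n)) (E (Xs n)) = 1"
      "T (E (Xs n)) = E (Xs n) \<cdot> of_real \<mu>"
      by (auto simp: P_def ip_self)
    have XA: "x \<in> A" if "x \<in> Xs n" for x using Suc that by (auto simp: good_def orthonormal_def)
    have 2: "ip (E (Xs n)) x = 0" if "x \<in> Xs n" for x
      using 1(2)[OF that] qcnj_ip[OF XA[OF that] 1(1)] by simp
    have 3: "E (Xs n) \<notin> Xs n" using 1 by fastforce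
    show ?case
      using Suc 1 2 3 unfolding good_def orthonormal_def Xs by auto
  qed
  obtain \<mu> where \<mu>: "\<And>n. P (Xs n) (e n) (\<mu> n)"
    using PE[OF good] unfolding e_def by metis
  have eA: "e n \<in> A" and sqe: "sq (e n) = 1" and \<mu>0: "0 \<le> \<mu> n" and Te: "T (e n) = e n \<cdot> of_real (\<mu> n)" for n
    using \<mu>[of n] by (auto simp: P_def)
  have lt: "ip (e k) (e n) = 0" if "k < n" for k n
    using \<mu>[of n] that by (auto simp: P_def Xs_e)
  have on: "orthonormal e UNIV"
  proof -
    have "ip (e k) (e l) = (if k = l then 1 else 0)" for k l
    proof (cases k l rule: linorder_cases)
      case greater
      then show ?thesis using lt[OF greater] qcnj_ip[OF eA eA, of l k] by simp
    qed (use lt eA sqe in \<open>simp_all add: ip_self\<close>)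
    then show ?thesis by (simp add: orthonormal_def eA)
  qed
  have max: "tf f \<le> \<mu> n * sq f" if "f \<in> A" "\<And>k. k < n \<Longrightarrow> ip (e k) f = 0" for n f
    using \<mu>[of n] that by (auto simp: P_def Xs_e)
  have tfe: "tf (e n) = \<mu> n" for n
    by (simp add: tf_def Te ip_rscale_right eA ip_self sqe)
  have dec: "decseq \<mu>"
  proof (rule decseq_SucI)
    fix n
    show "\<mu> (Suc n) \<le> \<mu> n" using max[OF eA[of "Suc n"], of n] lt by (simp add: tfe sqe)
  qed
  \<comment> \<open>The images T (e n) are orthogonal and have norm \<mu> n. Compactness gives a
    convergent subsequence, whose consecutive members come close only if these norms tend to 0;
    monotonicity extends this to the whole sequence.\<close>
  have conv: "\<mu> \<longlonglongrightarrow> 0"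
  proof -
    obtain r :: "nat \<Rightarrow> nat" and g where r: "strict_mono r" and g: "g \<in> A"
      and lim: "(\<lambda>n. sq (T (e (r n)) - g)) \<longlonglongrightarrow> 0"
      using cpt eA sqe unfolding T_compact_def by (metis order_refl)
    have le: "(\<mu> (r n))\<^sup>2 \<le> 2 * sq (T (e (r n)) - g) + 2 * sq (T (e (r (Suc n))) - g)" for n
    proof -
      have ne: "r n \<noteq> r (Suc n)" using strict_monoD[OF r, of n "Suc n"] by simp
      have "sq (T (e (r n)) - T (e (r (Suc n)))) = (\<mu> (r n))\<^sup>2 + (\<mu> (r (Suc n)))\<^sup>2"
        using ne orthonormalD(2)[OF on, of "r n" "r (Suc n)"]
        by (simp add: sq_diff Te eA sq_rscale sqe ip_rscale_left ip_rscale_right)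
      moreover have "sq ((T (e (r n)) - g) + (g - T (e (r (Suc n)))))
          \<le> 2 * sq (T (e (r n)) - g) + 2 * sq (g - T (e (r (Suc n))))"
        using eA g by (intro sq_add_le) auto
      moreover have "sq (g - T (e (r (Suc n)))) = sq (T (e (r (Suc n))) - g)"
        using eA g by (intro sq_minus_commute) auto
      ultimately show ?thesis by simp (smt (verit) zero_le_power2)
    qed
    have "(\<lambda>n. 2 * sq (T (e (r n)) - g) + 2 * sq (T (e (r (Suc n))) - g)) \<longlonglongrightarrow> 2 * 0 + 2 * 0"
      by (intro tendsto_intros lim LIMSEQ_Suc[OF lim])
    then have "(\<lambda>n. (\<mu> (r n))\<^sup>2) \<longlonglongrightarrow> 0"
      by (intro LIMSEQ_null_squeeze[OF _ le]) auto
    then have "(\<lambda>n. sqrt ((\<mu> (r n))\<^sup>2)) \<longlonglongrightarrow> sqrt 0" by (rule tendsto_real_sqrt)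
    then have 0: "(\<lambda>n. \<mu> (r n)) \<longlonglongrightarrow> 0" using \<mu>0 by simp
    obtain L where L: "\<mu> \<longlonglongrightarrow> L" using decseq_convergent[OF dec, of 0] \<mu>0 by blast
    then have "(\<lambda>n. \<mu> (r n)) \<longlonglongrightarrow> L" using LIMSEQ_subseq_LIMSEQ[OF L r] by (simp add: o_def)
    with 0 have "L = 0" by (rule LIMSEQ_unique[rotated])
    with L show ?thesis by simp
  qed
  show ?thesis by (rule that[OF on Te \<mu>0 dec conv max])
qed

end

locale spectral_operator = positive_operator +
  fixes e :: "nat \<Rightarrow> 'a \<Rightarrow> quat" and \<mu> :: "nat \<Rightarrow> real"
  assumes e_orthonormal: "orthonormal e UNIV"
    and T_e: "T (e n) = e n \<cdot> of_real (\<mu> n)"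
    and \<mu>_nonneg: "0 \<le> \<mu> n"
    and \<mu>_decseq: "decseq \<mu>" and \<mu>_lim: "\<mu> \<longlonglongrightarrow> 0"
    and \<mu>_max: "f \<in> A \<Longrightarrow> (\<And>k. k < n \<Longrightarrow> ip (e k) f = 0) \<Longrightarrow> tf f \<le> \<mu> n * sq f"
begin

lemma e_mem [simp]: "e n \<in> A"
  using orthonormalD(1)[OF e_orthonormal] by simp

lemma ip_e: "ip (e k) (e l) = (if k = l then 1 else 0)"
  using orthonormalD(2)[OF e_orthonormal] by simp

lemma sq_e: "sq (e k) = 1"
  by (simp add: sq_def ip_e)

abbreviation "rem N \<equiv> resid e {..<N}"

lemma rem:
  assumes "f \<in> A"
  shows "rem N f \<in> A" "k < N \<Longrightarrow> ip (e k) (rem N f) = 0" "sq (rem N f) \<le> sq f"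
proof -
  note * = finite_lessThan[of N] orthonormal_subset[OF e_orthonormal subset_UNIV, of "{..<N}"]
  show "rem N f \<in> A" by (rule resid_mem[OF * assms])
  show "k < N \<Longrightarrow> ip (e k) (rem N f) = 0" using ip_resid[OF * assms] by simp
  show "sq (rem N f) \<le> sq f" by (simp add: sq_resid[OF * assms] sum_nonneg)
qed

lemma Bessel_e: "f \<in> A \<Longrightarrow> (\<Sum>k<N. (norm (ip (e k) f))\<^sup>2) \<le> sq f"
  by (rule Bessel[OF _ orthonormal_subset[OF e_orthonormal]]) auto

lemma T_rem:
  assumes f: "f \<in> A"
  shows "T (rem N f) = T f - (\<Sum>k<N. e k \<cdot> (of_real (\<mu> k) * ip (e k) f))"
  using f by (simp add: resid_def T_diff T_sum T_rscale T_e)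

text \<open>The span of the first N eigenvectors is invariant, so it is orthogonal to the remainder
  for the form as well.\<close>

lemma tf_rem:
  assumes f: "f \<in> A"
  shows "tf f = (\<Sum>k<N. \<mu> k * (norm (ip (e k) f))\<^sup>2) + tf (rem N f)"
proof -
  define s where "s = (\<Sum>k<N. e k \<cdot> ip (e k) f)"
  have s: "s \<in> A" using f by (simp add: s_def)
  have Ts: "T s = (\<Sum>k<N. e k \<cdot> (of_real (\<mu> k) * ip (e k) f))"
    using f by (simp add: s_def T_sum T_rscale T_e)
  have fe: "f = s + rem N f" by (simp add: resid_def s_def)
  have 0: "ip (rem N f) (T s) = 0"
  proof -
    have "ip (rem N f) (e k) = 0" if "k < N" for k
      using rem(2)[OF f that] qcnj_ip[OF e_mem rem(1)[OF f], of k N] by simp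
    then show ?thesis using rem(1)[OF f] f by (simp add: Ts ip_sum_right ip_rscale_right)
  qed
  have "tf f = tf s + tf (rem N f)"
  proof -
    have "qRe (ip s (T (rem N f))) = qRe (ip (rem N f) (T s))"
      using form.qRe_ip_commute[OF s rem(1)[OF f]] .
    then show ?thesis
      using form.sq_add[OF s rem(1)[OF f], of N] 0 by (simp flip: fe)
  qed
  moreover have "tf s = (\<Sum>k<N. \<mu> k * (norm (ip (e k) f))\<^sup>2)"
  proof -
    have "tf s = qRe (ip s (T s))" by (rule tf_def)
    also have "\<dots> = (\<Sum>k<N. qRe (ip s (e k) * (of_real (\<mu> k) * ip (e k) f)))"
      using s f by (simp add: Ts ip_sum_right ip_rscale_right bounded_linear.linear[OF bounded_linear_qRe, THEN linear_sum])
    also have "\<dots> = (\<Sum>k<N. \<mu> k * (norm (ip (e k) f))\<^sup>2)"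
    proof (rule sum.cong[OF refl])
      fix k assume k: "k \<in> {..<N}"
      have "ip (e k) s = (\<Sum>l<N. ip (e k) (e l) * ip (e l) f)"
        unfolding s_def using f by (subst ip_sum_right) (simp_all add: ip_rscale_right)
      also have "\<dots> = (\<Sum>l<N. if l = k then ip (e k) f else 0)"
        by (intro sum.cong) (auto simp: ip_e)
      also have "\<dots> = ip (e k) f" using k by simp
      finally have "ip s (e k) = qcnj (ip (e k) f)" using qcnj_ip[OF e_mem s] by metis
      then have "ip s (e k) * (of_real (\<mu> k) * ip (e k) f) = of_real (\<mu> k) * (qcnj (ip (e k) f) * ip (e k) f)"
        by (metis mult.assoc quat_of_real_commute)
      then show "qRe (ip s (e k) * (of_real (\<mu> k) * ip (e k) f)) = \<mu> k * (norm (ip (e k) f))\<^sup>2"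
        by (simp add: qcnj_mult_self del: of_real_power flip: of_real_mult)
    qed
    finally show ?thesis .
  qed
  ultimately show ?thesis by simp
qed

lemma tf_rem_le: "f \<in> A \<Longrightarrow> tf (rem N f) \<le> \<mu> N * sq f"
  using \<mu>_max[OF rem(1) rem(2), of f N N] rem(3)[of f N] mult_left_mono[OF rem(3) \<mu>_nonneg, of f N N]
  by simp

text \<open>The partial sums miss \<open>tf f\<close> by the form of a remainder, which is at most
  \<open>\<mu> N * sq f\<close>.\<close>

lemma tf_sums:
  assumes f: "f \<in> A"
  shows "(\<lambda>k. \<mu> k * (norm (ip (e k) f))\<^sup>2) sums tf f"
  unfolding sums_def
proof (rule tendsto_sandwich[where h = "\<lambda>_. tf f" and f = "\<lambda>N. tf f - \<mu> N * sq f"])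
  show "(\<lambda>N. tf f - \<mu> N * sq f) \<longlonglongrightarrow> tf f"
    using tendsto_diff[OF tendsto_const tendsto_mult_left_zero[OF \<mu>_lim, of "sq f"], of "tf f"] by simp
  show "\<forall>\<^sub>F N in sequentially. tf f - \<mu> N * sq f \<le> (\<Sum>k<N. \<mu> k * (norm (ip (e k) f))\<^sup>2)"
  proof (intro always_eventually allI)
    fix N show "tf f - \<mu> N * sq f \<le> (\<Sum>k<N. \<mu> k * (norm (ip (e k) f))\<^sup>2)"
      using tf_rem[OF f, of N] tf_rem_le[OF f, of N] by simp
  qed
  show "\<forall>\<^sub>F N in sequentially. (\<Sum>k<N. \<mu> k * (norm (ip (e k) f))\<^sup>2) \<le> tf f"
  proof (intro always_eventually allI)
    fix N show "(\<Sum>k<N. \<mu> k * (norm (ip (e k) f))\<^sup>2) \<le> tf f"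
      using tf_rem[OF f, of N] form.sq_nonneg[OF rem(1)[OF f, of N]] by simp
  qed
qed simp

text \<open>By symmetry T maps the remainder to a vector still orthogonal to the first N
  eigenvectors, so \<mu> N bounds the form both at the remainder and at its image. This gives the
  square.\<close>

lemma sq_T_rem:
  assumes f: "f \<in> A" shows "sq (T (rem N f)) \<le> (\<mu> N)\<^sup>2 * sq f"
proof -
  let ?r = "rem N f"
  have r: "?r \<in> A" by (rule rem(1)[OF f])
  have "ip (e k) (T ?r) = 0" if "k < N" for k
    using rem(2)[OF f that] r by (simp add: T_symmetric T_e ip_rscale_left)
  then have "tf (T ?r) \<le> \<mu> N * sq (T ?r)" using r by (intro \<mu>_max) auto
  then have "sq (T ?r) \<le> \<mu> N * tf ?r" using r \<mu>_nonneg by (intro sq_T_le) auto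
  also have "\<dots> \<le> \<mu> N * (\<mu> N * sq f)" by (intro mult_left_mono tf_rem_le f \<mu>_nonneg)
  finally show ?thesis by (simp add: power2_eq_square)
qed

text \<open>On each \<open>e\<^sub>k\<close> a positive square root \<open>S\<close> of \<open>T\<^sup>2\<close> satisfies \<open>(S + \<mu>\<^sub>k) (S - \<mu>\<^sub>k) e\<^sub>k = 0\<close>,
  and \<open>\<parallel>S h\<parallel> = \<parallel>T h\<parallel>\<close> controls the remainders.\<close>

lemma positive_sqrt_unique:
  assumes S: "positive_operator A ip S D" and SS: "\<And>f. f \<in> A \<Longrightarrow> S (S f) = T (T f)" and f: "f \<in> A"
  shows "S f = T f"
proof -
  interpret S: positive_operator A ip S D by (rule S)
  have Se: "S (e k) = T (e k)" for k
  proof (cases "\<mu> k = 0")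
    case True
    then have T0: "T (e k) = 0" using T_e by simp
    have "sq (S (e k)) = qRe (ip (e k) (S (S (e k))))"
      by (simp add: sq_def S.T_symmetric)
    also have "\<dots> = 0" by (simp add: SS T0)
    finally show ?thesis using T0 ip_definite[of "S (e k)"] by simp
  next
    case False
    let ?m = "of_real (\<mu> k) :: quat"
    define h where "h = S (e k) - e k \<cdot> ?m"
    have h: "h \<in> A" by (simp add: h_def)
    have "S h + h \<cdot> ?m = 0"
      by (simp add: h_def S.T_diff S.T_rscale SS T_e T_rscale rscale_distrib)
    then have "S h = - (h \<cdot> ?m)" by (simp add: eq_neg_iff_add_eq_0)
    then have "qRe (ip h (S h)) = - (\<mu> k * sq h)"
      using h by (simp add: ip_minus_right ip_rscale_right ip_self quat_mult_components)
    moreover have "0 \<le> qRe (ip h (S h))" by (rule S.form.ip_nonneg[OF h])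
    moreover have "0 < \<mu> k" using False \<mu>_nonneg[of k] by simp
    ultimately have "sq h \<le> 0" by (simp add: mult_le_0_iff)
    then have "h = 0" using sq_nonneg[OF h] by (intro ip_definite h) simp
    then show ?thesis by (simp add: h_def T_e)
  qed
  have sqS: "sq (S g) = sq (T g)" if g: "g \<in> A" for g
  proof -
    have "sq (S g) = qRe (ip g (S (S g)))" using g by (simp add: sq_def S.T_symmetric)
    also have "\<dots> = sq (T g)" using g by (simp add: SS sq_def T_symmetric)
    finally show ?thesis .
  qed
  \<comment> \<open>S and T agree on the eigenvectors, so only the remainder r contributes; 2 |S
    r|^2 + 2 |T r|^2 = 4 |T r|^2 gives the constant.\<close>
  have le: "sq (S f - T f) \<le> 4 * sq f * (\<mu> N)\<^sup>2" for N
  proof -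
    let ?r = "rem N f"
    have r: "?r \<in> A" by (rule rem(1)[OF f])
    have "S ?r = S f - (\<Sum>k<N. e k \<cdot> (of_real (\<mu> k) * ip (e k) f))"
      using f by (simp add: resid_def S.T_diff S.T_sum S.T_rscale Se T_e)
    then have eq: "S f - T f = S ?r - T ?r" using T_rem[OF f, of N] by simp
    have "0 \<le> sq (S ?r + T ?r)" using r by (intro sq_nonneg) auto
    then have "sq (S ?r - T ?r) \<le> 2 * sq (S ?r) + 2 * sq (T ?r)"
      unfolding sq_add[OF S.T_mem[OF r] T_mem[OF r]] sq_diff[OF S.T_mem[OF r] T_mem[OF r]] by simp
    then show ?thesis
      unfolding eq sqS[OF r] using sq_T_rem[OF f, of N] by (simp add: mult_ac)
  qed
  have "(\<lambda>N. 4 * sq f * (\<mu> N)\<^sup>2) \<longlonglongrightarrow> 4 * sq f * 0\<^sup>2" by (intro tendsto_intros \<mu>_lim)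
  then have "sq (S f - T f) \<le> 4 * sq f * 0\<^sup>2" by (rule LIMSEQ_le_const) (use le in auto)
  moreover have "0 \<le> sq (S f - T f)" using f by (intro sq_nonneg) auto
  ultimately show ?thesis using f by (intro eq_iff_sq_diff) auto
qed

lemma finite_eigenvalue: "c > 0 \<Longrightarrow> finite {n. \<mu> n = c}"
proof -
  assume "c > 0"
  then have "\<forall>\<^sub>F n in sequentially. \<mu> n < c" using \<mu>_lim by (rule order_tendstoD(2)[rotated])
  then obtain N where "\<And>n. n \<ge> N \<Longrightarrow> \<mu> n < c" by (auto simp: eventually_sequentially)
  then have "{n. \<mu> n = c} \<subseteq> {..<N}" by (force simp: not_le[symmetric])
  then show ?thesis by (rule finite_subset) simp
qed

text \<open>The residual g is again an eigenvector for c. It is orthogonal to the \<open>e k\<close>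
  with \<mu> k = c by construction and to the others by symmetry, so maximality gives c |g|^2 \<le>
  \<mu> n |g|^2 for all n, and the right side tends to 0.\<close>

lemma eigenvector_expansion:
  assumes f: "f \<in> A" and c: "c > 0" and eig: "T f = f \<cdot> of_real c"
  shows "f = (\<Sum>k\<in>{n. \<mu> n = c}. e k \<cdot> ip (e k) f)"
proof -
  let ?I = "{n. \<mu> n = c}"
  note I = finite_eigenvalue[OF c] orthonormal_subset[OF e_orthonormal subset_UNIV, of ?I]
  define g where "g = resid e ?I f"
  have g: "g \<in> A" unfolding g_def by (rule resid_mem[OF I f])
  have Tg: "T g = g \<cdot> of_real c"
    using f eig by (simp add: g_def resid_def T_diff T_sum T_rscale T_e rscale_distrib rscale_sum
        quat_of_real_commute[of c])
  have orth: "ip (e k) g = 0" for k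
  proof (cases "\<mu> k = c")
    case True then show ?thesis using ip_resid[OF I f] by (simp add: g_def)
  next
    case False
    have "ip (e k) g * of_real c = ip (e k) (T g)" using g by (simp add: Tg ip_rscale_right)
    also have "\<dots> = of_real (\<mu> k) * ip (e k) g" using g by (simp add: T_symmetric T_e ip_rscale_left)
    finally have "of_real (c - \<mu> k) * ip (e k) g = 0"
      by (simp add: left_diff_distrib quat_of_real_commute[of c])
    then show ?thesis using False by simp
  qed
  have "c * sq g \<le> \<mu> n * sq g" for n
  proof -
    have "tf g = c * sq g" using g by (simp add: tf_def Tg ip_rscale_right ip_self mult.commute flip: of_real_mult)
    then show ?thesis using \<mu>_max[OF g, of n] orth by simp
  qed
  moreover have "(\<lambda>n. \<mu> n * sq g) \<longlonglongrightarrow> 0" by (rule tendsto_mult_left_zero[OF \<mu>_lim])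
  ultimately have "c * sq g \<le> 0" by (intro LIMSEQ_le_const) auto
  then have "sq g = 0" using c sq_nonneg[OF g] by (simp add: mult_le_0_iff)
  then have "g = 0" by (rule ip_definite[OF g])
  then show ?thesis by (simp add: g_def resid_def)
qed

end

text \<open>The value \<open>t n\<close> can occur in the decreasing sequence s only before n, where
  s and t agree; t attains it once more, at n itself.\<close>

lemma decseq_multiplicities_first_difference:
  fixes s t :: "nat \<Rightarrow> real"
  assumes dec: "decseq s" and s0: "0 \<le> s n"
    and mult: "\<And>c. c > 0 \<Longrightarrow> finite {n. t n = c} \<and> card {n. s n = c} = card {n. t n = c}"
    and eq: "\<And>k. k < n \<Longrightarrow> s k = t k" and less: "s n < t n"
  shows False
proof -
  have pos: "t n > 0" using s0 less by simp
  have "{k. s k = t n} \<subset> {k. t k = t n}"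
  proof
    show "{k. s k = t n} \<subseteq> {k. t k = t n}"
    proof
      fix k assume k: "k \<in> {k. s k = t n}"
      have "k < n"
      proof (rule ccontr)
        assume "\<not> k < n"
        then have "s k \<le> s n" using decseqD[OF dec] by simp
        then show False using k less by simp
      qed
      then show "k \<in> {k. t k = t n}" using k eq by simp
    qed
    have "n \<in> {k. t k = t n}" "n \<notin> {k. s k = t n}" using less by auto
    then show "{k. s k = t n} \<noteq> {k. t k = t n}" by metis
  qed
  from psubset_card_mono[OF _ this] mult[OF pos] show False by simp
qed

lemma decseq_eqI_multiplicities:
  fixes s t :: "nat \<Rightarrow> real"
  assumes "decseq s" "decseq t" "\<And>n. 0 \<le> s n" "\<And>n. 0 \<le> t n"
    and fin: "\<And>c. c > 0 \<Longrightarrow> finite {n. s n = c}" "\<And>c. c > 0 \<Longrightarrow> finite {n. t n = c}"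
    and card: "\<And>c. c > 0 \<Longrightarrow> card {n. s n = c} = card {n. t n = c}"
  shows "s = t"
proof
  fix n show "s n = t n"
  proof (induction n rule: less_induct)
    case (less n)
    show ?case
    proof (cases "s n" "t n" rule: linorder_cases)
      case lt: less
      then show ?thesis
        using decseq_multiplicities_first_difference[OF assms(1,3)] less fin card by blast
    next
      case greater
      have "False"
        by (rule decseq_multiplicities_first_difference[OF assms(2,4), of s])
          (use greater less fin card in auto)
      then show ?thesis ..
    qed
  qed
qed

text \<open>The base change matrices \<open>P\<close>, \<open>Q\<close> between two bases are mutually inverse, and
  \<open>Re tr (P Q) = Re tr (Q P)\<close> although the scalars do not commute.\<close>

lemma has_right_dim_unique:
  assumes "has_right_dim V n" "has_right_dim V m"
  shows "n = m"
proof -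
  obtain B where B: "finite B" "card B = n" "V = {f. \<exists>c. f = (\<lambda>x. \<Sum>b\<in>B. b x * c b)}"
    "\<And>c. (\<And>x. (\<Sum>b\<in>B. b x * c b) = 0) \<Longrightarrow> (\<forall>b\<in>B. c b = 0)"
    using assms(1) unfolding has_right_dim_def by blast
  obtain D where D: "finite D" "card D = m" "V = {f. \<exists>c. f = (\<lambda>x. \<Sum>b\<in>D. b x * c b)}"
    "\<And>c. (\<And>x. (\<Sum>b\<in>D. b x * c b) = 0) \<Longrightarrow> (\<forall>b\<in>D. c b = 0)"
    using assms(2) unfolding has_right_dim_def by blast
  have mem: "b \<in> {f. \<exists>c. f = (\<lambda>x. \<Sum>b\<in>E. b x * c b)}" if "finite E" "b \<in> E" for b :: "quat \<Rightarrow> quat" and E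
  proof -
    have "b = (\<lambda>x. \<Sum>b'\<in>E. b' x * (if b' = b then 1 else 0))"
    proof
      fix x
      have "(\<Sum>b'\<in>E. b' x * (if b' = b then 1 else 0)) = (\<Sum>b'\<in>E. if b' = b then b x else 0)"
        by (intro sum.cong) auto
      then show "b x = (\<Sum>b'\<in>E. b' x * (if b' = b then 1 else 0))" using that by simp
    qed
    then show ?thesis
      unfolding mem_Collect_eq by (rule exI[of _ "\<lambda>b'. if b' = b then 1 else 0"])
  qed
  have "\<forall>b\<in>B. \<exists>c. b = (\<lambda>x. \<Sum>d\<in>D. d x * c d)" using mem[OF B(1)] B(3) D(3) by blast
  then obtain P where P: "\<And>b x. b \<in> B \<Longrightarrow> b x = (\<Sum>d\<in>D. d x * P b d)" by (metis (no_types))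
  have "\<forall>d\<in>D. \<exists>c. d = (\<lambda>x. \<Sum>b\<in>B. b x * c b)" using mem[OF D(1)] B(3) D(3) by blast
  then obtain Q where Q: "\<And>d x. d \<in> D \<Longrightarrow> d x = (\<Sum>b\<in>B. b x * Q d b)" by (metis (no_types))
  \<comment> \<open>Expressing b through D and then back through B gives coordinates of b in B, so
    independence makes the coefficient at b equal to 1. The bases are generic here because the
    argument is used in both directions.\<close>
  have diag: "(\<Sum>d\<in>D. Q d b * P b d) = 1"
    if E: "finite B" "\<And>c. (\<And>x. (\<Sum>b\<in>B. b x * c b) = 0) \<Longrightarrow> (\<forall>b\<in>B. c b = 0)"
      and P: "\<And>b x. b \<in> B \<Longrightarrow> b x = (\<Sum>d\<in>D. d x * P b d)"
      and Q: "\<And>d x. d \<in> D \<Longrightarrow> d x = (\<Sum>b\<in>B. b x * Q d b)" and b: "b \<in> B"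
    for B D :: "(quat \<Rightarrow> quat) set" and P Q :: "_ \<Rightarrow> _ \<Rightarrow> quat" and b
  proof -
    let ?c = "\<lambda>b'. (\<Sum>d\<in>D. Q d b' * P b d) - (if b' = b then 1 else 0)"
    have "(\<Sum>b'\<in>B. b' x * ?c b') = 0" for x
    proof -
      have "b x = (\<Sum>d\<in>D. (\<Sum>b'\<in>B. b' x * Q d b') * P b d)"
        unfolding P[OF b, of x] by (rule sum.cong[OF refl]) (simp only: Q[symmetric])
      also have "\<dots> = (\<Sum>b'\<in>B. b' x * (\<Sum>d\<in>D. Q d b' * P b d))"
        by (simp add: sum_distrib_left sum_distrib_right mult.assoc sum.swap[of _ B])
      finally have 1: "(\<Sum>b'\<in>B. b' x * (\<Sum>d\<in>D. Q d b' * P b d)) = b x" by simp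
      have "(\<Sum>b'\<in>B. b' x * (if b' = b then 1 else 0)) = (\<Sum>b'\<in>B. if b' = b then b x else 0)"
        by (intro sum.cong) auto
      then have 2: "(\<Sum>b'\<in>B. b' x * (if b' = b then 1 else 0)) = b x" using E(1) b by simp
      show ?thesis unfolding right_diff_distrib sum_subtractf 1 2 by simp
    qed
    from bspec[OF E(2)[OF this] b] show ?thesis by simp
  qed
  have lin: "qRe (\<Sum>k\<in>I. h k) = (\<Sum>k\<in>I. qRe (h k))" for h and I :: "(quat \<Rightarrow> quat) set"
    by (rule linear_sum[OF bounded_linear.linear[OF bounded_linear_qRe]])
  have "real n = (\<Sum>b\<in>B. qRe (\<Sum>d\<in>D. Q d b * P b d))"
    using diag[OF B(1,4) P Q] B(2) by simp
  also have "\<dots> = (\<Sum>d\<in>D. qRe (\<Sum>b\<in>B. P b d * Q d b))"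
    unfolding lin by (subst sum.swap) (simp add: qRe_mult_commute)
  also have "\<dots> = real m"
    using diag[OF D(1,4) Q P] D(2) by simp
  finally show ?thesis by simp
qed

section \<open>Compactness from bounded partial traces\<close>

context positive_operator
begin

text \<open>Among all systems orthonormal for the form, take one whose sum is within \<epsilon> of
  the supremum. If a residual r had |T r|^2 > \<epsilon> \<open>tf r\<close>, appending r,
  normalised for the form, would exceed the supremum.\<close>

lemma finite_rank_approximation:
  assumes bound: "\<And>n (v :: nat \<Rightarrow> _). form.orthonormal v {..<n} \<Longrightarrow> (\<Sum>k<n. sq (T (v k))) \<le> K"
    and \<epsilon>: "\<epsilon> > 0"
  obtains n :: nat and v where "form.orthonormal v {..<n}"
    "\<And>f. f \<in> A \<Longrightarrow> sq (T (form.resid v {..<n} f)) \<le> \<epsilon> * tf f"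
proof -
  define S where "S = {s. \<exists>n (v :: nat \<Rightarrow> _). form.orthonormal v {..<n} \<and> s = (\<Sum>k<n. sq (T (v k)))}"
  have bdd: "bdd_above S" using bound by (intro bdd_aboveI[of _ K]) (auto simp: S_def)
  \<comment> \<open>The empty system makes the set of sums nonempty, so the supremum is meaningful
    even if the form vanishes identically.\<close>
  have "form.orthonormal (\<lambda>_. 0) {..<0::nat}" by (simp add: form.orthonormal_def)
  then have "S \<noteq> {}" unfolding S_def by blast
  then obtain s where s: "s \<in> S" "Sup S - \<epsilon> < s" using less_cSupD[of S "Sup S - \<epsilon>"] \<epsilon> by auto
  then obtain n and v :: "nat \<Rightarrow> _" where v: "form.orthonormal v {..<n}" and sv: "s = (\<Sum>k<n. sq (T (v k)))"
    unfolding S_def by blast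
  show ?thesis
  proof (rule that[OF v])
    fix f assume f: "f \<in> A"
    define r where "r = form.resid v {..<n} f"
    note * = finite_lessThan[of n] v f
    have r: "r \<in> A" unfolding r_def by (rule form.resid_mem[OF *])
    have o: "ip (v k) (T r) = 0" if "k < n" for k
      unfolding r_def by (rule form.ip_resid[OF *]) (use that in simp)
    have rf: "tf r \<le> tf f" unfolding r_def by (simp add: form.sq_resid[OF *] sum_nonneg)
    have "sq (T r) \<le> \<epsilon> * tf r"
    proof (cases "tf r = 0")
      case True
      then show ?thesis using tf_zero_imp[OF r] by simp
    next
      case False
      then have pos: "tf r > 0" using form.sq_nonneg[OF r] by simp
      define w where "w = r \<cdot> of_real (1 / sqrt (tf r))"
      define v' where "v' = v(n := w)"
      have w: "w \<in> A" "tf w = 1"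
        using r pos by (simp_all add: w_def form.sq_rscale power_divide del: of_real_divide)
      have vA: "v k \<in> A" if "k < n" for k using form.orthonormalD(1)[OF v] that by simp
      have o1: "ip (v k) (T w) = 0" if "k < n" for k
        using o[OF that] r vA[OF that] by (simp add: w_def T_rscale ip_rscale_right)
      have o2: "ip w (T (v k)) = 0" if "k < n" for k
        using form.qcnj_ip[OF vA[OF that] w(1)] o1[OF that] by simp
      have "form.orthonormal v' {..<Suc n}"
        using form.orthonormalD[OF v] o1 o2 w ip_T_self[OF w(1)]
        by (auto simp: form.orthonormal_def v'_def less_Suc_eq)
      then have "(\<Sum>k<Suc n. sq (T (v' k))) \<in> S" unfolding S_def by blast
      then have "(\<Sum>k<Suc n. sq (T (v' k))) \<le> Sup S" by (rule cSup_upper[OF _ bdd])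
      moreover have "(\<Sum>k<Suc n. sq (T (v' k))) = s + sq (T w)"
        by (simp add: sv v'_def)
      ultimately have "sq (T w) \<le> \<epsilon>" using s(2) by simp
      moreover have "sq (T w) = sq (T r) / tf r"
        using r pos by (simp add: w_def T_rscale sq_rscale power_divide del: of_real_divide)
      ultimately show ?thesis using pos by (simp add: field_simps)
    qed
    also have "\<dots> \<le> \<epsilon> * tf f" using rf \<epsilon> by simp
    finally show "sq (T (form.resid v {..<n} f)) \<le> \<epsilon> * tf f" unfolding r_def .
  qed
qed

text \<open>T is approximated by operators of finite rank, one for each m with error 1 / (m + 1).
  Along a suitable subsequence all coefficients of these approximations converge, so the images form
  a Cauchy sequence.\<close>

lemma compact_of_trace_bound:
  assumes bound: "\<And>n (v :: nat \<Rightarrow> _). form.orthonormal v {..<n} \<Longrightarrow> (\<Sum>k<n. sq (T (v k))) \<le> K"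
    and complete: "\<And>F. (\<And>n. F n \<in> A) \<Longrightarrow>
      (\<And>\<epsilon>. \<epsilon> > 0 \<Longrightarrow> \<exists>N. \<forall>m\<ge>N. \<forall>n\<ge>N. sq (F m - F n) < \<epsilon>) \<Longrightarrow>
      \<exists>g\<in>A. (\<lambda>n. sq (F n - g)) \<longlonglongrightarrow> 0"
  shows T_compact
  unfolding T_compact_def
proof (intro allI impI)
  fix F :: "nat \<Rightarrow> 'a \<Rightarrow> quat" and B :: real
  assume F: "\<forall>n. F n \<in> A \<and> sq (F n) \<le> B"
  then have FA: "F n \<in> A" and FB: "sq (F n) \<le> B" for n by auto
  have "\<exists>n (v :: nat \<Rightarrow> _). form.orthonormal v {..<n} \<and>
      (\<forall>f\<in>A. sq (T (form.resid v {..<n} f)) \<le> 1 / real (Suc m) * tf f)" for m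
    using finite_rank_approximation[OF bound, of "1 / real (Suc m)"] by (metis of_nat_0_less_iff zero_less_Suc zero_less_divide_1_iff)
  then obtain n :: "nat \<Rightarrow> nat" and v :: "nat \<Rightarrow> nat \<Rightarrow> 'a \<Rightarrow> quat" where
    v: "\<And>m. form.orthonormal (v m) {..<n m}"
    and res: "\<And>m f. f \<in> A \<Longrightarrow> sq (T (form.resid (v m) {..<n m} f)) \<le> 1 / real (Suc m) * tf f"
    by metis
  define M where "M = sqrt \<bar>C\<bar> * B"
  have tfM: "tf (F j) \<le> M" for j
    using tf_le_sq[OF FA[of j]] mult_left_mono[OF FB[of j], of "sqrt \<bar>C\<bar>"] by (simp add: M_def)
  have M0: "M \<ge> 0" using tfM[of 0] form.sq_nonneg[OF FA[of 0]] by simp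
  have vA: "v m k \<in> A" if "k < n m" for m k using form.orthonormalD(1)[OF v] that by simp
  \<comment> \<open>The coefficients for all m are collected into one countable family, padded with
    zeros beyond \<open>n m\<close>, so that a single diagonal argument serves every
    accuracy.\<close>
  define c where "c = (\<lambda>j (m, k). if k < n m then ip (v m k) (T (F j)) else 0)"
  have cM: "norm (c j p) \<le> sqrt M" for j p
  proof (cases p)
    case (Pair m k)
    show ?thesis
    proof (cases "k < n m")
      case True
      have "(norm (ip (v m k) (T (F j))))\<^sup>2 \<le> tf (v m k) * tf (F j)"
        by (intro form.Cauchy_Schwarz vA True FA)
      also have "\<dots> \<le> M" using tfM form.sq_orthonormal[OF v, of k m] True by simp
      finally show ?thesis using Pair True by (simp add: c_def real_le_rsqrt)
    qed (use Pair M0 in \<open>simp add: c_def\<close>)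
  qed
  obtain r :: "nat \<Rightarrow> nat" where r: "strict_mono r"
    and conv: "\<And>p. \<exists>l. (\<lambda>j. c (r j) p) \<longlonglongrightarrow> l"
    using function_convergent_subsequence[of UNIV c, OF countableI_type cM] by (metis UNIV_I)
  obtain l where l: "\<And>p. (\<lambda>j. c (r j) p) \<longlonglongrightarrow> l p" using conv by metis
  define H where "H = (\<lambda>j. F (r j))"
  have H: "H j \<in> A" "tf (H j) \<le> M" for j using FA tfM by (auto simp: H_def)
  have "\<exists>N. \<forall>i\<ge>N. \<forall>j\<ge>N. sq (T (H i) - T (H j)) < \<epsilon>" if \<epsilon>: "\<epsilon> > 0" for \<epsilon>
  proof -
    \<comment> \<open>With |T h|^2 \<le> 2 |s|^2 + 2 |T R|^2, where s is the part of finite rank and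
      R the residual of h, the choice of m makes the second term less than \<epsilon> / 2, as
      \<open>tf h \<le> 4 * M\<close>. The first is less than \<epsilon> / 2 once g i and g j are
      below sqrt \<epsilon> / 4.\<close>
    obtain m where m: "16 * M / \<epsilon> < real m" using reals_Archimedean2 by blast
    then have m8: "8 * M / real (Suc m) < \<epsilon> / 2" using \<epsilon> by (simp add: field_simps)
    define g where "g = (\<lambda>j. \<Sum>k<n m. norm (c (r j) (m, k) - l (m, k)) * sqrt (sq (T (v m k))))"
    have "g \<longlonglongrightarrow> (\<Sum>k<n m. 0 * sqrt (sq (T (v m k))))"
      unfolding g_def using l by (intro tendsto_intros) (simp_all add: tendsto_norm_zero_iff LIM_zero_iff)
    then have "\<forall>\<^sub>F j in sequentially. g j < sqrt \<epsilon> / 4"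
      using \<epsilon> by (intro order_tendstoD(2)) auto
    then obtain N where N: "\<And>j. j \<ge> N \<Longrightarrow> g j < sqrt \<epsilon> / 4" by (auto simp: eventually_sequentially)
    have g0: "0 \<le> g j" for j
      unfolding g_def using vA by (intro sum_nonneg mult_nonneg_nonneg) auto
    show ?thesis
    proof (intro exI allI impI)
      fix i j assume ij: "N \<le> i" "N \<le> j"
      define h where "h = H i - H j"
      have h: "h \<in> A" using H by (simp add: h_def)
      define s where "s = (\<Sum>k<n m. T (v m k) \<cdot> ip (v m k) (T h))"
      let ?R = "form.resid (v m) {..<n m} h"
      have R: "?R \<in> A" by (rule form.resid_mem[OF _ v h]) simp
      have sA: "s \<in> A" unfolding s_def using vA by (intro sum_mem rscale_mem T_mem) auto
      define q where "q = (\<Sum>k<n m. v m k \<cdot> ip (v m k) (T h))"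
      have q: "q \<in> A" unfolding q_def using vA by (intro sum_mem rscale_mem) auto
      have "T q = (\<Sum>k<n m. T (v m k \<cdot> ip (v m k) (T h)))"
        unfolding q_def using vA by (intro T_sum rscale_mem) auto
      also have "\<dots> = s"
        unfolding s_def using vA by (intro sum.cong refl T_rscale) auto
      finally have Th: "T h = s + T ?R"
        unfolding form.resid_def q_def[symmetric] T_diff[OF h q] by simp
      have coef: "ip (v m k) (T h) = (c (r i) (m, k) - l (m, k)) - (c (r j) (m, k) - l (m, k))"
        if "k < n m" for k
        using that vA[OF that] FA by (simp add: h_def H_def c_def T_diff ip_diff_right)
      have "sqrt (sq s) \<le> (\<Sum>k<n m. sqrt (sq (T (v m k) \<cdot> ip (v m k) (T h))))"
        unfolding s_def using vA by (intro sqrt_sq_sum) auto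
      also have "\<dots> \<le> (\<Sum>k<n m. norm (c (r i) (m, k) - l (m, k)) * sqrt (sq (T (v m k)))
          + norm (c (r j) (m, k) - l (m, k)) * sqrt (sq (T (v m k))))"
      proof (intro sum_mono)
        fix k assume "k \<in> {..<n m}"
        then have k: "k < n m" by simp
        have "sqrt (sq (T (v m k) \<cdot> ip (v m k) (T h))) = norm (ip (v m k) (T h)) * sqrt (sq (T (v m k)))"
          using vA[OF k] by (simp add: sq_rscale real_sqrt_mult)
        also have "\<dots> \<le> (norm (c (r i) (m, k) - l (m, k)) + norm (c (r j) (m, k) - l (m, k))) * sqrt (sq (T (v m k)))"
          unfolding coef[OF k] using vA[OF k] by (intro mult_right_mono norm_triangle_ineq4) auto
        finally show "sqrt (sq (T (v m k) \<cdot> ip (v m k) (T h)))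
            \<le> norm (c (r i) (m, k) - l (m, k)) * sqrt (sq (T (v m k)))
              + norm (c (r j) (m, k) - l (m, k)) * sqrt (sq (T (v m k)))"
          by (simp add: distrib_right)
      qed
      also have "\<dots> = g i + g j" by (simp add: g_def sum.distrib)
      also have "\<dots> < sqrt \<epsilon> / 2" using N[OF ij(1)] N[OF ij(2)] by simp
      finally have "(sqrt (sq s))\<^sup>2 < (sqrt \<epsilon> / 2)\<^sup>2"
        using sA by (intro power_strict_mono) auto
      then have s4: "sq s < \<epsilon> / 4" using sA \<epsilon> by (simp add: power_divide)
      have "tf h \<le> 4 * M"
      proof -
        have "0 \<le> tf (H i + H j)" using H by (intro form.sq_nonneg) auto
        then have "tf h \<le> 2 * tf (H i) + 2 * tf (H j)"
          unfolding h_def form.sq_add[OF H(1) H(1)] form.sq_diff[OF H(1) H(1)] by simp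
        then show ?thesis using H(2)[of i] H(2)[of j] by simp
      qed
      then have "1 / real (Suc m) * tf h \<le> 1 / real (Suc m) * (4 * M)"
        by (intro mult_left_mono) auto
      with res[OF h, of m] have "sq (T ?R) \<le> 4 * M / real (Suc m)" by simp
      moreover have "sq (T h) \<le> 2 * sq s + 2 * sq (T ?R)"
        unfolding Th using sA R by (intro sq_add_le) auto
      ultimately have "sq (T h) < \<epsilon>" using s4 m8 by simp
      then show "sq (T (H i) - T (H j)) < \<epsilon>" using H by (simp add: h_def T_diff)
    qed
  qed
  then obtain g where "g \<in> A" "(\<lambda>j. sq (T (H j) - g)) \<longlonglongrightarrow> 0"
    using complete[of "\<lambda>j. T (H j)"] H by auto
  with r show "\<exists>r :: nat \<Rightarrow> nat. \<exists>g\<in>A. strict_mono r \<and> (\<lambda>n. sq (T (F (r n)) - g)) \<longlonglongrightarrow> 0"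
    unfolding H_def by blast
qed

end

section \<open>The slice Bergman space\<close>

definition moebius_weight :: "real \<Rightarrow> real" where
  "moebius_weight t = 1 / (pi * (1 - t)\<^sup>2)"

lemma borel_measurable_moebius_weight [measurable]: "moebius_weight \<in> borel_measurable borel"
  unfolding moebius_weight_def by measurable

context slice
begin

lemma slice_disc_eq: "slice_disc i = emb ` ball 0 1"
  by (auto simp: slice_disc_def slice_plane_def qball_def)

lemma measurable_emb: "emb \<in> measurable lborel (restrict_space borel (slice_plane i))"
proof (rule measurable_restrict_space2)
  show "emb \<in> borel_measurable lborel"
    by (simp add: borel_measurable_continuous_onI bounded_linear_emb linear_continuous_on)
qed (auto simp: slice_plane_def)

lemma sets_slice_lborel: "sets (slice_lborel i) = sets (restrict_space borel (slice_plane i))"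
  and space_slice_lborel: "space (slice_lborel i) = slice_plane i"
  by (simp_all add: slice_lborel_def space_restrict_space)

lemma slice_disc_sets: "slice_disc i \<in> sets (slice_lborel i)"
  unfolding sets_slice_lborel sets_restrict_space slice_disc_def qball_def by auto

lemma sets_slice_disc:
  "sets (restrict_space (slice_lborel i) (slice_disc i)) = sets (restrict_space borel (slice_disc i))"
proof -
  have "sets (restrict_space (slice_lborel i) (slice_disc i))
      = sets (restrict_space (restrict_space borel (slice_plane i)) (slice_disc i))"
    by (rule sets_restrict_space_cong[OF sets_slice_lborel])
  also have "\<dots> = sets (restrict_space borel (slice_disc i))"
    unfolding sets_restrict_restrict_space
    by (rule arg_cong[of _ _ "\<lambda>X. sets (restrict_space borel X)"]) (auto simp: slice_disc_def)
  finally show ?thesis .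
qed

lemma measurable_emb_disc:
  "emb \<in> measurable (disc_measure w) (restrict_space borel (slice_disc i))"
proof (rule measurable_restrict_space2)
  show "emb \<in> borel_measurable (disc_measure w)"
    by (intro measurable_disc_measure_continuous linear_continuous_on bounded_linear_emb)
qed (auto simp: slice_disc_eq)

text \<open>Both measures on the slice become images of measures on the complex disc, so that every
  integral over the slice can be pulled back along \<open>emb\<close>.\<close>

lemma density_slice_disc:
  assumes [measurable]: "w \<in> borel_measurable borel"
  shows "density (restrict_space (slice_lborel i) (slice_disc i)) (\<lambda>z. ennreal (w ((norm z)\<^sup>2)))
    = distr (disc_measure w) (restrict_space borel (slice_disc i)) emb"
proof (rule measure_eqI)
  let ?N = "restrict_space (slice_lborel i) (slice_disc i)"
  let ?f = "\<lambda>z::quat. ennreal (w ((norm z)\<^sup>2))"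
  show "sets (density ?N ?f) = sets (distr (disc_measure w) (restrict_space borel (slice_disc i)) emb)"
    by (simp add: sets_slice_disc)
  fix A assume "A \<in> sets (density ?N ?f)"
  then have A: "A \<in> sets ?N" by simp
  then have A': "A \<in> sets (restrict_space borel (slice_disc i))" by (simp add: sets_slice_disc)
  have AL: "A \<in> sets (slice_lborel i)" and Asub: "A \<subseteq> slice_disc i"
    using A slice_disc_sets by (auto simp: sets_restrict_space_iff sets_restrict_space)
  have fL: "?f \<in> borel_measurable (slice_lborel i)"
    unfolding measurable_cong_sets[OF sets_slice_lborel refl] by (rule measurable_restrict_space1) measurable
  have fN: "?f \<in> borel_measurable ?N" by (rule measurable_restrict_space1[OF fL])
  have g: "(\<lambda>z. ?f z * indicator A z * indicator (slice_disc i) z) \<in> borel_measurable (restrict_space borel (slice_plane i))"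
    unfolding measurable_cong_sets[OF sets_slice_lborel refl, symmetric]
    by (intro borel_measurable_times_ennreal borel_measurable_indicator fL AL slice_disc_sets)
  have "emeasure (density ?N ?f) A = (\<integral>\<^sup>+z. ?f z * indicator A z \<partial>?N)"
    by (rule emeasure_density[OF fN A])
  also have "\<dots> = (\<integral>\<^sup>+z. ?f z * indicator A z * indicator (slice_disc i) z \<partial>slice_lborel i)"
    using slice_disc_sets by (subst nn_integral_restrict_space) (auto simp: sets.Int_space_eq2)
  also have "\<dots> = (\<integral>\<^sup>+z. ?f (emb z) * indicator A (emb z) * indicator (slice_disc i) (emb z) \<partial>lborel)"
    unfolding slice_lborel_def by (rule nn_integral_distr[OF measurable_emb]) (use g in simp)
  also have "\<dots> = (\<integral>\<^sup>+z. ennreal (w ((norm z)\<^sup>2)) * indicator (emb -` A \<inter> ball 0 1) z * indicator (ball 0 1) z \<partial>lborel)"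
    by (intro nn_integral_cong) (auto simp: slice_disc_eq indicator_def)
  also have "\<dots> = (\<integral>\<^sup>+z. indicator (emb -` A \<inter> ball 0 1) z \<partial>disc_measure w)"
  proof (rule nn_integral_disc_measure[symmetric])
    show "indicator (emb -` A \<inter> ball 0 1) \<in> borel_measurable (disc_measure w)"
      using measurable_sets[OF measurable_emb_disc A', of w] by (intro borel_measurable_indicator) simp
  qed measurable
  also have "\<dots> = emeasure (disc_measure w) (emb -` A \<inter> ball 0 1)"
    using measurable_sets[OF measurable_emb_disc A', of w] by simp
  also have "\<dots> = emeasure (distr (disc_measure w) (restrict_space borel (slice_disc i)) emb) A"
    by (subst emeasure_distr[OF measurable_emb_disc A']) simp
  finally show "emeasure (density ?N ?f) A
      = emeasure (distr (disc_measure w) (restrict_space borel (slice_disc i)) emb) A" .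
qed

lemma bergman_measure_eq:
  "bergman_measure \<alpha> i = distr (disc_measure (bergman_weight \<alpha>)) (restrict_space borel (slice_disc i)) emb"
  unfolding bergman_measure_def by (subst density_slice_disc[symmetric]) (simp_all add: bergman_weight_def)

lemma moebius_measure_eq:
  "moebius_measure i = distr (disc_measure moebius_weight) (restrict_space borel (slice_disc i)) emb"
  unfolding moebius_measure_def by (subst density_slice_disc[symmetric]) (simp_all add: moebius_weight_def)

lemma slice_hol_continuous:
  assumes "f \<in> slice_hol_space"
  shows "continuous_on (slice_disc i) f" "continuous_on (ball 0 1) (\<lambda>z. f (emb z))"
proof -
  have "f differentiable_on qball" using assms by (simp add: slice_hol_space_def slice_hyperholomorphic_def)
  then have c: "continuous_on qball f" by (rule differentiable_imp_continuous_on)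
  then show "continuous_on (slice_disc i) f" by (rule continuous_on_subset) (simp add: slice_disc_def)
  show "continuous_on (ball 0 1) (\<lambda>z. f (emb z))"
    by (rule continuous_on_compose2[OF c linear_continuous_on[OF bounded_linear_emb]]) auto
qed

lemma slice_hol_measurable:
  assumes "f \<in> slice_hol_space"
  shows "f \<in> borel_measurable (restrict_space borel (slice_disc i))"
    "(\<lambda>z. f (emb z)) \<in> borel_measurable (disc_measure w)"
  using slice_hol_continuous[OF assms]
  by (auto intro: borel_measurable_continuous_on_restrict measurable_disc_measure_continuous)

lemma coord2_holomorphic:
  assumes "f \<in> slice_hol_space" "slice_split i j"
  shows "(\<lambda>z. slice_split.coord2 i j (f (emb z))) holomorphic_on ball 0 1"
  using slice_hol_coord_holomorphic[OF assms(1), of "- j"]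
  by (simp add: slice_split.coord2_def[OF assms(2)])

lemma coord_holomorphic:
  "f \<in> slice_hol_space \<Longrightarrow> (\<lambda>z. coord (f (emb z))) holomorphic_on ball 0 1"
  using slice_hol_coord_holomorphic[of f 1] by simp

end

locale bergman_space = slice +
  fixes \<alpha> :: real
  assumes \<alpha>: "\<alpha> > -1"
begin

abbreviation "M \<equiv> disc_measure (bergman_weight \<alpha>)"

lemma finite_M: "finite_measure M"
  by (rule finite_measure_disc_bergman[OF \<alpha>])

lemma bergman_iff:
  "f \<in> bergman \<alpha> i \<longleftrightarrow> f \<in> slice_hol_space \<and> integrable M (\<lambda>z. (norm (f (emb z)))\<^sup>2)"
proof -
  have "integrable (bergman_measure \<alpha> i) (\<lambda>z. (norm (f z))\<^sup>2) \<longleftrightarrow> integrable M (\<lambda>z. (norm (f (emb z)))\<^sup>2)"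
    if "f \<in> slice_hol_space"
    unfolding bergman_measure_eq
    by (rule integrable_distr_eq[OF measurable_emb_disc])
      (use slice_hol_measurable(1)[OF that] in measurable)
  then show ?thesis by (auto simp: bergman_def)
qed

lemma bip_eq:
  assumes "f \<in> slice_hol_space" "g \<in> slice_hol_space"
  shows "bip \<alpha> i f g = (LINT z|M. qcnj (f (emb z)) * g (emb z))"
proof -
  have "(\<lambda>z. qcnj (f z)) \<in> borel_measurable (restrict_space borel (slice_disc i))"
    by (rule borel_measurable_continuous_on[OF linear_continuous_on[OF bounded_linear_qcnj]
          slice_hol_measurable(1)[OF assms(1)]])
  from borel_measurable_times[OF this slice_hol_measurable(1)[OF assms(2)]] show ?thesis
    unfolding bip_def bergman_measure_eq by (rule integral_distr[OF measurable_emb_disc])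
qed

lemma integrable_bip:
  assumes "f \<in> bergman \<alpha> i" "g \<in> bergman \<alpha> i"
  shows "integrable M (\<lambda>z. qcnj (f (emb z)) * g (emb z))"
proof (rule Bochner_Integration.integrable_bound)
  have f: "f \<in> slice_hol_space" and g: "g \<in> slice_hol_space" using assms by (auto simp: bergman_iff)
  show "integrable M (\<lambda>z. (norm (f (emb z)))\<^sup>2 + (norm (g (emb z)))\<^sup>2)"
    using assms by (auto simp: bergman_iff)
  show "(\<lambda>z. qcnj (f (emb z)) * g (emb z)) \<in> borel_measurable M"
    by (intro borel_measurable_times slice_hol_measurable(2)[OF g]
        borel_measurable_continuous_on[OF linear_continuous_on[OF bounded_linear_qcnj]
          slice_hol_measurable(2)[OF f]])
  have "x * y \<le> x\<^sup>2 + y\<^sup>2" for x y :: real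
    using sum_squares_bound[of x y] zero_le_power2[of x] zero_le_power2[of y] by linarith
  then show "AE z in M. norm (qcnj (f (emb z)) * g (emb z))
      \<le> norm ((norm (f (emb z)))\<^sup>2 + (norm (g (emb z)))\<^sup>2)"
    by (simp add: norm_mult)
qed

lemma bergman_square_bounded:
  assumes h: "h \<in> slice_hol_space" and int: "integrable M g"
    and le: "\<And>z. z \<in> ball 0 1 \<Longrightarrow> (norm (h (emb z)))\<^sup>2 \<le> g z"
  shows "h \<in> bergman \<alpha> i"
  unfolding bergman_iff
proof (intro conjI h Bochner_Integration.integrable_bound[OF int])
  show "(\<lambda>z. (norm (h (emb z)))\<^sup>2) \<in> borel_measurable M"
    using slice_hol_measurable(2)[OF h] by measurable
  show "AE z in M. norm ((norm (h (emb z)))\<^sup>2) \<le> norm (g z)"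
    by (rule AE_I2) (use le in \<open>force intro: order_trans[OF le abs_ge_self]\<close>)
qed

lemma bergman_coord_integrable:
  assumes f: "f \<in> bergman \<alpha> i" and j: "slice_split i j"
  shows "integrable M (\<lambda>z. (norm (coord (f (emb z))))\<^sup>2)"
    "integrable M (\<lambda>z. (norm (slice_split.coord2 i j (f (emb z))))\<^sup>2)"
proof -
  interpret slice_split i j by fact
  have f': "f \<in> slice_hol_space" "integrable M (\<lambda>z. (norm (f (emb z)))\<^sup>2)" using f by (auto simp: bergman_iff)
  have m: "(\<lambda>z. coord (f (emb z))) \<in> borel_measurable M" "(\<lambda>z. coord2 (f (emb z))) \<in> borel_measurable M"
    by (intro measurable_disc_measure_continuous holomorphic_on_imp_continuous_on
        coord_holomorphic[OF f'(1)] coord2_holomorphic[OF f'(1) j])+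
  show "integrable M (\<lambda>z. (norm (coord (f (emb z))))\<^sup>2)"
    by (rule Bochner_Integration.integrable_bound[OF f'(2)])
      (use m(1) norm_split in \<open>auto intro!: AE_I2 simp: norm_split\<close>)
  show "integrable M (\<lambda>z. (norm (coord2 (f (emb z))))\<^sup>2)"
    by (rule Bochner_Integration.integrable_bound[OF f'(2)])
      (use m(2) norm_split in \<open>auto intro!: AE_I2 simp: norm_split\<close>)
qed

text \<open>Splitting \<open>f = F\<^sub>1 + F\<^sub>2 j\<close> with holomorphic \<open>F\<^sub>1, F\<^sub>2\<close> reduces the reproducing property to the
  classical Bergman space.\<close>

lemma kernel_exists:
  assumes w: "w \<in> ball 0 1"
  obtains K where "K \<in> bergman \<alpha> i" "\<And>z. z \<in> ball 0 1 \<Longrightarrow> K (emb z) = emb (disc_kernel \<alpha> w z)"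
    "\<And>f. f \<in> bergman \<alpha> i \<Longrightarrow> bip \<alpha> i K f = f (emb w)"
proof -
  have w1: "norm w < 1" using w by simp
  obtain K where K: "K \<in> slice_hol_space" "\<And>z. z \<in> ball 0 1 \<Longrightarrow> K (emb z) = emb (disc_kernel \<alpha> w z)"
    using slice_extension[OF holomorphic_disc_kernel[OF \<alpha> w1]] by blast
  have KA: "K \<in> bergman \<alpha> i"
  proof (rule bergman_square_bounded[OF K(1)])
    show "integrable M (\<lambda>_. ((1 - norm w) powr (- (\<alpha> + 2)))\<^sup>2)"
      using finite_M by (simp add: finite_measure.integrable_const)
    fix z :: complex assume z: "z \<in> ball 0 1"
    then show "(norm (K (emb z)))\<^sup>2 \<le> ((1 - norm w) powr (- (\<alpha> + 2)))\<^sup>2"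
      using summable_disc_kernel(3)[OF \<alpha> w1, of z] by (simp add: K power_mono)
  qed
  have "bip \<alpha> i K f = f (emb w)" if f: "f \<in> bergman \<alpha> i" for f
  proof -
    obtain j where j: "slice_split i j" by (rule split_exists)
    interpret slice_split i j by fact
    have f': "f \<in> slice_hol_space" using f by (simp add: bergman_iff)
    let ?k = "\<lambda>z. cnj (disc_kernel \<alpha> w z)"
    let ?F = "\<lambda>z. coord (f (emb z))" and ?G = "\<lambda>z. coord2 (f (emb z))"
    have hol: "?F holomorphic_on ball 0 1" "?G holomorphic_on ball 0 1"
      using coord_holomorphic[OF f'] coord2_holomorphic[OF f' j] .
    have int: "integrable M (\<lambda>z. ?k z * F z)"
      if F: "F holomorphic_on ball 0 1" "integrable M (\<lambda>z. (norm (F z))\<^sup>2)" for F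
    proof -
      interpret finite_measure M by (rule finite_M)
      have mF: "F \<in> borel_measurable M"
        by (intro measurable_disc_measure_continuous holomorphic_on_imp_continuous_on F)
      have iF: "integrable M F"
        using square_integrable_imp_integrable[of "\<lambda>z. norm (F z)"] mF F(2) by (simp add: integrable_norm_iff)
      show ?thesis
      proof (rule Bochner_Integration.integrable_bound)
        show "integrable M (\<lambda>z. (1 - norm w) powr (- (\<alpha> + 2)) * norm (F z))" using iF by simp
        have "continuous_on (ball 0 1) ?k"
          by (intro continuous_intros holomorphic_on_imp_continuous_on holomorphic_disc_kernel \<alpha> w1)
        then show "(\<lambda>z. ?k z * F z) \<in> borel_measurable M"
          by (intro borel_measurable_times mF measurable_disc_measure_continuous)
        show "AE z in M. norm (?k z * F z) \<le> norm ((1 - norm w) powr (- (\<alpha> + 2)) * norm (F z))"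
          using summable_disc_kernel(3)[OF \<alpha> w1]
          by (intro AE_I2) (auto simp: norm_mult intro!: mult_right_mono)
      qed
    qed
    note iF = int[OF hol(1) bergman_coord_integrable(1)[OF f j]]
    note iG = int[OF hol(2) bergman_coord_integrable(2)[OF f j]]
    \<comment> \<open>On the slice the kernel takes values in the slice plane and multiplies from
      the left; j stays on the right and leaves the integral.\<close>
    have "bip \<alpha> i K f = (LINT z|M. emb (?k z * ?F z) + emb (?k z * ?G z) * j)"
      unfolding bip_eq[OF K(1) f']
    proof (intro Bochner_Integration.integral_cong refl)
      fix z assume "z \<in> space M"
      then have "qcnj (K (emb z)) = emb (?k z)" by (simp add: K(2) qcnj_emb)
      then show "qcnj (K (emb z)) * f (emb z) = emb (?k z * ?F z) + emb (?k z * ?G z) * j"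
        by (subst quat_split[of "f (emb z)"]) (simp add: emb_mult algebra_simps)
    qed
    also have "\<dots> = emb (LINT z|M. ?k z * ?F z) + emb (LINT z|M. ?k z * ?G z) * j"
      using integral_bounded_linear[OF bounded_linear_emb iF] integral_bounded_linear[OF bounded_linear_emb iG]
        integrable_bounded_linear[OF bounded_linear_emb iF] integrable_bounded_linear[OF bounded_linear_emb iG]
      by (simp add: integral_mult_left)
    also have "\<dots> = emb (?F w) + emb (?G w) * j"
      using disc_kernel_reproducing[OF \<alpha> w1 hol(1) bergman_coord_integrable(1)[OF f j]]
        disc_kernel_reproducing[OF \<alpha> w1 hol(2) bergman_coord_integrable(2)[OF f j]] by simp
    also have "\<dots> = f (emb w)" by (rule quat_split[symmetric])
    finally show ?thesis .
  qed
  then show ?thesis using that KA K(2) by blast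
qed

lemma qRe_bip_self:
  assumes "f \<in> bergman \<alpha> i"
  shows "qRe (bip \<alpha> i f f) = (LINT z|M. (norm (f (emb z)))\<^sup>2)"
proof -
  have "qRe (bip \<alpha> i f f) = (LINT z|M. qRe (qcnj (f (emb z)) * f (emb z)))"
    using assms integral_bounded_linear[OF bounded_linear_qRe integrable_bip[OF assms assms]]
    by (simp add: bip_eq bergman_iff)
  then show ?thesis by (simp add: qcnj_mult_self del: of_real_power)
qed

sublocale quat_semi_inner "bergman \<alpha> i" "bip \<alpha> i"
proof unfold_locales
  obtain h where h: "h \<in> slice_hol_space" using slice_extension[of "\<lambda>_. 0"] by auto
  have "(\<lambda>x. h x * 0) \<in> slice_hol_space" by (rule slice_hol_space_mult_right[OF h])
  then show "0 \<in> bergman \<alpha> i" by (simp add: bergman_iff zero_fun_def)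
next
  fix f g assume f: "f \<in> bergman \<alpha> i" and g: "g \<in> bergman \<alpha> i"
  show "f + g \<in> bergman \<alpha> i"
  proof (rule bergman_square_bounded)
    show "f + g \<in> slice_hol_space"
      using slice_hol_space_add[of f g] f g by (simp add: bergman_iff plus_fun_def)
    show "integrable M (\<lambda>z. 2 * (norm (f (emb z)))\<^sup>2 + 2 * (norm (g (emb z)))\<^sup>2)"
      using f g by (auto simp: bergman_iff)
    fix z
    have "(norm (f (emb z) + g (emb z)))\<^sup>2 \<le> (norm (f (emb z)) + norm (g (emb z)))\<^sup>2"
      by (intro power_mono norm_triangle_ineq) auto
    also have "\<dots> \<le> 2 * (norm (f (emb z)))\<^sup>2 + 2 * (norm (g (emb z)))\<^sup>2"
      using sum_squares_bound[of "norm (f (emb z))" "norm (g (emb z))"] by (simp add: power2_sum)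
    finally show "(norm ((f + g) (emb z)))\<^sup>2 \<le> 2 * (norm (f (emb z)))\<^sup>2 + 2 * (norm (g (emb z)))\<^sup>2"
      by simp
  qed
  show "f \<cdot> a \<in> bergman \<alpha> i" for a
  proof (rule bergman_square_bounded)
    show "f \<cdot> a \<in> slice_hol_space"
      using slice_hol_space_mult_right[of f a] f by (simp add: bergman_iff rscale_def)
    show "integrable M (\<lambda>z. (norm (f (emb z)))\<^sup>2 * (norm a)\<^sup>2)"
      using f by (auto simp: bergman_iff)
  qed (simp add: norm_mult power_mult_distrib)
next
  fix f g h assume f: "f \<in> bergman \<alpha> i" and g: "g \<in> bergman \<alpha> i" and h: "h \<in> bergman \<alpha> i"
  have "g + h \<in> slice_hol_space"
    using slice_hol_space_add[of g h] g h by (simp add: bergman_iff plus_fun_def)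
  then show "bip \<alpha> i f (g + h) = bip \<alpha> i f g + bip \<alpha> i f h"
    using f g h integrable_bip[OF f g] integrable_bip[OF f h]
    by (simp add: bip_eq bergman_iff distrib_left)
next
  fix f g a assume f: "f \<in> bergman \<alpha> i" and g: "g \<in> bergman \<alpha> i"
  have "g \<cdot> a \<in> slice_hol_space"
    using slice_hol_space_mult_right[of g a] g by (simp add: bergman_iff rscale_def)
  then show "bip \<alpha> i f (g \<cdot> a) = bip \<alpha> i f g * a"
    using f g integrable_bip[OF f g]
    by (simp add: bip_eq bergman_iff mult.assoc[symmetric] integral_mult_left)
  show "qcnj (bip \<alpha> i f g) = bip \<alpha> i g f"
    using f g integral_bounded_linear[OF bounded_linear_qcnj integrable_bip[OF f g]]
    by (simp add: bip_eq bergman_iff)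
next
  fix f assume f: "f \<in> bergman \<alpha> i"
  show "0 \<le> qRe (bip \<alpha> i f f)" by (simp add: qRe_bip_self[OF f])
qed

lemma sq_eq: "f \<in> bergman \<alpha> i \<Longrightarrow> sq f = (LINT z|M. (norm (f (emb z)))\<^sup>2)"
  by (simp add: sq_def qRe_bip_self)

lemma bergman_zero_eqI:
  assumes f: "f \<in> bergman \<alpha> i" and "\<And>z. z \<in> ball 0 1 \<Longrightarrow> f (emb z) = 0"
  shows "f = 0"
  by (rule slice_hol_eqI) (use assms zero_mem in \<open>auto simp: bergman_iff\<close>)

text \<open>Definiteness comes from the kernel: if |f| = 0, Cauchy-Schwarz gives <K_w, f> = 0, that
  is f(w) = 0 at each point of the slice, with no passage from almost everywhere to
  everywhere.\<close>

sublocale quat_inner_space "bergman \<alpha> i" "bip \<alpha> i"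
proof unfold_locales
  fix f assume f: "f \<in> bergman \<alpha> i" and 0: "sq f = 0"
  have "f (emb w) = 0" if w: "w \<in> ball 0 1" for w
  proof -
    obtain K where K: "K \<in> bergman \<alpha> i" "bip \<alpha> i K f = f (emb w)"
      using kernel_exists[OF w] f by metis
    from Cauchy_Schwarz[OF K(1) f] show ?thesis by (simp add: K(2) 0)
  qed
  then show "f = 0" by (rule bergman_zero_eqI[OF f])
qed

text \<open>Any two reproducing elements have the same inner products with the whole space, so the
  description picks the function built from the disc kernel.\<close>

lemma kernel_props:
  assumes w: "w \<in> ball 0 1"
  shows kernel_mem: "kernel \<alpha> i (emb w) \<in> bergman \<alpha> i"
    and kernel_reproducing: "f \<in> bergman \<alpha> i \<Longrightarrow> bip \<alpha> i (kernel \<alpha> i (emb w)) f = f (emb w)"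
    and kernel_emb: "z \<in> ball 0 1 \<Longrightarrow> kernel \<alpha> i (emb w) (emb z) = emb (disc_kernel \<alpha> w z)"
proof -
  obtain K where K: "K \<in> bergman \<alpha> i" "\<And>z. z \<in> ball 0 1 \<Longrightarrow> K (emb z) = emb (disc_kernel \<alpha> w z)"
    "\<And>f. f \<in> bergman \<alpha> i \<Longrightarrow> bip \<alpha> i K f = f (emb w)"
    using kernel_exists[OF w] by blast
  have "kernel \<alpha> i (emb w) = K"
    unfolding kernel_def
  proof (rule the_equality)
    show "K \<in> bergman \<alpha> i \<and> (\<forall>f\<in>bergman \<alpha> i. f (emb w) = bip \<alpha> i K f)" using K by simp
    fix L assume L: "L \<in> bergman \<alpha> i \<and> (\<forall>f\<in>bergman \<alpha> i. f (emb w) = bip \<alpha> i L f)"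
    show "L = K"
    proof (rule eqI_ip)
      fix h assume h: "h \<in> bergman \<alpha> i"
      have "bip \<alpha> i L h = bip \<alpha> i K h" using L K(3) h by metis
      then show "bip \<alpha> i h L = bip \<alpha> i h K" using L K(1) h qcnj_ip by metis
    qed (use L K in auto)
  qed
  with K show "kernel \<alpha> i (emb w) \<in> bergman \<alpha> i"
    "f \<in> bergman \<alpha> i \<Longrightarrow> bip \<alpha> i (kernel \<alpha> i (emb w)) f = f (emb w)"
    "z \<in> ball 0 1 \<Longrightarrow> kernel \<alpha> i (emb w) (emb z) = emb (disc_kernel \<alpha> w z)"
    by auto
qed

lemma sq_kernel:
  assumes w: "w \<in> ball 0 1"
  shows "sq (kernel \<alpha> i (emb w)) = (1 - (norm w)\<^sup>2) powr (- (\<alpha> + 2))"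
proof -
  have "bip \<alpha> i (kernel \<alpha> i (emb w)) (kernel \<alpha> i (emb w)) = emb (disc_kernel \<alpha> w w)"
    using w by (simp add: kernel_reproducing kernel_mem kernel_emb)
  then show ?thesis using w by (simp add: sq_def disc_kernel_diag)
qed

lemma norm_eval_le:
  assumes w: "w \<in> ball 0 1" and f: "f \<in> bergman \<alpha> i"
  shows "(norm (f (emb w)))\<^sup>2 \<le> (1 - (norm w)\<^sup>2) powr (- (\<alpha> + 2)) * sq f"
  using Cauchy_Schwarz[OF kernel_mem[OF w] f] by (simp add: kernel_reproducing[OF w f] sq_kernel[OF w])

lemma bnorm_eq: "bnorm \<alpha> i f = sqrt (sq f)"
  by (simp add: bnorm_def sq_def)

lemma normalized_kernel_eq:
  "normalized_kernel \<alpha> i z = kernel \<alpha> i z \<cdot> of_real (1 / sqrt (sq (kernel \<alpha> i z)))"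
  by (simp add: normalized_kernel_def bnorm_eq rscale_def divide_inverse of_real_inverse)

text \<open>The extended monomials, normalised by the roots of the kernel coefficients, show that
  the space has infinite dimension; the spectral theorem needs this to produce an infinite
  sequence.\<close>

lemma monomials_orthonormal:
  obtains u :: "nat \<Rightarrow> quat \<Rightarrow> quat" where "orthonormal u UNIV"
proof -
  define c where "c = (\<lambda>n. sqrt (kernel_coeff \<alpha> n))"
  have "\<exists>f. f \<in> slice_hol_space \<and> (\<forall>z\<in>ball 0 1. f (emb z) = emb (of_real (c n) * z ^ n))" for n
  proof -
    have "(\<lambda>z. of_real (c n) * z ^ n) holomorphic_on ball 0 1" by (intro holomorphic_intros)
    then obtain f where "f \<in> slice_hol_space"
      "\<And>z. z \<in> ball 0 1 \<Longrightarrow> f (emb z) = emb (of_real (c n) * z ^ n)"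
      using slice_extension by blast
    then show ?thesis by blast
  qed
  then obtain u where u: "\<And>n. u n \<in> slice_hol_space"
    "\<And>n z. z \<in> ball 0 1 \<Longrightarrow> u n (emb z) = emb (of_real (c n) * z ^ n)" by metis
  interpret finite_measure M by (rule finite_M)
  have uA: "u n \<in> bergman \<alpha> i" for n
  proof (rule bergman_square_bounded[OF u(1)])
    show "integrable M (\<lambda>_. (c n)\<^sup>2)" by simp
    fix z :: complex assume z: "z \<in> ball 0 1"
    then have "(norm z ^ n)\<^sup>2 \<le> 1" by (simp add: power_le_one)
    then show "(norm (u n (emb z)))\<^sup>2 \<le> (c n)\<^sup>2"
      using z by (simp add: u norm_mult norm_power power_mult_distrib mult_left_le)
  qed
  have "bip \<alpha> i (u m) (u n) = (if m = n then 1 else 0)" for m n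
  proof -
    have int: "integrable M (\<lambda>z. cnj z ^ m * z ^ n)"
    proof (rule integrable_const_bound[of _ 1])
      show "AE z in M. norm (cnj z ^ m * z ^ n) \<le> 1"
        by (rule AE_I2) (auto simp: norm_mult norm_power intro!: mult_le_one power_le_one)
      show "(\<lambda>z. cnj z ^ m * z ^ n) \<in> borel_measurable M"
        by (rule measurable_disc_measure_borel) measurable
    qed
    have "bip \<alpha> i (u m) (u n) = (LINT z|M. emb (of_real (c m * c n) * (cnj z ^ m * z ^ n)))"
      unfolding bip_eq[OF u(1) u(1)]
      by (intro Bochner_Integration.integral_cong refl)
        (simp add: u(2) qcnj_emb emb_mult[symmetric] mult_ac del: emb_simps)
    also have "\<dots> = emb (LINT z|M. of_real (c m * c n) * (cnj z ^ m * z ^ n))"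
      by (rule integral_bounded_linear[OF bounded_linear_emb]) (use int in simp)
    also have "(LINT z|M. of_real (c m * c n) * (cnj z ^ m * z ^ n)) = of_real (c m * c n) * (LINT z|M. cnj z ^ m * z ^ n)"
      by (rule integral_mult_right_zero)
    also have "\<dots> = (if m = n then 1 else 0)"
    proof (cases "m = n")
      case True
      have "(LINT z|M. cnj z ^ n * z ^ n) = (LINT z|M. of_real (norm z ^ (2 * n)))"
        by (intro Bochner_Integration.integral_cong refl)
          (metis complex_norm_square mult.commute of_real_power power_mult power_mult_distrib)
      also have "\<dots> = of_real (1 / kernel_coeff \<alpha> n)"
        unfolding integral_complex_of_real integral_disc_norm_power[OF \<alpha>] ..
      finally show ?thesis
        using True kernel_coeff_pos[OF \<alpha>, of n] by (simp add: c_def flip: of_real_mult)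
    next
      case False
      have "(LINT z|M. cnj z ^ m * z ^ n) = (LINT z|M. indicator (ball 0 1) z * (cnj z ^ m * z ^ n))"
        by (intro Bochner_Integration.integral_cong refl) simp
      then show ?thesis using False by (simp add: integral_disc_measure_monomials)
    qed
    finally show ?thesis by simp
  qed
  with uA have "orthonormal u UNIV" by (simp add: orthonormal_def)
  then show ?thesis by (rule that)
qed

end

section \<open>Jensen's inequality and completeness\<close>

text \<open>Young's inequality with weights p and 1 - p for the numbers x and 1.\<close>

lemma powr_tangent_le:
  fixes x p :: real
  assumes "0 \<le> x" "0 < p" "p \<le> 1"
  shows "x powr p \<le> 1 + p * (x - 1)"
proof (cases "x = 0")
  case False
  then show ?thesis
    using Youngs_inequality_0[of p "1 - p" x 1] assms by (simp add: algebra_simps)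
qed (use assms in simp)

text \<open>The concave case with exponent 1 / p, applied to \<open>x powr p\<close>.\<close>

lemma powr_tangent_ge:
  fixes x p :: real
  assumes "0 \<le> x" "1 \<le> p"
  shows "1 + p * (x - 1) \<le> x powr p"
proof -
  have "(x powr p) powr (1 / p) \<le> 1 + 1 / p * (x powr p - 1)"
    using assms by (intro powr_tangent_le) auto
  moreover have "(x powr p) powr (1 / p) = x" using assms by (simp add: powr_powr)
  ultimately have "p * x \<le> p * (1 + 1 / p * (x powr p - 1))"
    using assms by (intro mult_left_mono) auto
  then show ?thesis using assms by (simp add: algebra_simps)
qed

text \<open>Jensen's inequality for subprobability weights, from the tangent of \<open>x \<mapsto> x powr p\<close> at the mean.\<close>

context
  fixes w x :: "nat \<Rightarrow> real" and m p :: real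
  assumes w0: "\<And>n. 0 \<le> w n" and w1: "\<And>N. (\<Sum>n<N. w n) \<le> 1"
    and x0: "\<And>n. 0 \<le> x n" and xB: "\<And>n. x n \<le> x 0"
    and m: "(\<lambda>n. x n * w n) sums m"
begin

lemma weights_sums: "summable w" "0 \<le> suminf w" "suminf w \<le> 1"
  using summableI_nonneg_bounded[OF w0 w1] suminf_nonneg[OF _ w0] suminf_le_const[OF _ w1] by auto

lemma mean_nonneg: "0 \<le> m"
  using sums_le[OF _ sums_zero m] x0 w0 by simp

lemma mean_zero: "m = 0 \<Longrightarrow> x n powr p * w n = 0"
  using sums_unique[OF m] suminf_eq_zero_iff[OF sums_summable[OF m]] x0 w0 by auto

lemma powr_mean_summable: "0 < p \<Longrightarrow> summable (\<lambda>n. x n powr p * w n)"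
proof (rule summable_comparison_test'[OF summable_mult[OF weights_sums(1), of "x 0 powr p"], of 0])
  fix n assume "0 < p"
  then have "x n powr p \<le> x 0 powr p" using x0 xB by (intro powr_mono2) auto
  then show "norm (x n powr p * w n) \<le> x 0 powr p * w n" using w0[of n] by (simp add: mult_right_mono)
qed

text \<open>A total mass W below 1 leaves the factor W + p (1 - W). It is at least 1 for p \<ge> 1
  and at most 1 for p \<le> 1, so the missing mass works in the right direction in both
  cases.\<close>

lemma tangent_sums:
  assumes "m > 0"
  shows "(\<lambda>n. m powr p * (1 + p * (x n / m - 1)) * w n) sums (m powr p * (suminf w + p * (1 - suminf w)))"
proof -
  have "(\<lambda>n. m powr p * ((1 - p) * w n + p / m * (x n * w n))) sums (m powr p * ((1 - p) * suminf w + p / m * m))"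
    by (intro sums_mult sums_add m summable_sums weights_sums)
  then show ?thesis using assms by (simp add: algebra_simps)
qed

lemma Jensen_powr_ge:
  assumes "1 \<le> p" shows "m powr p \<le> (\<Sum>n. x n powr p * w n)"
proof (cases "m = 0")
  case True
  then show ?thesis using assms by (auto intro!: suminf_nonneg powr_mean_summable simp: w0)
next
  case False
  then have mpos: "m > 0" using mean_nonneg by simp
  have "1 \<le> suminf w + p * (1 - suminf w)"
    using mult_right_mono[of 1 p "1 - suminf w"] weights_sums assms by simp
  then have "m powr p \<le> m powr p * (suminf w + p * (1 - suminf w))"
    using mult_left_mono[of 1 _ "m powr p"] by simp
  also have "\<dots> \<le> (\<Sum>n. x n powr p * w n)"
  proof (rule sums_le[OF _ tangent_sums[OF mpos] summable_sums[OF powr_mean_summable]])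
    fix n
    have "m powr p * (1 + p * (x n / m - 1)) \<le> m powr p * (x n / m) powr p"
      using mpos x0 assms by (intro mult_left_mono powr_tangent_ge) auto
    also have "\<dots> = x n powr p" using mpos x0[of n] by (simp add: powr_divide)
    finally show "m powr p * (1 + p * (x n / m - 1)) * w n \<le> x n powr p * w n"
      using w0 by (rule mult_right_mono)
  qed (use assms in simp)
  finally show ?thesis .
qed

lemma Jensen_powr_le:
  assumes "0 < p" "p \<le> 1" shows "(\<Sum>n<N. x n powr p * w n) \<le> m powr p"
proof (cases "m = 0")
  case True
  have "(\<Sum>n<N. x n powr p * w n) = 0" by (intro sum.neutral ballI mean_zero True)
  then show ?thesis by simp
next
  case False
  then have mpos: "m > 0" using mean_nonneg by simp
  have "(\<Sum>n<N. x n powr p * w n) \<le> (\<Sum>n. x n powr p * w n)"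
    by (rule sum_le_suminf[OF powr_mean_summable[OF assms(1)]]) (auto simp: w0)
  also have "\<dots> \<le> m powr p * (suminf w + p * (1 - suminf w))"
  proof (rule sums_le[OF _ summable_sums[OF powr_mean_summable[OF assms(1)]] tangent_sums[OF mpos]])
    fix n
    have "x n powr p = m powr p * (x n / m) powr p" using mpos x0[of n] by (simp add: powr_divide)
    also have "\<dots> \<le> m powr p * (1 + p * (x n / m - 1))"
      using mpos x0 assms by (intro mult_left_mono powr_tangent_le) auto
    finally show "x n powr p * w n \<le> m powr p * (1 + p * (x n / m - 1)) * w n"
      using w0 by (rule mult_right_mono)
  qed
  also have "\<dots> \<le> m powr p"
    using mult_right_mono[of p 1 "1 - suminf w"] weights_sums assms
      mult_left_mono[of "suminf w + p * (1 - suminf w)" 1 "m powr p"] by simp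
  finally show ?thesis .
qed

end

section \<open>Completeness of the Bergman space\<close>

context bergman_space
begin

lemma nn_integral_square:
  assumes "f \<in> bergman \<alpha> i"
  shows "(\<integral>\<^sup>+z. ennreal ((norm (f (emb z)))\<^sup>2) \<partial>M) = ennreal (sq f)"
  using assms by (subst nn_integral_eq_integral) (auto simp: bergman_iff sq_eq)

text \<open>The evaluation bound makes a Cauchy sequence uniformly Cauchy on smaller discs of the
  slice. The two complex components of the limit are holomorphic there and extend to the ball;
  Fatou's lemma upgrades pointwise convergence to convergence in norm.\<close>

lemma bergman_complete:
  assumes F: "\<And>n. F n \<in> bergman \<alpha> i"
    and Cauchy: "\<And>\<epsilon>. \<epsilon> > 0 \<Longrightarrow> \<exists>N. \<forall>m\<ge>N. \<forall>n\<ge>N. sq (F m - F n) < \<epsilon>"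
  shows "\<exists>g\<in>bergman \<alpha> i. (\<lambda>n. sq (F n - g)) \<longlonglongrightarrow> 0"
proof -
  obtain j where j: "slice_split i j" by (rule split_exists)
  interpret slice_split i j by fact
  define H where "H = (\<lambda>n w. F n (emb w))"
  define G where "G = (\<lambda>w. lim (\<lambda>n. H n w))"
  have unif: "uniform_limit (cball 0 \<rho>) H G sequentially" if \<rho>: "\<rho> < 1" for \<rho>
    unfolding G_def uniformly_convergent_uniform_limit_iff[symmetric]
  proof (intro Cauchy_uniformly_convergent uniformly_Cauchy_onI)
    fix e :: real assume e: "e > 0"
    show "\<exists>N. \<forall>w\<in>cball 0 \<rho>. \<forall>m\<ge>N. \<forall>n\<ge>N. dist (H m w) (H n w) < e"
    proof (cases "\<rho> < 0")
      case False
      define B where "B = (1 - \<rho>\<^sup>2) powr (- (\<alpha> + 2))"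
      have "\<rho>\<^sup>2 < 1" using \<rho> False by (simp add: power_less_one_iff)
      then have B: "B > 0" by (simp add: B_def)
      obtain N where N: "\<And>m n. m \<ge> N \<Longrightarrow> n \<ge> N \<Longrightarrow> sq (F m - F n) < e\<^sup>2 / B"
        using Cauchy[of "e\<^sup>2 / B"] e B by auto
      have "dist (H m w) (H n w) < e" if w: "w \<in> cball 0 \<rho>" and mn: "m \<ge> N" "n \<ge> N" for w m n
      proof -
        have w1: "w \<in> ball 0 1" using w \<rho> by simp
        have "(norm w)\<^sup>2 \<le> \<rho>\<^sup>2" using w by (intro power_mono) auto
        then have le: "(1 - (norm w)\<^sup>2) powr (- (\<alpha> + 2)) \<le> B"
          unfolding B_def using \<alpha> \<open>\<rho>\<^sup>2 < 1\<close> by (intro powr_mono2') auto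
        have "(norm ((F m - F n) (emb w)))\<^sup>2 \<le> (1 - (norm w)\<^sup>2) powr (- (\<alpha> + 2)) * sq (F m - F n)"
          by (rule norm_eval_le[OF w1 diff_mem[OF F F]])
        also have "\<dots> \<le> B * sq (F m - F n)" by (rule mult_right_mono[OF le sq_nonneg[OF diff_mem[OF F F]]])
        also have "\<dots> < B * (e\<^sup>2 / B)" using N[OF mn] B by (intro mult_strict_left_mono)
        also have "\<dots> = e\<^sup>2" using B by simp
        finally have "norm ((F m - F n) (emb w)) < e" using e by (simp add: power_less_imp_less_base)
        then show ?thesis by (simp add: H_def dist_norm)
      qed
      then show ?thesis by blast
    qed auto
  qed
  have loc: "\<exists>d>0. cball x d \<subseteq> ball 0 1 \<and> uniform_limit (cball x d) H G sequentially"
    if x: "x \<in> ball 0 1" for x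
  proof (intro exI conjI)
    show "(1 - norm x) / 2 > 0" using x by simp
    have sub: "cball x ((1 - norm x) / 2) \<subseteq> cball 0 ((1 + norm x) / 2)"
      by (rule cball_subset_cball_iff[THEN iffD2]) (use x in \<open>simp add: field_simps\<close>)
    have "(1 + norm x) / 2 < 1" using x by simp
    then show "uniform_limit (cball x ((1 - norm x) / 2)) H G sequentially"
      by (rule uniform_limit_on_subset[OF unif sub])
    show "cball x ((1 - norm x) / 2) \<subseteq> ball 0 1"
      using sub x by (auto simp: subset_eq)
  qed
  have F': "F n \<in> slice_hol_space" for n using F by (simp add: bergman_iff)
  have c2: "bounded_linear coord2"
  proof -
    have "coord2 = (\<lambda>q. coord (q * (- j)))" by (simp add: fun_eq_iff coord2_def)
    then show ?thesis
      using bounded_linear_compose[OF bounded_linear_coord bounded_linear_mult_left[of "- j"]] by simp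
  qed
  have hol1: "(\<lambda>w. coord (G w)) holomorphic_on ball 0 1"
  proof (rule holomorphic_uniform_sequence[OF open_ball])
    show "(\<lambda>w. coord (H n w)) holomorphic_on ball 0 1" for n
      unfolding H_def by (rule coord_holomorphic[OF F'])
    show "\<exists>d>0. cball x d \<subseteq> ball 0 1 \<and> uniform_limit (cball x d) (\<lambda>n w. coord (H n w)) (\<lambda>w. coord (G w)) sequentially"
      if "x \<in> ball 0 1" for x
      using loc[OF that] bounded_linear.uniform_limit[OF bounded_linear_coord] by blast
  qed
  have hol2: "(\<lambda>w. coord2 (G w)) holomorphic_on ball 0 1"
  proof (rule holomorphic_uniform_sequence[OF open_ball])
    show "(\<lambda>w. coord2 (H n w)) holomorphic_on ball 0 1" for n
      unfolding H_def by (rule coord2_holomorphic[OF F' j])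
    show "\<exists>d>0. cball x d \<subseteq> ball 0 1 \<and> uniform_limit (cball x d) (\<lambda>n w. coord2 (H n w)) (\<lambda>w. coord2 (G w)) sequentially"
      if "x \<in> ball 0 1" for x
      using loc[OF that] bounded_linear.uniform_limit[OF c2] by blast
  qed
  obtain g1 where g1: "g1 \<in> slice_hol_space" "\<And>z. z \<in> ball 0 1 \<Longrightarrow> g1 (emb z) = emb (coord (G z))"
    using slice_extension[OF hol1] by blast
  obtain g2 where g2: "g2 \<in> slice_hol_space" "\<And>z. z \<in> ball 0 1 \<Longrightarrow> g2 (emb z) = emb (coord2 (G z))"
    using slice_extension[OF hol2] by blast
  define g where "g = (\<lambda>x. g1 x + g2 x * j)"
  have g: "g \<in> slice_hol_space"
    unfolding g_def by (intro slice_hol_space_add slice_hol_space_mult_right g1 g2)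
  have gG: "g (emb z) = G z" if "z \<in> ball 0 1" for z
    using that quat_split[of "G z"] by (simp add: g_def g1 g2)
  have pw: "(\<lambda>n. F n (emb z)) \<longlonglongrightarrow> g (emb z)" if z: "z \<in> ball 0 1" for z
  proof -
    obtain d where "d > 0" "uniform_limit (cball z d) H G sequentially" using loc[OF z] by blast
    then have "(\<lambda>n. H n z) \<longlonglongrightarrow> G z" by (intro tendsto_uniform_limitI) auto
    then show ?thesis using gG[OF z] by (simp add: H_def)
  qed
  \<comment> \<open>Fatou's lemma in the second index of the Cauchy condition; the nonnegative
    integral is used because g is not yet known to be square integrable.\<close>
  have nn: "(\<integral>\<^sup>+z. ennreal ((norm (F n (emb z) - g (emb z)))\<^sup>2) \<partial>M) \<le> ennreal \<epsilon>"
    if N: "\<And>m n. m \<ge> N \<Longrightarrow> n \<ge> N \<Longrightarrow> sq (F m - F n) < \<epsilon>" and n: "n \<ge> N" for n N \<epsilon>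
  proof -
    let ?u = "\<lambda>m z. ennreal ((norm (F n (emb z) - F m (emb z)))\<^sup>2)"
    have "(\<integral>\<^sup>+z. ennreal ((norm (F n (emb z) - g (emb z)))\<^sup>2) \<partial>M) = (\<integral>\<^sup>+z. liminf (\<lambda>m. ?u m z) \<partial>M)"
    proof (rule nn_integral_cong)
      fix z assume "z \<in> space M"
      then have "(\<lambda>m. ?u m z) \<longlonglongrightarrow> ennreal ((norm (F n (emb z) - g (emb z)))\<^sup>2)"
        by (intro tendsto_intros pw) simp
      then show "ennreal ((norm (F n (emb z) - g (emb z)))\<^sup>2) = liminf (\<lambda>m. ?u m z)"
        by (intro lim_imp_Liminf[symmetric]) auto
    qed
    also have "\<dots> \<le> liminf (\<lambda>m. \<integral>\<^sup>+z. ?u m z \<partial>M)"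
    proof (rule nn_integral_liminf)
      fix m
      have "(\<lambda>z. F n (emb z) - F m (emb z)) \<in> borel_measurable M"
        by (intro borel_measurable_diff slice_hol_measurable F')
      then show "?u m \<in> borel_measurable M" by measurable
    qed
    also have "\<dots> \<le> ennreal \<epsilon>"
    proof (rule Liminf_le)
      have "(\<integral>\<^sup>+z. ?u m z \<partial>M) \<le> ennreal \<epsilon>" if "m \<ge> N" for m
        using nn_integral_square[OF diff_mem[OF F F], of n m] N[OF n that] by (simp add: ennreal_leI)
      then show "\<forall>\<^sub>F m in sequentially. (\<integral>\<^sup>+z. ?u m z \<partial>M) \<le> ennreal \<epsilon>"
        unfolding eventually_sequentially by blast
    qed simp
    finally show ?thesis .
  qed
  have diff: "(\<lambda>x. F n x - g x) \<in> slice_hol_space" for n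
    using slice_hol_space_add[OF F' slice_hol_space_mult_right[OF g, of "-1"], of n] by simp
  have dm: "(\<lambda>z. (norm (F n (emb z) - g (emb z)))\<^sup>2) \<in> borel_measurable M" for n
  proof -
    have "(\<lambda>z. F n (emb z) - g (emb z)) \<in> borel_measurable M"
      by (intro borel_measurable_diff slice_hol_measurable F' g)
    then show ?thesis by measurable
  qed
  obtain N1 where N1: "\<And>m n. m \<ge> N1 \<Longrightarrow> n \<ge> N1 \<Longrightarrow> sq (F m - F n) < 1" using Cauchy[of 1] by auto
  have "integrable M (\<lambda>z. (norm (F N1 (emb z) - g (emb z)))\<^sup>2)"
    using le_less_trans[OF nn[OF N1 order_refl] ennreal_less_top] by (intro integrableI_nonneg dm) auto
  then have d: "(\<lambda>x. F N1 x - g x) \<in> bergman \<alpha> i" using diff by (simp add: bergman_iff)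
  \<comment> \<open>Since one difference to the limit lies in the space, so does the limit.\<close>
  have "F N1 - (\<lambda>x. F N1 x - g x) = g" by (simp add: fun_eq_iff)
  with diff_mem[OF F[of N1] d] have gA: "g \<in> bergman \<alpha> i" by (simp only:)
  have "(\<lambda>n. sq (F n - g)) \<longlonglongrightarrow> 0"
  proof (rule LIMSEQ_I)
    fix e :: real assume e: "e > 0"
    then obtain N where N: "\<And>m n. m \<ge> N \<Longrightarrow> n \<ge> N \<Longrightarrow> sq (F m - F n) < e / 2"
      using Cauchy[of "e / 2"] by auto
    have "norm (sq (F n - g) - 0) < e" if "n \<ge> N" for n
    proof -
      have "ennreal (sq (F n - g)) \<le> ennreal (e / 2)"
        using nn[OF N that] nn_integral_square[OF diff_mem[OF F gA], of n] by simp
      then show ?thesis using e sq_nonneg[OF diff_mem[OF F gA], of n] by (simp add: ennreal_le_iff)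
    qed
    then show "\<exists>N. \<forall>n\<ge>N. norm (sq (F n - g) - 0) < e" by blast
  qed
  with gA show ?thesis by blast
qed

end

section \<open>Singular values and the Berezin transform\<close>

context bergman_space
begin

lemma positive_operator_of_bounded:
  assumes T: "T \<in> bounded_ops \<alpha> i" and pos: "positive_op \<alpha> i T"
  obtains C where "positive_operator (bergman \<alpha> i) (bip \<alpha> i) T C"
proof -
  have map: "T f \<in> bergman \<alpha> i" if "f \<in> bergman \<alpha> i" for f
    using T that unfolding bounded_ops_def by auto
  have "\<exists>C. \<forall>f\<in>bergman \<alpha> i. bnorm \<alpha> i (T f) \<le> C * bnorm \<alpha> i f"
    using T unfolding bounded_ops_def by blast
  then obtain C where C: "bnorm \<alpha> i (T f) \<le> C * bnorm \<alpha> i f" if "f \<in> bergman \<alpha> i" for f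
    by blast
  have "positive_operator (bergman \<alpha> i) (bip \<alpha> i) T (C\<^sup>2)"
  proof unfold_locales
    fix f g a assume f: "f \<in> bergman \<alpha> i"
    show "T f \<in> bergman \<alpha> i" by (rule map[OF f])
    show "T (f \<cdot> a) = T f \<cdot> a" using T f unfolding bounded_ops_def rscale_def by blast
    have "sqrt (sq (T f)) \<le> C * sqrt (sq f)" using C[OF f] by (simp add: bnorm_eq)
    then have "(sqrt (sq (T f)))\<^sup>2 \<le> (C * sqrt (sq f))\<^sup>2"
      using map[OF f] by (intro power_mono) auto
    then show "sq (T f) \<le> C\<^sup>2 * sq f" using f map[OF f] by (simp add: power_mult_distrib)
    show "\<exists>r\<ge>0. bip \<alpha> i f (T f) = of_real r" using pos f by (simp add: positive_op_def)
    assume g: "g \<in> bergman \<alpha> i"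
    show "T (f + g) = T f + T g" using T f g unfolding bounded_ops_def plus_fun_def by blast
  qed
  then show ?thesis by (rule that)
qed

lemma bounded_ops_eqI:
  assumes "S \<in> bounded_ops \<alpha> i" "T \<in> bounded_ops \<alpha> i" "\<And>f. f \<in> bergman \<alpha> i \<Longrightarrow> S f = T f"
  shows "S = T"
  by (rule PiE_ext[of S "bergman \<alpha> i" "\<lambda>_. bergman \<alpha> i"]) (use assms in \<open>auto simp: bounded_ops_def\<close>)

lemma compact_op_iff:
  assumes T: "T \<in> bounded_ops \<alpha> i" and positive_operator: "positive_operator (bergman \<alpha> i) (bip \<alpha> i) T C"
  shows "compact_op \<alpha> i T \<longleftrightarrow> positive_operator.T_compact (bergman \<alpha> i) (bip \<alpha> i) T"
proof -
  interpret positive_operator "bergman \<alpha> i" "bip \<alpha> i" T C by fact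
  have lim: "(\<lambda>n. bnorm \<alpha> i (\<lambda>x. T (F (r n)) x - g x)) \<longlonglongrightarrow> 0 \<longleftrightarrow> (\<lambda>n. sq (T (F (r n)) - g)) \<longlonglongrightarrow> 0"
    if F: "\<And>n. F n \<in> bergman \<alpha> i" and g: "g \<in> bergman \<alpha> i" for F g and r :: "nat \<Rightarrow> nat"
  proof -
    have eq: "(\<lambda>n. bnorm \<alpha> i (\<lambda>x. T (F (r n)) x - g x)) = (\<lambda>n. sqrt (sq (T (F (r n)) - g)))"
      by (simp add: bnorm_eq fun_diff_def)
    have "0 \<le> sq (T (F (r n)) - g)" for n by (intro sq_nonneg diff_mem T_mem F g)
    then have eq2: "(\<lambda>n. sq (T (F (r n)) - g)) = (\<lambda>n. (sqrt (sq (T (F (r n)) - g)))\<^sup>2)" by simp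
    show ?thesis
    proof
      assume "(\<lambda>n. bnorm \<alpha> i (\<lambda>x. T (F (r n)) x - g x)) \<longlonglongrightarrow> 0"
      then have "(\<lambda>n. (sqrt (sq (T (F (r n)) - g)))\<^sup>2) \<longlonglongrightarrow> 0\<^sup>2" unfolding eq by (rule tendsto_power)
      then show "(\<lambda>n. sq (T (F (r n)) - g)) \<longlonglongrightarrow> 0" by (subst eq2) simp
    next
      assume "(\<lambda>n. sq (T (F (r n)) - g)) \<longlonglongrightarrow> 0"
      from tendsto_real_sqrt[OF this] show "(\<lambda>n. bnorm \<alpha> i (\<lambda>x. T (F (r n)) x - g x)) \<longlonglongrightarrow> 0"
        unfolding eq by simp
    qed
  qed
  show ?thesis
  proof
    assume c: "compact_op \<alpha> i T"
    show T_compact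
      unfolding T_compact_def
    proof (intro allI impI)
      fix F :: "nat \<Rightarrow> quat \<Rightarrow> quat" and B assume F: "\<forall>n. F n \<in> bergman \<alpha> i \<and> sq (F n) \<le> B"
      then have "\<forall>n. F n \<in> bergman \<alpha> i \<and> bnorm \<alpha> i (F n) \<le> sqrt B" by (simp add: bnorm_eq)
      then obtain r :: "nat \<Rightarrow> nat" and g where "g \<in> bergman \<alpha> i" "strict_mono r"
        "(\<lambda>n. bnorm \<alpha> i (\<lambda>x. T (F (r n)) x - g x)) \<longlonglongrightarrow> 0"
        using c unfolding compact_op_def by meson
      then show "\<exists>r :: nat \<Rightarrow> nat. \<exists>g\<in>bergman \<alpha> i. strict_mono r \<and> (\<lambda>n. sq (T (F (r n)) - g)) \<longlonglongrightarrow> 0"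
        using lim[of F g r] F by blast
    qed
  next
    assume c: T_compact
    show "compact_op \<alpha> i T"
      unfolding compact_op_def
    proof (intro conjI T allI impI)
      fix F :: "nat \<Rightarrow> quat \<Rightarrow> quat" and B assume F: "\<forall>n. F n \<in> bergman \<alpha> i \<and> bnorm \<alpha> i (F n) \<le> B"
      then have FA: "F n \<in> bergman \<alpha> i" and Fs: "sqrt (sq (F n)) \<le> B" for n by (auto simp: bnorm_eq)
      have "sq (F n) \<le> B\<^sup>2" for n
        using power_mono[OF Fs[of n], of 2] sq_nonneg[OF FA[of n]] by simp
      then obtain r :: "nat \<Rightarrow> nat" and g where "g \<in> bergman \<alpha> i" "strict_mono r"
        "(\<lambda>n. sq (T (F (r n)) - g)) \<longlonglongrightarrow> 0"
        using c FA unfolding T_compact_def by meson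
      then show "\<exists>r :: nat \<Rightarrow> nat. \<exists>g\<in>bergman \<alpha> i. strict_mono r \<and>
          (\<lambda>n. bnorm \<alpha> i (\<lambda>x. T (F (r n)) x - g x)) \<longlonglongrightarrow> 0"
        using lim[of F g r, OF FA] by blast
    qed
  qed
qed

text \<open>A positive operator is its own adjoint and a positive root of T^2. That no other root
  exists is taken from the eigenvectors, hence the spectral hypothesis.\<close>

lemma op_abs_positive:
  assumes T: "T \<in> bounded_ops \<alpha> i" and pos: "positive_op \<alpha> i T"
    and spec: "spectral_operator (bergman \<alpha> i) (bip \<alpha> i) T C e \<mu>"
  shows "op_abs \<alpha> i T = T"
proof -
  interpret spectral_operator "bergman \<alpha> i" "bip \<alpha> i" T C e \<mu> by fact
  have map: "S f \<in> bergman \<alpha> i" if "S \<in> bounded_ops \<alpha> i" "f \<in> bergman \<alpha> i" for S f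
    using that unfolding bounded_ops_def by auto
  have adj: "op_adjoint \<alpha> i T = T"
    unfolding op_adjoint_def
  proof (rule the_equality)
    show "T \<in> bounded_ops \<alpha> i \<and> (\<forall>f\<in>bergman \<alpha> i. \<forall>g\<in>bergman \<alpha> i. bip \<alpha> i (T f) g = bip \<alpha> i f (T g))"
      using T by (simp add: T_symmetric)
    fix S assume S: "S \<in> bounded_ops \<alpha> i \<and> (\<forall>f\<in>bergman \<alpha> i. \<forall>g\<in>bergman \<alpha> i. bip \<alpha> i (S f) g = bip \<alpha> i f (T g))"
    show "S = T"
    proof (rule bounded_ops_eqI[OF _ T])
      fix f assume f: "f \<in> bergman \<alpha> i"
      have SA: "S f \<in> bergman \<alpha> i" using S f map by blast
      show "S f = T f"
      proof (rule eqI_ip[OF SA T_mem[OF f]])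
        fix h assume h: "h \<in> bergman \<alpha> i"
        have "bip \<alpha> i (S f) h = bip \<alpha> i (T f) h" using S f h by (simp add: T_symmetric)
        then show "bip \<alpha> i h (S f) = bip \<alpha> i h (T f)"
          using qcnj_ip[OF SA h] qcnj_ip[OF T_mem[OF f] h] by simp
      qed
    qed (use S in simp)
  qed
  show ?thesis
    unfolding op_abs_def adj op_sqrt_def
  proof (rule the_equality)
    show "T \<in> bounded_ops \<alpha> i \<and> positive_op \<alpha> i T \<and> compose (bergman \<alpha> i) T T = compose (bergman \<alpha> i) T T"
      using T pos by simp
    fix S assume S: "S \<in> bounded_ops \<alpha> i \<and> positive_op \<alpha> i S
        \<and> compose (bergman \<alpha> i) S S = compose (bergman \<alpha> i) T T"
    then obtain D where D: "positive_operator (bergman \<alpha> i) (bip \<alpha> i) S D" using positive_operator_of_bounded by blast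
    have SS: "S (S f) = T (T f)" if "f \<in> bergman \<alpha> i" for f
    proof -
      have "compose (bergman \<alpha> i) S S f = compose (bergman \<alpha> i) T T f" using S by simp
      then show ?thesis using that by (simp add: compose_def)
    qed
    show "S = T"
      by (rule bounded_ops_eqI[OF _ T positive_sqrt_unique[OF D SS]]) (use S in auto)
  qed
qed

text \<open>The eigenvectors \<open>e n\<close> with \<mu> n = c are a basis: they span because of
  \<open>eigenvector_expansion\<close>, and pairing with each of them gives independence.\<close>

lemma has_right_dim_eigenspace:
  assumes spec: "spectral_operator (bergman \<alpha> i) (bip \<alpha> i) T C e \<mu>" and c: "c > 0"
  shows "has_right_dim (eigenspace \<alpha> i T c) (card {n. \<mu> n = c})"
proof -
  interpret spectral_operator "bergman \<alpha> i" "bip \<alpha> i" T C e \<mu> by fact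
  let ?I = "{n. \<mu> n = c}"
  have inj: "inj e"
  proof (rule injI)
    fix k l assume "e k = e l"
    then have "bip \<alpha> i (e k) (e l) = 1" using ip_e[of l l] by simp
    then show "k = l" using ip_e[of k l] by (simp split: if_splits)
  qed
  then have injI: "inj_on e ?I" by (rule inj_on_subset) simp
  have fin: "finite ?I" by (rule finite_eigenvalue[OF c])
  have lc: "(\<lambda>x. \<Sum>b\<in>e ` ?I. b x * a b) = (\<Sum>k\<in>?I. e k \<cdot> a (e k))" for a
    by (rule ext) (simp add: sum.reindex[OF injI] sum_fun_apply)
  have mem: "(\<Sum>k\<in>?I. e k \<cdot> a k) \<in> bergman \<alpha> i" for a by (intro sum_mem rscale_mem e_mem)
  show ?thesis
    unfolding has_right_dim_def
  proof (intro exI[of _ "e ` ?I"] conjI allI impI)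
    show "finite (e ` ?I)" "card (e ` ?I) = card ?I" using fin injI by (simp_all add: card_image)
    show "eigenspace \<alpha> i T c = {f. \<exists>a. f = (\<lambda>x. \<Sum>b\<in>e ` ?I. b x * a b)}"
    proof (intro set_eqI iffI)
      fix f assume "f \<in> eigenspace \<alpha> i T c"
      then have f: "f \<in> bergman \<alpha> i" "T f = f \<cdot> of_real c" by (auto simp: eigenspace_def rscale_def)
      have "f = (\<lambda>x. \<Sum>b\<in>e ` ?I. b x * bip \<alpha> i b f)"
        unfolding lc by (rule eigenvector_expansion[OF f(1) c f(2)])
      then show "f \<in> {f. \<exists>a. f = (\<lambda>x. \<Sum>b\<in>e ` ?I. b x * a b)}" unfolding mem_Collect_eq
        by (rule exI[of _ "\<lambda>b. bip \<alpha> i b f"])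
    next
      fix f assume "f \<in> {f. \<exists>a. f = (\<lambda>x. \<Sum>b\<in>e ` ?I. b x * a b)}"
      then obtain a where f: "f = (\<Sum>k\<in>?I. e k \<cdot> a (e k))" unfolding lc by blast
      have "T f = (\<Sum>k\<in>?I. T (e k \<cdot> a (e k)))" unfolding f by (intro T_sum rscale_mem e_mem)
      also have "\<dots> = (\<Sum>k\<in>?I. e k \<cdot> a (e k) \<cdot> of_real c)"
      proof (rule sum.cong[OF refl])
        fix k assume "k \<in> ?I"
        then show "T (e k \<cdot> a (e k)) = e k \<cdot> a (e k) \<cdot> of_real c"
          using quat_of_real_commute[of c "a (e k)"] by (simp add: T_rscale T_e)
      qed
      also have "\<dots> = f \<cdot> of_real c" unfolding f rscale_sum ..
      finally show "f \<in> eigenspace \<alpha> i T c"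
        using mem[of "\<lambda>k. a (e k)"] f by (simp add: eigenspace_def rscale_def)
    qed
    fix a assume z: "\<forall>x. (\<Sum>b\<in>e ` ?I. b x * a b) = 0"
    have 0: "(\<Sum>k\<in>?I. e k \<cdot> a (e k)) = 0"
      unfolding lc[symmetric] by (simp only: z) (simp add: zero_fun_def)
    show "\<forall>b\<in>e ` ?I. a b = 0"
    proof (intro ballI, elim imageE, simp only:)
      fix k assume k: "k \<in> ?I"
      have "0 = bip \<alpha> i (e k) (\<Sum>l\<in>?I. e l \<cdot> a (e l))" by (simp only: 0) simp
      also have "\<dots> = (\<Sum>l\<in>?I. bip \<alpha> i (e k) (e l) * a (e l))"
        by (subst ip_sum_right) (simp_all add: ip_rscale_right)
      also have "\<dots> = (\<Sum>l\<in>?I. if l = k then a (e k) else 0)"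
        by (intro sum.cong) (auto simp: ip_e)
      also have "\<dots> = a (e k)" using fin k by simp
      finally show "a (e k) = 0" by simp
    qed
  qed
qed

text \<open>Uniqueness of dimension fixes how often each positive value occurs, and this determines
  a decreasing nonnegative sequence. The kernel of T, possibly of infinite dimension, is not
  counted; zeros merely fill up the sequence.\<close>

lemma singular_value_eq:
  assumes T: "T \<in> bounded_ops \<alpha> i" "positive_op \<alpha> i T"
    and spec: "spectral_operator (bergman \<alpha> i) (bip \<alpha> i) T C e \<mu>"
  shows "singular_value \<alpha> i T = \<mu>"
proof -
  interpret spectral_operator "bergman \<alpha> i" "bip \<alpha> i" T C e \<mu> by fact
  note dim = has_right_dim_eigenspace[OF spec]
  show ?thesis
    unfolding singular_value_def op_abs_positive[OF T spec]
  proof (rule the_equality)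
    show "decseq \<mu> \<and> (\<forall>n. 0 \<le> \<mu> n) \<and> (\<forall>c>0. finite {n. \<mu> n = c}
        \<and> has_right_dim (eigenspace \<alpha> i T c) (card {n. \<mu> n = c}))"
      using \<mu>_decseq \<mu>_nonneg finite_eigenvalue dim by blast
    fix s :: "nat \<Rightarrow> real"
    assume s: "decseq s \<and> (\<forall>n. 0 \<le> s n) \<and> (\<forall>c>0. finite {n. s n = c}
        \<and> has_right_dim (eigenspace \<alpha> i T c) (card {n. s n = c}))"
    show "s = \<mu>"
      by (rule decseq_eqI_multiplicities)
        (use s \<mu>_decseq \<mu>_nonneg finite_eigenvalue has_right_dim_unique[OF _ dim] in blast)+
  qed
qed

section \<open>Evaluation weights and their integrals against the Moebius invariant measure\<close>

abbreviation "N \<equiv> disc_measure moebius_weight"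

text \<open>By the reproducing property this is |<k_z, f>|^2 for the normalised kernel k_z.\<close>

definition eval_weight :: "(quat \<Rightarrow> quat) \<Rightarrow> complex \<Rightarrow> real" where
  "eval_weight f z = (norm (f (emb z)))\<^sup>2 / sq (kernel \<alpha> i (emb z))"

lemma sq_kernel_pos:
  assumes "z \<in> ball 0 1" shows "sq (kernel \<alpha> i (emb z)) > 0"
proof -
  have "(norm z)\<^sup>2 < 1" using assms by (simp add: power_less_one_iff)
  then show ?thesis unfolding sq_kernel[OF assms] by simp
qed

lemma eval_weight_eq:
  "z \<in> ball 0 1 \<Longrightarrow> eval_weight f z = (norm (f (emb z)))\<^sup>2 * (1 - (norm z)\<^sup>2) powr (\<alpha> + 2)"
  by (simp add: eval_weight_def sq_kernel powr_minus field_simps del: minus_add_distrib)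

lemma eval_weight_nonneg: "z \<in> ball 0 1 \<Longrightarrow> 0 \<le> eval_weight f z"
  using sq_kernel_pos[of z] by (simp add: eval_weight_def)

lemma eval_weight_measurable:
  assumes "f \<in> bergman \<alpha> i" shows "eval_weight f \<in> borel_measurable N"
proof -
  have [measurable]: "(\<lambda>z. f (emb z)) \<in> borel_measurable N"
    by (rule slice_hol_measurable) (use assms in \<open>simp add: bergman_iff\<close>)
  have [measurable]: "(\<lambda>z::complex. (1 - (norm z)\<^sup>2) powr (\<alpha> + 2)) \<in> borel_measurable N"
    by (rule measurable_disc_measure_borel) measurable
  have "(\<lambda>z. (norm (f (emb z)))\<^sup>2 * (1 - (norm z)\<^sup>2) powr (\<alpha> + 2)) \<in> borel_measurable N"
    by measurable
  then show ?thesis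
    by (rule measurable_cong[THEN iffD1, rotated]) (simp add: eval_weight_eq)
qed

text \<open>With t = 1 - |z|^2 the factor t^(\<alpha> + 2) of the weight and the density 1 / (pi
  t^2) combine to t^\<alpha> / pi, which is the Bergman density divided by \<alpha> + 1.\<close>

lemma nn_integral_eval_weight:
  assumes f: "f \<in> bergman \<alpha> i"
  shows "(\<integral>\<^sup>+z. ennreal (eval_weight f z) \<partial>N) = ennreal (sq f / (\<alpha> + 1))"
proof -
  have fh: "f \<in> slice_hol_space" using f by (simp add: bergman_iff)
  have m1: "(\<lambda>z. ennreal (eval_weight f z)) \<in> borel_measurable N"
    using eval_weight_measurable[OF f] by measurable
  have m2: "(\<lambda>z. ennreal ((norm (f (emb z)))\<^sup>2)) \<in> borel_measurable M"
    using slice_hol_measurable(2)[OF fh] by measurable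
  have m3: "(\<lambda>z. ennreal (1 / (\<alpha> + 1)) * ennreal ((norm (f (emb z)))\<^sup>2)) \<in> borel_measurable M"
    using m2 by measurable
  have "(\<integral>\<^sup>+z. ennreal (eval_weight f z) \<partial>N)
      = (\<integral>\<^sup>+z. ennreal (moebius_weight ((norm z)\<^sup>2)) * ennreal (eval_weight f z) * indicator (ball 0 1) z \<partial>lborel)"
    by (rule nn_integral_disc_measure[OF _ m1]) measurable
  also have "\<dots> = (\<integral>\<^sup>+z. ennreal (bergman_weight \<alpha> ((norm z)\<^sup>2))
      * (ennreal (1 / (\<alpha> + 1)) * ennreal ((norm (f (emb z)))\<^sup>2)) * indicator (ball 0 1) z \<partial>lborel)"
  proof (rule nn_integral_cong)
    fix z :: complex
    show "ennreal (moebius_weight ((norm z)\<^sup>2)) * ennreal (eval_weight f z) * indicator (ball 0 1) z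
        = ennreal (bergman_weight \<alpha> ((norm z)\<^sup>2)) * (ennreal (1 / (\<alpha> + 1)) * ennreal ((norm (f (emb z)))\<^sup>2))
          * indicator (ball 0 1) z"
    proof (cases "z \<in> ball 0 1")
      case True
      define t where "t = 1 - (norm z)\<^sup>2"
      have t: "t > 0" using True by (simp add: t_def power_less_one_iff)
      have "t powr (\<alpha> + 2) = t powr \<alpha> * t\<^sup>2" using t by (simp add: powr_add)
      then have "moebius_weight ((norm z)\<^sup>2) * eval_weight f z
          = bergman_weight \<alpha> ((norm z)\<^sup>2) * (1 / (\<alpha> + 1) * (norm (f (emb z)))\<^sup>2)"
        using True t \<alpha> by (simp add: eval_weight_eq moebius_weight_def bergman_weight_def t_def[symmetric])
      moreover have "0 \<le> bergman_weight \<alpha> ((norm z)\<^sup>2)"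
        using bergman_weight_pos[OF \<alpha>, of "(norm z)\<^sup>2"] True by (simp add: power_less_one_iff)
      moreover have "0 \<le> moebius_weight ((norm z)\<^sup>2)" by (simp add: moebius_weight_def)
      ultimately show ?thesis
        using \<alpha> eval_weight_nonneg[OF True, of f] by (simp add: ennreal_mult[symmetric])
    qed simp
  qed
  also have "\<dots> = (\<integral>\<^sup>+z. ennreal (1 / (\<alpha> + 1)) * ennreal ((norm (f (emb z)))\<^sup>2) \<partial>M)"
    by (rule nn_integral_disc_measure[OF _ m3, symmetric]) measurable
  also have "\<dots> = ennreal (1 / (\<alpha> + 1)) * ennreal (sq f)"
    by (subst nn_integral_cmult[OF m2]) (simp add: nn_integral_square[OF f])
  also have "\<dots> = ennreal (sq f / (\<alpha> + 1))"
    using \<alpha> f by (simp add: ennreal_mult[symmetric])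
  finally show ?thesis .
qed

end

locale bergman_operator = bergman_space +
  fixes T :: qop and C :: real
  assumes T_op: "T \<in> bounded_ops \<alpha> i" and T_positive: "positive_op \<alpha> i T"
    and T_operator: "positive_operator (bergman \<alpha> i) (bip \<alpha> i) T C"
begin

sublocale positive_operator "bergman \<alpha> i" "bip \<alpha> i" T C by (rule T_operator)

text \<open>The Berezin transform as a real function on the complex disc, written as a Rayleigh
  quotient of the unnormalised kernel.\<close>

definition rberezin :: "complex \<Rightarrow> real" where
  "rberezin z = tf (kernel \<alpha> i (emb z)) / sq (kernel \<alpha> i (emb z))"

lemma berezin_eq:
  assumes z: "z \<in> ball 0 1" shows "berezin \<alpha> i T (emb z) = of_real (rberezin z)"
proof -
  let ?K = "kernel \<alpha> i (emb z)"
  let ?k = "normalized_kernel \<alpha> i (emb z)"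
  have K: "?K \<in> bergman \<alpha> i" by (rule kernel_mem[OF z])
  have k: "?k \<in> bergman \<alpha> i" unfolding normalized_kernel_eq by (rule rscale_mem[OF K])
  have "tf ?k = rberezin z"
    using sq_kernel_pos[OF z] K
    by (simp add: normalized_kernel_eq rberezin_def form.sq_rscale power_divide del: of_real_divide)
  then show ?thesis unfolding berezin_def using ip_T_self[OF k] by simp
qed

lemma rberezin_nonneg: "z \<in> ball 0 1 \<Longrightarrow> 0 \<le> rberezin z"
  unfolding rberezin_def using sq_kernel_pos[of z] form.sq_nonneg[OF kernel_mem[of z]] by simp

lemma rberezin_bounded: "z \<in> ball 0 1 \<Longrightarrow> rberezin z \<le> sqrt \<bar>C\<bar>"
  unfolding rberezin_def using sq_kernel_pos[of z] tf_le_sq[OF kernel_mem[of z]]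
  by (simp add: divide_le_eq)

lemma norm_ip_kernel:
  assumes "z \<in> ball 0 1" "f \<in> bergman \<alpha> i"
  shows "norm (bip \<alpha> i f (kernel \<alpha> i (emb z))) = norm (f (emb z))"
  using norm_ip_commute[OF assms(2) kernel_mem[OF assms(1)]] kernel_reproducing[OF assms] by simp

text \<open>Up to conjugation, T v_k (z) = <K_z, T v_k> is the coefficient of K_z along v_k for the
  form, so this is Bessel's inequality for the form at K_z.\<close>

lemma form_orthonormal_eval_le:
  fixes v :: "nat \<Rightarrow> quat \<Rightarrow> quat"
  assumes v: "form.orthonormal v {..<n}" and z: "z \<in> ball 0 1"
  shows "(\<Sum>k<n. eval_weight (T (v k)) z) \<le> rberezin z"
proof -
  let ?K = "kernel \<alpha> i (emb z)"
  have vA: "v k \<in> bergman \<alpha> i" if "k < n" for k using form.orthonormalD(1)[OF v] that by simp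
  have "norm (bip \<alpha> i (v k) (T ?K)) = norm (T (v k) (emb z))" if "k < n" for k
    using norm_ip_kernel[OF z T_mem[OF vA[OF that]]] T_symmetric[OF vA[OF that] kernel_mem[OF z]] by simp
  then have "(\<Sum>k<n. (norm (T (v k) (emb z)))\<^sup>2) = (\<Sum>k<n. (norm (bip \<alpha> i (v k) (T ?K)))\<^sup>2)"
    by (intro sum.cong) auto
  also have "\<dots> \<le> tf ?K" by (rule form.Bessel[OF finite_lessThan v kernel_mem[OF z]])
  finally show ?thesis
    using sq_kernel_pos[OF z] by (simp add: eval_weight_def rberezin_def sum_divide_distrib[symmetric] divide_right_mono)
qed

text \<open>Integrating the Bessel bound gives the trace bound I (\<alpha> + 1), where I is the
  integral of the Berezin transform. Only monotonicity of \<open>nn_integral\<close> is invoked for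
  \<open>rberezin\<close>, whose measurability is derived later from the eigenvectors.\<close>

lemma compact_of_integrable_rberezin:
  assumes "(\<integral>\<^sup>+z. ennreal (rberezin z) \<partial>N) < \<infinity>"
  shows T_compact
proof -
  obtain I where I: "(\<integral>\<^sup>+z. ennreal (rberezin z) \<partial>N) = ennreal I" "I \<ge> 0"
    using assms by (cases "\<integral>\<^sup>+z. ennreal (rberezin z) \<partial>N") auto
  show ?thesis
  proof (rule compact_of_trace_bound[OF _ bergman_complete])
    fix n and v :: "nat \<Rightarrow> quat \<Rightarrow> quat" assume v: "form.orthonormal v {..<n}"
    have TvA: "T (v k) \<in> bergman \<alpha> i" if "k < n" for k
      using form.orthonormalD(1)[OF v] that by simp
    have "ennreal (\<Sum>k<n. sq (T (v k)) / (\<alpha> + 1)) = (\<Sum>k<n. ennreal (sq (T (v k)) / (\<alpha> + 1)))"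
      using TvA \<alpha> by (intro sum_ennreal[symmetric]) (auto intro!: divide_nonneg_nonneg)
    also have "\<dots> = (\<Sum>k<n. \<integral>\<^sup>+z. ennreal (eval_weight (T (v k)) z) \<partial>N)"
      using TvA by (intro sum.cong) (auto simp: nn_integral_eval_weight)
    also have "\<dots> = (\<integral>\<^sup>+z. (\<Sum>k<n. ennreal (eval_weight (T (v k)) z)) \<partial>N)"
      using TvA by (intro nn_integral_sum[symmetric]) (auto intro!: measurable_compose[OF eval_weight_measurable measurable_ennreal])
    also have "\<dots> \<le> (\<integral>\<^sup>+z. ennreal (rberezin z) \<partial>N)"
    proof (rule nn_integral_mono)
      fix z assume "z \<in> space N"
      then have z: "z \<in> ball 0 1" by simp
      show "(\<Sum>k<n. ennreal (eval_weight (T (v k)) z)) \<le> ennreal (rberezin z)"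
        using form_orthonormal_eval_le[OF v z] eval_weight_nonneg[OF z] by (simp add: ennreal_leI)
    qed
    also have "\<dots> = ennreal I" by (rule I(1))
    finally have "(\<Sum>k<n. sq (T (v k)) / (\<alpha> + 1)) \<le> I" using I(2) by (simp add: ennreal_le_iff)
    then show "(\<Sum>k<n. sq (T (v k))) \<le> I * (\<alpha> + 1)"
      using \<alpha> by (simp add: sum_divide_distrib[symmetric] divide_le_eq)
  qed
qed

lemma spectral_decomposition:
  assumes T_compact
  obtains e \<mu> where "spectral_operator (bergman \<alpha> i) (bip \<alpha> i) T C e \<mu>"
proof -
  obtain u :: "nat \<Rightarrow> quat \<Rightarrow> quat" where u: "orthonormal u UNIV" by (rule monomials_orthonormal)
  obtain e \<mu> where *: "orthonormal e UNIV" "\<And>n. T (e n) = e n \<cdot> of_real (\<mu> n)" "\<And>n. 0 \<le> \<mu> n" "decseq \<mu>" "\<mu> \<longlonglongrightarrow> 0"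
    "\<And>n f. f \<in> bergman \<alpha> i \<Longrightarrow> (\<And>k. k < n \<Longrightarrow> bip \<alpha> i (e k) f = 0) \<Longrightarrow> tf f \<le> \<mu> n * sq f"
    using spectral_theorem[OF assms u] by metis
  have "spectral_operator (bergman \<alpha> i) (bip \<alpha> i) T C e \<mu>"
    by unfold_locales (use * in blast)+
  then show ?thesis by (rule that)
qed

end

locale bergman_spectral = bergman_operator +
  fixes e :: "nat \<Rightarrow> quat \<Rightarrow> quat" and \<mu> :: "nat \<Rightarrow> real"
  assumes spec: "spectral_operator (bergman \<alpha> i) (bip \<alpha> i) T C e \<mu>"
begin

sublocale spectral_operator "bergman \<alpha> i" "bip \<alpha> i" T C e \<mu> by (rule spec)

text \<open>The expansion of the form at K_z, whose coefficients are the values e_k(z) up to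
  conjugation.\<close>

lemma rberezin_sums:
  assumes z: "z \<in> ball 0 1"
  shows "(\<lambda>k. \<mu> k * eval_weight (e k) z) sums rberezin z"
  using sums_divide[OF tf_sums[OF kernel_mem[OF z]], of "sq (kernel \<alpha> i (emb z))"]
  by (simp add: norm_ip_kernel[OF z] eval_weight_def rberezin_def)

lemma sum_eval_weight_le:
  assumes z: "z \<in> ball 0 1"
  shows "(\<Sum>k<n. eval_weight (e k) z) \<le> 1"
  using Bessel_e[OF kernel_mem[OF z], of n] sq_kernel_pos[OF z]
  by (simp add: norm_ip_kernel[OF z] eval_weight_def sum_divide_distrib[symmetric] divide_le_eq)

lemma rberezin_measurable: "rberezin \<in> borel_measurable N"
proof (rule borel_measurable_LIMSEQ_real)
  show "(\<lambda>n. \<Sum>k<n. \<mu> k * eval_weight (e k) z) \<longlonglongrightarrow> rberezin z" if "z \<in> space N" for z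
    using rberezin_sums[of z] that by (simp add: sums_def)
  show "(\<lambda>z. \<Sum>k<n. \<mu> k * eval_weight (e k) z) \<in> borel_measurable N" for n
    by (intro borel_measurable_sum borel_measurable_times borel_measurable_const eval_weight_measurable e_mem)
qed

text \<open>Bundles the assumptions of the Jensen context in their order; the bound on all x n there
  is the largest eigenvalue \<mu> 0.\<close>

lemma Jensen_conditions:
  assumes z: "z \<in> ball 0 1"
  shows "0 \<le> eval_weight (e k) z" "(\<Sum>k<n. eval_weight (e k) z) \<le> 1" "0 \<le> \<mu> k" "\<mu> k \<le> \<mu> 0"
    "(\<lambda>k. \<mu> k * eval_weight (e k) z) sums rberezin z"
  using eval_weight_nonneg[OF z] sum_eval_weight_le[OF z] \<mu>_nonneg decseqD[OF \<mu>_decseq, of 0 k]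
    rberezin_sums[OF z] by auto

lemma nn_integral_eigen_weight:
  "(\<integral>\<^sup>+z. ennreal (\<mu> k powr p * eval_weight (e k) z) \<partial>N) = ennreal (\<mu> k powr p / (\<alpha> + 1))"
proof -
  have "(\<integral>\<^sup>+z. ennreal (\<mu> k powr p * eval_weight (e k) z) \<partial>N)
      = (\<integral>\<^sup>+z. ennreal (\<mu> k powr p) * ennreal (eval_weight (e k) z) \<partial>N)"
    by (intro nn_integral_cong) (simp add: ennreal_mult eval_weight_nonneg)
  also have "\<dots> = ennreal (\<mu> k powr p) * ennreal (1 / (\<alpha> + 1))"
    using measurable_compose[OF eval_weight_measurable[OF e_mem] measurable_ennreal]
    by (subst nn_integral_cmult) (simp_all add: nn_integral_eval_weight sq_e)
  finally show ?thesis using \<alpha> by (simp add: ennreal_mult[symmetric])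
qed

text \<open>Jensen pointwise in z, then exchange of sum and integral for nonnegative terms; each
  eigenvalue contributes \<mu> k^p / (\<alpha> + 1).\<close>

lemma nn_integral_rberezin_powr_finite:
  assumes p: "1 \<le> p" and s: "summable (\<lambda>k. \<mu> k powr p)"
  shows "(\<integral>\<^sup>+z. ennreal (rberezin z powr p) \<partial>N) < \<infinity>"
proof -
  have "(\<integral>\<^sup>+z. ennreal (rberezin z powr p) \<partial>N)
      \<le> (\<integral>\<^sup>+z. (\<Sum>k. ennreal (\<mu> k powr p * eval_weight (e k) z)) \<partial>N)"
  proof (rule nn_integral_mono)
    fix z assume "z \<in> space N"
    then have z: "z \<in> ball 0 1" by simp
    note J = Jensen_conditions[OF z]
    have "(\<Sum>k. ennreal (\<mu> k powr p * eval_weight (e k) z)) = ennreal (\<Sum>k. \<mu> k powr p * eval_weight (e k) z)"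
      using p by (intro suminf_ennreal2 powr_mean_summable[OF J]) (auto intro!: mult_nonneg_nonneg J(1))
    then show "ennreal (rberezin z powr p) \<le> (\<Sum>k. ennreal (\<mu> k powr p * eval_weight (e k) z))"
      using Jensen_powr_ge[OF J p] by (simp add: ennreal_leI)
  qed
  also have "\<dots> = (\<Sum>k. \<integral>\<^sup>+z. ennreal (\<mu> k powr p * eval_weight (e k) z) \<partial>N)"
  proof (rule nn_integral_suminf)
    fix k
    have "(\<lambda>z. \<mu> k powr p * eval_weight (e k) z) \<in> borel_measurable N"
      by (intro borel_measurable_times borel_measurable_const eval_weight_measurable e_mem)
    then show "(\<lambda>z. ennreal (\<mu> k powr p * eval_weight (e k) z)) \<in> borel_measurable N" by measurable
  qed
  also have "\<dots> = ennreal (\<Sum>k. \<mu> k powr p / (\<alpha> + 1))"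
    unfolding nn_integral_eigen_weight using \<alpha>
    by (intro suminf_ennreal2 summable_divide s) auto
  finally show ?thesis by (simp add: le_less_trans[OF _ ennreal_less_top])
qed

text \<open>The reversed Jensen inequality is applied to finite sums, whose integrals bound the
  partial sums of the eigenvalue powers by I (\<alpha> + 1).\<close>

lemma summable_of_nn_integral_rberezin:
  assumes p: "0 < p" "p \<le> 1" and I: "(\<integral>\<^sup>+z. ennreal (rberezin z powr p) \<partial>N) = ennreal I" "0 \<le> I"
  shows "summable (\<lambda>k. \<mu> k powr p)"
proof (rule summableI_nonneg_bounded)
  fix n
  have "ennreal (\<Sum>k<n. \<mu> k powr p / (\<alpha> + 1)) = (\<Sum>k<n. ennreal (\<mu> k powr p / (\<alpha> + 1)))"
    using \<alpha> by (intro sum_ennreal[symmetric]) auto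
  also have "\<dots> = (\<Sum>k<n. \<integral>\<^sup>+z. ennreal (\<mu> k powr p * eval_weight (e k) z) \<partial>N)"
    by (simp only: nn_integral_eigen_weight)
  also have "\<dots> = (\<integral>\<^sup>+z. (\<Sum>k<n. ennreal (\<mu> k powr p * eval_weight (e k) z)) \<partial>N)"
  proof (rule nn_integral_sum[symmetric])
    fix k
    have "(\<lambda>z. \<mu> k powr p * eval_weight (e k) z) \<in> borel_measurable N"
      by (intro borel_measurable_times borel_measurable_const eval_weight_measurable e_mem)
    then show "(\<lambda>z. ennreal (\<mu> k powr p * eval_weight (e k) z)) \<in> borel_measurable N" by measurable
  qed
  also have "\<dots> \<le> (\<integral>\<^sup>+z. ennreal (rberezin z powr p) \<partial>N)"
  proof (rule nn_integral_mono)
    fix z assume "z \<in> space N"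
    then have z: "z \<in> ball 0 1" by simp
    note J = Jensen_conditions[OF z]
    have "(\<Sum>k<n. ennreal (\<mu> k powr p * eval_weight (e k) z)) = ennreal (\<Sum>k<n. \<mu> k powr p * eval_weight (e k) z)"
      by (intro sum_ennreal mult_nonneg_nonneg J(1)) auto
    then show "(\<Sum>k<n. ennreal (\<mu> k powr p * eval_weight (e k) z)) \<le> ennreal (rberezin z powr p)"
      using Jensen_powr_le[OF J p] by (simp add: ennreal_leI)
  qed
  also have "\<dots> = ennreal I" by (rule I(1))
  finally have "(\<Sum>k<n. \<mu> k powr p / (\<alpha> + 1)) \<le> I" using I(2) by (simp add: ennreal_le_iff)
  then show "(\<Sum>k<n. \<mu> k powr p) \<le> I * (\<alpha> + 1)"
    using \<alpha> by (simp add: sum_divide_distrib[symmetric] divide_le_eq)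
qed simp

lemma berezin_in_Lp:
  assumes p: "1 \<le> p" and s: "summable (\<lambda>k. \<mu> k powr p)"
  shows "berezin \<alpha> i T \<in> Lp_space (moebius_measure i) p"
proof -
  let ?R = "restrict_space borel (slice_disc i)"
  \<comment> \<open>On the slice disc \<open>coord\<close> is the inverse of \<open>emb\<close>; it
    carries measurability from the complex disc back to the slice.\<close>
  have c: "coord \<in> measurable ?R (restrict_space borel (ball 0 1))"
  proof (rule measurable_restrict_space3)
    show "coord \<in> borel_measurable borel"
      by (intro borel_measurable_continuous_onI linear_continuous_on bounded_linear_coord)
    show "coord \<in> slice_disc i \<rightarrow> ball 0 1" by (auto simp: slice_disc_eq)
  qed
  have "rberezin \<in> borel_measurable (restrict_space borel (ball 0 1))"
    using rberezin_measurable by (simp add: measurable_cong_sets[OF sets_disc_measure refl])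
  from measurable_compose[OF c this] have "(\<lambda>x. rberezin (coord x)) \<in> borel_measurable ?R" .
  then have "(\<lambda>x. of_real (rberezin (coord x)) :: quat) \<in> borel_measurable ?R"
    by (rule borel_measurable_continuous_on[OF linear_continuous_on[OF bounded_linear_of_real]])
  then have m: "berezin \<alpha> i T \<in> borel_measurable ?R"
    by (rule measurable_cong[THEN iffD1, rotated])
      (auto simp: space_restrict_space slice_disc_eq berezin_eq)
  have "integrable N (\<lambda>z. rberezin z powr p)"
    using nn_integral_rberezin_powr_finite[OF p s] rberezin_measurable
    by (intro integrableI_nonneg) auto
  then have "integrable N (\<lambda>z. norm (berezin \<alpha> i T (emb z)) powr p)"
    by (rule Bochner_Integration.integrable_cong[THEN iffD1, OF refl, rotated])
      (simp add: berezin_eq rberezin_nonneg)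
  moreover have "(\<lambda>x. norm (berezin \<alpha> i T x) powr p) \<in> borel_measurable ?R"
    using m by measurable
  ultimately have "integrable (moebius_measure i) (\<lambda>x. norm (berezin \<alpha> i T x) powr p)"
    unfolding moebius_measure_eq by (subst integrable_distr_eq[OF measurable_emb_disc])
  moreover have "berezin \<alpha> i T \<in> borel_measurable (moebius_measure i)"
    using m by (simp add: moebius_measure_eq)
  ultimately show ?thesis by (simp add: Lp_space_def)
qed

end

section \<open>The two implications\<close>

context bergman_operator
begin

lemma berezin_Lp_of_schatten:
  assumes p: "1 \<le> p" and T: "T \<in> schatten_class \<alpha> i J p"
  shows "berezin \<alpha> i T \<in> Lp_space (moebius_measure i) p"
proof -
  have c: "compact_op \<alpha> i T" and s: "summable (\<lambda>n. singular_value \<alpha> i T n powr p)"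
    using T by (auto simp: schatten_class_def)
  then obtain e \<mu> where spec: "spectral_operator (bergman \<alpha> i) (bip \<alpha> i) T C e \<mu>"
    using spectral_decomposition compact_op_iff[OF T_op T_operator] by blast
  interpret bergman_spectral i \<alpha> T C e \<mu>
    by (rule bergman_spectral.intro[OF bergman_operator_axioms bergman_spectral_axioms.intro[OF spec]])
  show ?thesis
    using s unfolding singular_value_eq[OF T_op T_positive spec] by (rule berezin_in_Lp[OF p])
qed

lemma schatten_of_berezin_Lp:
  assumes p: "0 < p" "p \<le> 1" and B: "berezin \<alpha> i T \<in> Lp_space (moebius_measure i) p"
    and J: "op_commutator \<alpha> i T J = zero_op \<alpha> i"
  shows "T \<in> schatten_class \<alpha> i J p"
proof -
  have "integrable (moebius_measure i) (\<lambda>x. norm (berezin \<alpha> i T x) powr p)"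
    using B by (simp add: Lp_space_def)
  then have "integrable N (\<lambda>z. norm (berezin \<alpha> i T (emb z)) powr p)"
    unfolding moebius_measure_eq by (rule integrable_distr[OF measurable_emb_disc])
  then have int: "integrable N (\<lambda>z. rberezin z powr p)"
    by (rule Bochner_Integration.integrable_cong[THEN iffD1, OF refl, rotated])
      (simp add: berezin_eq rberezin_nonneg)
  define I where "I = (LINT z|N. rberezin z powr p)"
  have I: "(\<integral>\<^sup>+z. ennreal (rberezin z powr p) \<partial>N) = ennreal I" "0 \<le> I"
    unfolding I_def by (subst nn_integral_eq_integral[OF int]) auto
  \<comment> \<open>The Berezin transform B is at most sqrt |C|, so B = B^(1 - p) B^p \<le> L B^p,
    and integrability of the p-th power passes to B. For p = 1 the convention
    \<open>0 powr 0 = 0\<close> is harmless: if L = 0, then B vanishes.\<close>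
  define L where "L = (sqrt \<bar>C\<bar>) powr (1 - p)"
  have "(\<integral>\<^sup>+z. ennreal (rberezin z) \<partial>N) \<le> (\<integral>\<^sup>+z. ennreal L * ennreal (rberezin z powr p) \<partial>N)"
  proof (rule nn_integral_mono)
    fix z assume "z \<in> space N"
    then have z: "z \<in> ball 0 1" by simp
    have "rberezin z = rberezin z powr (1 - p) * rberezin z powr p"
      using rberezin_nonneg[OF z] by (simp add: powr_add[symmetric])
    also have "\<dots> \<le> L * rberezin z powr p"
      unfolding L_def using p rberezin_nonneg[OF z] rberezin_bounded[OF z]
      by (intro mult_right_mono powr_mono2) auto
    finally show "ennreal (rberezin z) \<le> ennreal L * ennreal (rberezin z powr p)"
      by (simp add: ennreal_mult[symmetric] L_def ennreal_leI)
  qed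
  also have "\<dots> = ennreal L * ennreal I"
    using borel_measurable_integrable[OF int] by (subst nn_integral_cmult) (simp_all add: I(1))
  also have "\<dots> < \<infinity>" by (simp add: ennreal_mult_less_top)
  finally have cpt: T_compact by (rule compact_of_integrable_rberezin)
  then obtain e \<mu> where spec: "spectral_operator (bergman \<alpha> i) (bip \<alpha> i) T C e \<mu>"
    by (rule spectral_decomposition)
  interpret bergman_spectral i \<alpha> T C e \<mu>
    by (rule bergman_spectral.intro[OF bergman_operator_axioms bergman_spectral_axioms.intro[OF spec]])
  have "summable (\<lambda>n. singular_value \<alpha> i T n powr p)"
    unfolding singular_value_eq[OF T_op T_positive spec]
    by (rule summable_of_nn_integral_rberezin[OF p I])
  then show ?thesis
    using J cpt compact_op_iff[OF T_op T_operator] by (simp add: schatten_class_def)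
qed

end

theorem theorem5p14:
  fixes \<alpha> :: real and i :: quat and T :: qop
  assumes "\<alpha> > -1"
    and "i \<in> imag_sphere"
    and "T \<in> bounded_ops \<alpha> i"
    and "positive_op \<alpha> i T"
    and "op_commutator \<alpha> i T (J_op \<alpha> i) = zero_op \<alpha> i"
  shows "(\<forall>p::real. 1 \<le> p \<longrightarrow> T \<in> schatten_class \<alpha> i (J_op \<alpha> i) p \<longrightarrow>
            berezin \<alpha> i T \<in> Lp_space (moebius_measure i) p) \<and>
         (\<forall>p::real. 0 < p \<longrightarrow> p \<le> 1 \<longrightarrow> berezin \<alpha> i T \<in> Lp_space (moebius_measure i) p \<longrightarrow>
            T \<in> schatten_class \<alpha> i (J_op \<alpha> i) p)"
proof -
  interpret bergman_space i \<alpha> by unfold_locales (fact assms)+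
  obtain C where C: "positive_operator (bergman \<alpha> i) (bip \<alpha> i) T C"
    by (rule positive_operator_of_bounded[OF assms(3,4)])
  interpret bergman_operator i \<alpha> T C
    by (rule bergman_operator.intro[OF bergman_space_axioms bergman_operator_axioms.intro[OF assms(3,4) C]])
  show ?thesis
    using berezin_Lp_of_schatten schatten_of_berezin_Lp[OF _ _ _ assms(5)] by blast
qed

end
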